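(* Assume that $g$ is continuous and that condition (C) holds: in a small neighbourhood of the cycle $\widetilde{x}$ the system $\dot x=f(x)$ has no other $T$-periodic solutions (i.e. none other than $\widetilde{x}$ and its time shifts $\widetilde{x}^\theta$). Suppose that (A) for all $s,\theta\in[0,T]$, the equality $M_E^s(\theta)=0$ implies $M_A^s(\theta)\neq 0$. Then for all sufficiently small $\varepsilon>0$ every $T$-periodic solution $\widetilde{x}_\varepsilon$ of $\dot x=f(x)+\varepsilon g(t,x)$ satisfies $$\widetilde{x}_\varepsilon(t)\neq\widetilde{x}(s)\quad\text{for all } t,s\in[0,T].\qquad( * )$$ If in addition (B) $\mathrm{ind}(\widetilde{x},\Phi)\neq 1$, then for all sufficiently small $\varepsilon>0$ the system $\dot x=f(x)+\varepsilon g(t,x)$ has at least two $T$-periodic solutions $\widetilde{x}_{\varepsilon,1}$ and $\widetilde{x}_{\varepsilon,2}$ satisfying $( * )$. To these solutions there correspond $\theta_1,\theta_2\in[0,T]$ such that $$\widetilde{x}_{\varepsilon,1}(t)\to\widetilde{x}^{\theta_1}(t)\quad\text{and}\quad \widetilde{x}_{\varepsilon,2}(t)\to\widetilde{x}^{\theta_2}(t)\quad\text{as }\varepsilon\to0.$$ Moreover, $\widetilde{x}_{\varepsilon,1}$ lies inside the cycle $\widetilde{x}$ and $\widetilde{x}_{\varepsilon,2}$ lies outside it.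
   Context: Setting. $f:\mathbb{R}^2\to\mathbb{R}^2$ is continuously differentiable and every solution of $\dot x=f(x)$ extends to $(-\infty,\infty)$. $\widetilde{x}$ is a $T$-periodic cycle (nonconstant $T$-periodic solution, $T>0$) of $\dot x=f(x)$, positively oriented as a curve; $\widetilde{x}^\theta(t)=\widetilde{x}(\theta+t)$. The function $g:\mathbb{R}\times\mathbb{R}^2\to\mathbb{R}^2$ is $T$-periodic in its first variable. For $\xi\in\mathbb{R}^2$ put $\xi^\bot=(-\xi_2,\xi_1)$. Functions $M_E^s,M_A^s$. Let $\widetilde{z}$ and $\widehat{z}$ be the solutions of the adjoint system $\dot z=-(f'(\widetilde{x}(t)))^*z$ with $\widetilde{z}(0)=\dot{\widetilde{x}}(0)^\bot$ and $\widehat{z}(0)=\dot{\widetilde{x}}(0)/\|\dot{\widetilde{x}}(0)\|^2$. For $s,\theta\in[0,T]$ put $$M_E^s(\theta)=\int_{s-T+\theta}^{s+\theta}\langle\widetilde{z}(\tau),g(\tau-\theta,\widetilde{x}(\tau))\rangle d\tau,\qquad M_A^s(\theta)=\int_{s-T+\theta}^{s+\theta}\langle\widehat{z}(\tau),g(\tau-\theta,\widetilde{x}(\tau))\rangle d\tau,$$ and $M_E:=M_E^0$, $M_A:=M_A^0$. Field $\Phi$ and index. $\Phi$ is the vector field given on the cycle by $\Phi(\widetilde{x}(\theta))=M_E(\theta)\dot{\widetilde{x}}(\theta)^\bot+M_A(\theta)\dot{\widetilde{x}}(\theta)$. The Poincaré index $\mathrm{ind}(\widetilde{x},\Phi)$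 of the cycle $\widetilde{x}$ with respect to $\Phi$ is the number of turns made by the vector $\Phi(\widetilde{x}(\theta))$ as $\theta$ goes from $0$ to $T$.
   Formalization: The phases θ₁, θ₂ may depend on ε, with x_{ε,i}(t) − x̃(θ_i(ε)+t) → 0, since fixed phases can fail; T is the least period of the cycle; the index is the number of turns of Φ rounded to the nearest integer, since Φ need not close up. *)

theory Defs
  imports "HOL-Complex_Analysis.Complex_Analysis"
begin

definition solves_ode_on ::
    "(real \<Rightarrow> real^2 \<Rightarrow> real^2) \<Rightarrow> (real \<Rightarrow> real^2) \<Rightarrow> real set \<Rightarrow> bool" where
  "solves_ode_on F x J \<longleftrightarrow>
     (\<forall>t\<in>J. (x has_vector_derivative F t (x t)) (at t within J))"

definition periodic_solution ::
    "real \<Rightarrow> (real \<Rightarrow> real^2 \<Rightarrow> real^2) \<Rightarrow> (real \<Rightarrow> real^2) \<Rightarrow> bool" where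
  "periodic_solution T F x \<longleftrightarrow> solves_ode_on F x UNIV \<and> (\<forall>t. x (t + T) = x t)"

definition solutions_extend :: "(real^2 \<Rightarrow> real^2) \<Rightarrow> bool" where
  "solutions_extend f \<longleftrightarrow>
     (\<forall>J x. open J \<and> is_interval J \<and> solves_ode_on (\<lambda>t. f) x J \<longrightarrow>
        (\<exists>y. solves_ode_on (\<lambda>t. f) y UNIV \<and> (\<forall>t\<in>J. y t = x t)))"

definition perp :: "real^2 \<Rightarrow> real^2" where
  "perp \<xi> = vector [- (\<xi> $ 2), \<xi> $ 1]"

text \<open>A loop parametrised by \<open>{0..T}\<close>, as a path in the complex plane over the
  unit interval; this is the setting in which the library has winding numbers.\<close>

definition complex_path :: "real \<Rightarrow> (real \<Rightarrow> real^2) \<Rightarrow> real \<Rightarrow> complex" where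
  "complex_path T v = (\<lambda>u. Complex (v (T * u) $ 1) (v (T * u) $ 2))"

text \<open>A positively oriented \<open>T\<close>-periodic cycle runs exactly once around the curve as
  \<open>t\<close> goes from \<open>0\<close> to \<open>T\<close>: \<open>T\<close> is its least period. Otherwise a field on the
  cycle could not be prescribed as a function of the parameter \<open>\<theta> \<in> {0..T}\<close>.\<close>

definition positively_oriented :: "real \<Rightarrow> (real \<Rightarrow> real^2) \<Rightarrow> bool" where
  "positively_oriented T x \<longleftrightarrow>
     simple_path (complex_path T x) \<and>
     (\<forall>w \<in> inside (path_image (complex_path T x)). winding_number (complex_path T x) w = 1)"

definition cycle :: "real \<Rightarrow> (real^2 \<Rightarrow> real^2) \<Rightarrow> (real \<Rightarrow> real^2) \<Rightarrow> bool" where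
  "cycle T f x \<longleftrightarrow>
     T > 0 \<and> periodic_solution T (\<lambda>t. f) x \<and> (\<exists>t. x t \<noteq> x 0)"

text \<open>\<open>A t\<close> is the Jacobian matrix of \<open>f\<close> along the cycle.\<close>

definition adjoint_solution :: "(real \<Rightarrow> real^2^2) \<Rightarrow> (real \<Rightarrow> real^2) \<Rightarrow> bool" where
  "adjoint_solution A z \<longleftrightarrow> solves_ode_on (\<lambda>t y. - (transpose (A t) *v y)) z UNIV"

text \<open>With \<open>z\<close> the solution of the adjoint system starting at \<open>x'(0)\<^sup>\<bottom>\<close>,
  respectively at \<open>x'(0) / |x'(0)|\<^sup>2\<close>, this is \<open>M\<^sub>E\<^sup>s(\<theta>)\<close>, respectively \<open>M\<^sub>A\<^sup>s(\<theta>)\<close>.\<close>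

definition bif_fun ::
    "real \<Rightarrow> (real \<Rightarrow> real^2 \<Rightarrow> real^2) \<Rightarrow> (real \<Rightarrow> real^2) \<Rightarrow> (real \<Rightarrow> real^2) \<Rightarrow>
     real \<Rightarrow> real \<Rightarrow> real" where
  "bif_fun T g x z s \<theta> =
     integral {s - T + \<theta> .. s + \<theta>} (\<lambda>\<tau>. z \<tau> \<bullet> g (\<tau> - \<theta>) (x \<tau>))"

text \<open>The value of the field \<open>\<Phi>\<close> at the point \<open>x \<theta>\<close> of the cycle.\<close>

definition Phi_field ::
    "real \<Rightarrow> (real \<Rightarrow> real^2 \<Rightarrow> real^2) \<Rightarrow> (real \<Rightarrow> real^2) \<Rightarrow>
     (real \<Rightarrow> real^2) \<Rightarrow> (real \<Rightarrow> real^2) \<Rightarrow> real \<Rightarrow> real^2" where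
  "Phi_field T g x zE zA \<theta> =
     bif_fun T g x zE 0 \<theta> *\<^sub>R perp (vector_derivative x (at \<theta>)) +
     bif_fun T g x zA 0 \<theta> *\<^sub>R vector_derivative x (at \<theta>)"

text \<open>The number of turns of \<open>V \<theta>\<close> as \<open>\<theta>\<close> goes from \<open>0\<close> to \<open>T\<close>. The real part of the
  winding number is the total change of argument divided by \<open>2 \<pi>\<close>. If \<open>V T = V 0\<close> it is an
  integer and the rounding does nothing. The field \<open>\<Phi>\<close> need not close up: with \<open>c > 0\<close> given
  by \<open>z\<^sub>E(T) = c z\<^sub>E(0)\<close> (in general \<open>c \<noteq> 1\<close>) and \<open>z\<^sub>A(T) = z\<^sub>A(0) + a z\<^sub>E(0)\<close>, one has
  \<open>M\<^sub>E(T) = c M\<^sub>E(0)\<close> and \<open>M\<^sub>A(T) = M\<^sub>A(0) + a M\<^sub>E(0)\<close>. So its two end values are equal or lie in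
  a common open half-plane, the change of argument differs from a whole number of turns by
  less than half a turn, and that whole number, the index, is the nearest integer.\<close>

definition poincare_index :: "real \<Rightarrow> (real \<Rightarrow> real^2) \<Rightarrow> int" where
  "poincare_index T V = round (Re (winding_number (complex_path T V) 0))"

definition isolated_cycle :: "real \<Rightarrow> (real^2 \<Rightarrow> real^2) \<Rightarrow> (real \<Rightarrow> real^2) \<Rightarrow> bool" where
  "isolated_cycle T f x \<longleftrightarrow>
     (\<exists>U. open U \<and> range x \<subseteq> U \<and>
       (\<forall>y. periodic_solution T (\<lambda>t. f) y \<and> range y \<subseteq> U \<longrightarrow>
          (\<exists>\<theta>. \<forall>t. y t = x (\<theta> + t))))"

definition avoids_cycle :: "real \<Rightarrow> (real \<Rightarrow> real^2) \<Rightarrow> (real \<Rightarrow> real^2) \<Rightarrow> bool" where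
  "avoids_cycle T x y \<longleftrightarrow> (\<forall>t\<in>{0..T}. \<forall>s\<in>{0..T}. y t \<noteq> x s)"

text \<open>The family \<open>y \<epsilon>\<close> converges to time shifts \<open>t \<mapsto> x (\<theta> + t)\<close> of the cycle: to each solution
  \<open>y \<epsilon>\<close> there corresponds a phase \<open>\<theta> \<epsilon> \<in> {0..T}\<close>. Convergence to a single phase holds along
  sequences \<open>\<epsilon>\<^sub>n \<rightarrow> 0\<close> with \<open>\<theta> \<epsilon>\<^sub>n\<close> convergent; when the limit phase is degenerate, the phases
  can oscillate as \<open>\<epsilon> \<rightarrow> 0\<close>, even if the periodic solutions near the cycle are unique
  inside and outside it.\<close>

definition tends_to_shifts ::
    "real \<Rightarrow> (real \<Rightarrow> real^2) \<Rightarrow> (real \<Rightarrow> real \<Rightarrow> real^2) \<Rightarrow> (real \<Rightarrow> real) \<Rightarrow> bool" where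
  "tends_to_shifts T x y \<theta> \<longleftrightarrow>
     (\<forall>\<epsilon>. \<theta> \<epsilon> \<in> {0..T}) \<and>
     (\<forall>t. ((\<lambda>\<epsilon>. y \<epsilon> t - x (\<theta> \<epsilon> + t)) \<longlongrightarrow> 0) (at_right 0))"

end

theory Submission
  imports Defs
begin

text \<open>
  Let \<open>P\<^sub>\<epsilon>\<close> be the translation operator of the perturbed system over one period. Expanding a solution that
  starts on the cycle to first order in \<open>\<epsilon>\<close> and pairing it with the solutions of the adjoint system shows that
  \<open>P\<^sub>\<epsilon> \<xi> - \<xi> = \<epsilon> W(\<xi>) + o(\<epsilon>)\<close> on the cycle, where \<open>W\<close> is \<open>\<Phi>\<close> up to a triangular change of the frame of
  tangent and normal. By (A) neither vanishes, so for small \<open>\<epsilon>\<close> no periodic solution meets the cycle and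
  \<open>P\<^sub>\<epsilon> - id\<close> turns \<open>ind(x, \<Phi>)\<close> times along it. On loops close to the cycle but off it, on a fixed side,
  \<open>P\<^sub>0 - id\<close> turns exactly once: if no point of such a loop has a period in \<open>[T/2, T]\<close>, then
  \<open>P\<^sub>0 - id\<close> is homotopic through the displacements over shorter times to the vector field \<open>f\<close>, which turns once by
  Hopf's theorem; otherwise a periodic orbit of period \<open>u < T\<close> serves as the loop, and along it the displacement
  over time \<open>T\<close> is the one over time \<open>T - u\<close>. If \<open>ind(x, \<Phi>) \<noteq> 1\<close>, the two numbers of turns differ, and \<open>P\<^sub>\<epsilon>\<close>
  has a fixed point between the loop and the cycle, on either side.

  As \<open>g\<close> is only continuous, \<open>P\<^sub>\<epsilon>\<close> need not exist. It is replaced by the operators of systems with polynomial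
  approximations of \<open>g\<close>, and the periodic solutions are limits given by the theorem of Arzela and Ascoli.
\<close>

subsection \<open>Ordinary differential equations\<close>

text \<open>On the cycle itself the unperturbed displacement over one period has no direction, since
  every point of the cycle is fixed. Hence the loops off the cycle, where (C) excludes fixed points;
  a perturbed displacement without zeros in the closed collar between loop and cycle carries the
  count from one to the other. The time \<open>T / 2\<close> separates two ranges: over shorter
  times the displacement can be divided by the elapsed time, and between \<open>T / 2\<close> and
  \<open>T\<close> the only danger near the cycle is a return slightly before \<open>T\<close>. (A)
  concerns all windows \<open>s\<close> because a periodic solution may meet any point of the cycle
  at any phase of the forcing. The field \<Phi> need not close up over a period, whereas
  \<open>W\<close> does: the monodromy of the adjoint system changes the frame and the integrals
  alike. As \<open>f\<close> is Lipschitz on bounded sets only, it is composed with the projection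
  onto a ball that contains the 1-neighbourhood of the cycle, and the solutions obtained are shown
  to stay in that ball.\<close>

lemma gronwall_integral:
  fixes e :: "real \<Rightarrow> real"
  assumes "a \<le> b" and cont: "continuous_on {a..b} e" and L: "0 \<le> L"
    and le: "\<And>t. t \<in> {a..b} \<Longrightarrow> e t \<le> A + L * integral {a..t} e"
    and t: "t \<in> {a..b}"
  shows "e t \<le> A * exp (L * (t - a))"
proof -
  define I where "I t = A + L * integral {a..t} e" for t
  have I': "(I has_real_derivative L * e s) (at s within {a..b})" if "s \<in> {a..b}" for s
  proof -
    have "((\<lambda>u. integral {a..u} e) has_real_derivative e s) (at s within {a..b})"
      using integral_has_real_derivative[OF cont that] .
    then show ?thesis unfolding I_def
      by (auto intro!: derivative_eq_intros)
  qed
  \<comment> \<open>\<open>I\<close> bounds \<open>e\<close>, so the derivative of the damped bound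
    \<open>J\<close> is nowhere positive.\<close>
  define J where "J s = I s * exp (- L * (s - a))" for s
  have J': "(J has_real_derivative (L * e s - L * I s) * exp (- L * (s - a))) (at s within {a..b})"
    if "s \<in> {a..b}" for s
    unfolding J_def
    by (rule derivative_eq_intros I' that refl)+ (simp add: algebra_simps)
  have "J t \<le> J a"
  proof -
    have "\<exists>z\<in>{a..t}. J t - J a = (L * e z - L * I z) * exp (- L * (z - a)) * (t - a)"
    proof (rule mvt_very_simple)
      show "(J has_derivative (*) ((L * e s - L * I s) * exp (- L * (s - a)))) (at s within {a..t})"
        if "a \<le> s" "s \<le> t" for s
        using DERIV_subset[OF J', of s "{a..t}"] that t by (auto simp: has_field_derivative_def)
    qed (use t in auto)
    then obtain z where z: "z \<in> {a..t}"
      and eq: "J t - J a = (L * e z - L * I z) * exp (- L * (z - a)) * (t - a)" by blast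
    have "e z \<le> I z" using le[of z] z t by (auto simp: I_def)
    then have "L * e z \<le> L * I z" using L by (rule mult_left_mono)
    then have "(L * e z - L * I z) * exp (- L * (z - a)) * (t - a) \<le> 0"
      using t by (intro mult_nonpos_nonneg) auto
    then show ?thesis using eq by linarith
  qed
  moreover have "J a = A" by (simp add: J_def I_def)
  moreover have "I t = J t * exp (L * (t - a))" by (simp add: J_def mult.assoc flip: exp_add)
  ultimately have "I t \<le> A * exp (L * (t - a))"
    by (simp add: mult_right_mono)
  then show ?thesis using le[OF t] by (simp add: I_def)
qed

lemma norm_gronwall:
  fixes u :: "real \<Rightarrow> 'a::euclidean_space"
  assumes "a \<le> b" and L: "0 \<le> L" and M: "0 \<le> M"
    and der: "\<And>t. t \<in> {a..b} \<Longrightarrow> (u has_vector_derivative u' t) (at t within {a..b})"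
    and le: "\<And>t. t \<in> {a..b} \<Longrightarrow> norm (u' t) \<le> L * norm (u t) + M"
    and t: "t \<in> {a..b}"
  shows "norm (u t) \<le> (norm (u a) + M * (b - a)) * exp (L * (t - a))"
proof -
  have cont: "continuous_on {a..b} u"
    using der by (rule continuous_on_vector_derivative)
  have contn: "continuous_on {a..b} (\<lambda>s. norm (u s))" by (intro continuous_intros cont)
  show ?thesis
  proof (rule gronwall_integral[OF \<open>a \<le> b\<close> contn L _ t])
    fix s assume s: "s \<in> {a..b}"
    have int: "(u' has_integral (u s - u a)) {a..s}"
      by (rule fundamental_theorem_of_calculus)
        (use s in \<open>auto intro!: has_vector_derivative_within_subset[OF der]\<close>)
    have cs: "continuous_on {a..s} (\<lambda>s. norm (u s))"
      using contn by (rule continuous_on_subset) (use s in auto)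
    have i2: "(\<lambda>r. norm (u r)) integrable_on {a..s}"
      by (rule integrable_continuous_real[OF cs])
    have "norm (integral {a..s} u') \<le> integral {a..s} (\<lambda>r. L * norm (u r) + M)"
    proof (rule integral_norm_bound_integral)
      show "u' integrable_on {a..s}" using int by blast
      show "(\<lambda>r. L * norm (u r) + M) integrable_on {a..s}"
        by (intro integrable_continuous_real continuous_intros cs)
    qed (use le s in auto)
    also have "\<dots> = L * integral {a..s} (\<lambda>r. norm (u r)) + M * (s - a)"
      using s i2 by (subst Henstock_Kurzweil_Integration.integral_add) 
        (auto intro!: integrable_continuous_real continuous_intros cs)
    finally have "norm (u s - u a) \<le> L * integral {a..s} (\<lambda>r. norm (u r)) + M * (s - a)"
      using int by (simp add: integral_unique)
    moreover have "M * (s - a) \<le> M * (b - a)" using M s by (intro mult_left_mono) auto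
    ultimately show "norm (u s) \<le> norm (u a) + M * (b - a) + L * integral {a..s} (\<lambda>r. norm (u r))"
      using norm_triangle_ineq2[of "u s" "u a"] by linarith
  qed
qed

lemma ode_integral_form:
  fixes X :: "real \<Rightarrow> 'a::euclidean_space"
  assumes "continuous_on {a..b} X" and "\<And>t. t \<in> {a..b} \<Longrightarrow> x t = c + integral {a..t} X"
    and t: "t \<in> {a..b}"
  shows "(x has_vector_derivative X t) (at t within {a..b})"
proof -
  have "((\<lambda>u. c + integral {a..u} X) has_vector_derivative X t) (at t within {a..b})"
    using integral_has_vector_derivative[OF assms(1) t]
    by (auto intro!: derivative_eq_intros)
  then show ?thesis
    by (rule has_vector_derivative_transform[OF t, rotated]) (use assms in auto)
qed

text \<open>Banach's fixed point theorem for \<open>u t = exp (- K t) x t\<close>: the weight makes the Picard operator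
  a contraction on the whole interval at once.\<close>

lemma picard_lindelof:
  fixes X :: "real \<Rightarrow> 'a::euclidean_space \<Rightarrow> 'a"
  assumes "0 \<le> T" and cont: "continuous_on ({0..T} \<times> UNIV) (\<lambda>(t, x). X t x)"
    and L: "0 \<le> L" and lip: "\<And>t x y. t \<in> {0..T} \<Longrightarrow> norm (X t x - X t y) \<le> L * norm (x - y)"
  obtains x where "x 0 = \<xi>"
    "\<And>t. t \<in> {0..T} \<Longrightarrow> (x has_vector_derivative X t (x t)) (at t within {0..T})"
proof -
  \<comment> \<open>The contraction constant is \<open>L / K\<close>, at most 1/2; the summand 1
    keeps \<open>K\<close> positive when \<open>L = 0\<close>.\<close>
  define K where "K = 2 * L + 1"
  have K: "K > 0" using L by (simp add: K_def)
  define G where "G u t = \<xi> + integral {0..t} (\<lambda>s. X s (exp (K * s) *\<^sub>R u s))" for u t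
  define \<Psi> where "\<Psi> u t = exp (- K * t) *\<^sub>R G u t" for u t
  have ci: "continuous_on {0..T} (\<lambda>s. X s (exp (K * s) *\<^sub>R u s))" if "continuous_on {0..T} u" for u
  proof -
    have "continuous_on {0..T} ((\<lambda>(t, x). X t x) \<circ> (\<lambda>s. (s, exp (K * s) *\<^sub>R u s)))"
      by (intro continuous_on_compose continuous_intros that continuous_on_subset[OF cont]) auto
    then show ?thesis by (simp add: o_def)
  qed
  have c\<Psi>: "continuous_on (cbox 0 T) (\<Psi> u)" if "continuous_on {0..T} u" for u
  proof -
    have "continuous_on {0..T} (\<lambda>t. integral {0..t} (\<lambda>s. X s (exp (K * s) *\<^sub>R u s)))"
      by (intro indefinite_integral_continuous_1 integrable_continuous_real ci that)
    then show ?thesis unfolding \<Psi>_def G_def by (auto intro!: continuous_intros)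
  qed
  \<comment> \<open>The complete space is that of bounded continuous functions on the whole line.
    \<open>clamp\<close> continues \<open>\<Psi> u\<close> from \<open>{0..T}\<close> by its end
    values, and only the restriction of the fixed point to \<open>{0..T}\<close> is used
    afterwards.\<close>
  have "\<exists>h::real \<Rightarrow>\<^sub>C 'a. \<forall>t. h t = \<Psi> u (clamp 0 T t)" if "continuous_on {0..T} u" for u
    using continuous_on_cbox_bcontfunE[OF c\<Psi>[OF that]] by (metis ext_cont_def)
  then have "\<forall>u::real \<Rightarrow>\<^sub>C 'a. \<exists>h::real \<Rightarrow>\<^sub>C 'a. \<forall>t. h t = \<Psi> u (clamp 0 T t)"
    by simp
  from choice[OF this] obtain H :: "(real \<Rightarrow>\<^sub>C 'a) \<Rightarrow> (real \<Rightarrow>\<^sub>C 'a)"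
    where H: "\<And>u t. H u t = \<Psi> u (clamp 0 T t)" 
    by blast
  have cl: "clamp 0 T t \<in> {0..T}" for t
    using clamp_in_interval[of 0 T t] \<open>0 \<le> T\<close> by simp
  have "dist (H u) (H v) \<le> (1/2) * dist u v" for u v
  proof (rule dist_bound)
    fix t
    define s where "s = clamp 0 T t"
    have s: "s \<in> {0..T}" using cl by (simp add: s_def)
    let ?I = "\<lambda>u. \<lambda>r. X r (exp (K * r) *\<^sub>R apply_bcontfun u r)"
    have int: "?I u integrable_on {0..s}" for u
    proof (rule integrable_continuous_real)
      have "continuous_on {0..T} u" by simp
      from ci[OF this] show "continuous_on {0..s} (?I u)"
        by (rule continuous_on_subset) (use s in auto)
    qed
    have e1: "\<Psi> u s - \<Psi> v s = exp (- K * s) *\<^sub>R (integral {0..s} (\<lambda>r. ?I u r - ?I v r))"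
      by (simp add: \<Psi>_def G_def Henstock_Kurzweil_Integration.integral_diff[OF int int] scaleR_diff_right scaleR_add_right)
    have e2: "norm (integral {0..s} (\<lambda>r. ?I u r - ?I v r)) \<le> integral {0..s} (\<lambda>r. (L * dist u v) * exp (K * r))"
    proof (rule integral_norm_bound_integral)
      show "(\<lambda>r. ?I u r - ?I v r) integrable_on {0..s}" by (intro integrable_diff int)
      show "(\<lambda>r. (L * dist u v) * exp (K * r)) integrable_on {0..s}"
        by (intro integrable_continuous_real continuous_intros)
      fix r assume r: "r \<in> {0..s}"
      have "norm (?I u r - ?I v r) \<le> L * norm (exp (K * r) *\<^sub>R (u r - v r))"
        using lip[of r "exp (K * r) *\<^sub>R u r" "exp (K * r) *\<^sub>R v r"] r s by (simp add: scaleR_diff_right)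
      also have "\<dots> = L * exp (K * r) * dist (u r) (v r)" by (simp add: dist_norm)
      also have "\<dots> \<le> L * exp (K * r) * dist u v" using L by (intro mult_left_mono dist_bounded) auto
      finally show "norm (?I u r - ?I v r) \<le> L * dist u v * exp (K * r)" by (simp add: algebra_simps)
    qed
    have e3: "integral {0..s} (\<lambda>r. (L * dist u v) * exp (K * r)) = (L * dist u v) * ((exp (K * s) - 1) / K)"
    proof -
      have "((\<lambda>r. exp (K * r)) has_integral (exp (K * s) / K - exp (K * 0) / K)) {0..s}"
        by (rule fundamental_theorem_of_calculus)
          (use s K in \<open>auto intro!: derivative_eq_intros simp: has_real_derivative_iff_has_vector_derivative[symmetric]\<close>)
      then show ?thesis by (simp add: integral_unique diff_divide_distrib)
    qed
    have "norm (\<Psi> u s - \<Psi> v s) \<le> exp (- K * s) * ((L * dist u v) * ((exp (K * s) - 1) / K))"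
      using mult_left_mono[OF e2[unfolded e3], of "exp (- K * s)"] by (simp add: e1)
    also have "\<dots> = dist u v * (L / K * (1 - exp (- K * s)))"
      using K by (simp add: exp_minus field_simps)
    also have "\<dots> \<le> dist u v * (L / K * 1)"
      using K L by (intro mult_left_mono) auto
    also have "\<dots> \<le> dist u v * (1/2)"
      using L by (intro mult_left_mono) (auto simp: K_def field_simps)
    finally show "dist (H u t) (H v t) \<le> (1/2) * dist u v"
      by (simp add: H s_def dist_norm algebra_simps)
  qed
  then obtain u where u: "H u = u"
    using banach_fix_type[of "1/2" H] by auto
  have ut: "u t = \<Psi> u t" if "t \<in> {0..T}" for t
  proof -
    have "clamp 0 T t = t" using that by (simp add: clamp_cancel_cbox)
    then show ?thesis by (metis H u)
  qed
  show ?thesis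
  proof (rule that)
    let ?x = "\<lambda>t. exp (K * t) *\<^sub>R u t"
    show "?x 0 = \<xi>" using ut[of 0] \<open>0 \<le> T\<close> by (simp add: \<Psi>_def G_def)
    show "(?x has_vector_derivative X t (?x t)) (at t within {0..T})" if "t \<in> {0..T}" for t
    proof (rule ode_integral_form[OF ci _ that])
      show "exp (K * t) *\<^sub>R apply_bcontfun u t = \<xi> + integral {0..t} (\<lambda>a. X a (exp (K * a) *\<^sub>R apply_bcontfun u a))"
        if "t \<in> {0..T}" for t
        by (subst ut[OF that]) (simp add: \<Psi>_def G_def flip: exp_add)
    qed auto
  qed
qed

text \<open>At a first time \<open>s\<close> with \<open>c \<le> e s\<close> all earlier values lie
  below \<open>c\<close>. By continuity the weak bound then holds up to and including
  \<open>s\<close>, and the gain from weak to strict in \<open>step\<close> rules such a time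
  out.\<close>

lemma continuity_bootstrap:
  fixes e :: "real \<Rightarrow> real"
  assumes cont: "continuous_on {a..b} e" and "e a < c"
    and step: "\<And>t. t \<in> {a..b} \<Longrightarrow> (\<And>s. s \<in> {a..t} \<Longrightarrow> e s \<le> c) \<Longrightarrow> e t < c"
    and t: "t \<in> {a..b}"
  shows "e t < c"
proof (rule ccontr)
  assume "\<not> e t < c"
  define S where "S = {s \<in> {a..t}. c \<le> e s}"
  have cont': "continuous_on {a..t} e" using cont by (rule continuous_on_subset) (use t in auto)
  have "closed S"
    unfolding S_def using continuous_closed_preimage[OF cont', of "{c..}"] by (auto simp: vimage_def Int_def conj_commute)
  moreover have "bounded S" by (rule bounded_subset[of "{a..t}"]) (auto simp: S_def)
  ultimately have "compact S" by (simp add: compact_eq_bounded_closed)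
  moreover have "t \<in> S" using \<open>\<not> e t < c\<close> t by (auto simp: S_def)
  ultimately obtain s where s: "s \<in> S" "\<And>r. r \<in> S \<Longrightarrow> s \<le> r"
    using compact_attains_inf[of S] by blast
  have "a < s" using s(1) \<open>e a < c\<close> by (cases "a = s") (auto simp: S_def)
  have lt: "e r < c" if "r \<in> {a..<s}" for r
    using s(2)[of r] that s(1) by (force simp: S_def not_le)
  have "e s < c"
  proof (rule step)
    show "s \<in> {a..b}" using s t by (auto simp: S_def)
    have "e s \<le> c"
    proof (rule tendsto_upperbound)
      show "(e \<longlongrightarrow> e s) (at s within {a..<s})"
      proof (rule tendsto_within_subset)
        show "(e \<longlongrightarrow> e s) (at s within {a..b})"
          using cont s(1) t by (auto simp: continuous_on_def S_def)
      qed (use s(1) t in \<open>auto simp: S_def\<close>)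
      show "\<forall>\<^sub>F r in at s within {a..<s}. e r \<le> c"
        using lt by (auto simp: eventually_at_filter less_imp_le)
      show "at s within {a..<s} \<noteq> bot" using \<open>a < s\<close> by (simp add: at_within_eq_bot_iff)
    qed
    then show "e r \<le> c" if "r \<in> {a..s}" for r
      using lt[of r] that by (cases "r = s") auto
  qed
  then show False using s by (auto simp: S_def)
qed

section \<open>Gluing a solution over successive periods\<close>

lemma has_vector_derivative_Un:
  assumes "(y has_vector_derivative D) (at t within A)" "(y has_vector_derivative D) (at t within B)"
  shows "(y has_vector_derivative D) (at t within (A \<union> B))"
  using assms by (auto simp: has_vector_derivative_def has_derivative_within Lim_within_Un)

lemma periodic_int:
  fixes F :: "real \<Rightarrow> 'a"
  assumes per: "\<And>t. F (t + T) = F t"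
  shows "F (t + of_int k * T) = F t"
proof (induction k rule: int_induct[where k = 0])
  case (step1 i)
  then show ?case using per[of "t + of_int i * T"] by (simp add: algebra_simps)
next
  case (step2 i)
  then show ?case using per[of "t + of_int (i - 1) * T"] by (simp add: algebra_simps)
qed simp

lemma periodic_extension:
  assumes T: "0 < T" and per: "\<And>t x. F (t + T) x = F t x"
    and sol: "solves_ode_on F y {0..T}" and close: "y T = y 0"
  obtains x where "periodic_solution T F x" "\<And>t. t \<in> {0..T} \<Longrightarrow> x t = y t"
proof -
  define x where "x t = y (t - of_int \<lfloor>t / T\<rfloor> * T)" for t
  have perk: "F (t + of_int k * T) = F t" for t k
    by (rule periodic_int) (use per in auto)
  \<comment> \<open>Because \<open>y T = y 0\<close>, the formula also holds at the right end of
    each closed period interval, so both one-sided derivatives at a seam come from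
    \<open>y\<close>.\<close>
  have x_eq: "x t = y (t - of_int k * T)" if "t \<in> {of_int k * T .. of_int (k + 1) * T}" for t k
  proof (cases "t = of_int (k + 1) * T")
    case True
    then have "t / T = of_int (k + 1)" using T by simp
    then have "\<lfloor>t / T\<rfloor> = k + 1" by (simp only: floor_of_int)
    then show ?thesis unfolding x_def True using close by (simp add: algebra_simps)
  next
    case False
    then have "of_int k * T \<le> t" "t < (of_int k + 1) * T" using that by auto
    then have "of_int k \<le> t / T" "t / T < of_int k + 1" using T by (simp_all add: field_simps)
    then have "\<lfloor>t / T\<rfloor> = k" by linarith
    then show ?thesis by (simp add: x_def)
  qed
  have der: "(x has_vector_derivative F t (x t)) (at t within {of_int k * T .. of_int (k + 1) * T})"
    if t: "t \<in> {of_int k * T .. of_int (k + 1) * T}" for t k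
  proof -
    let ?I = "{of_int k * T .. of_int (k + 1) * T}"
    have im: "(\<lambda>s. s - of_int k * T) ` ?I \<subseteq> {0..T}" by (auto simp: algebra_simps)
    have "(y has_vector_derivative F (t - of_int k * T) (y (t - of_int k * T)))
        (at (t - of_int k * T) within {0..T})"
      using sol im t unfolding solves_ode_on_def by blast
    then have "(y has_vector_derivative F (t - of_int k * T) (y (t - of_int k * T)))
        (at (t - of_int k * T) within ((\<lambda>s. s - of_int k * T) ` ?I))"
      using im by (rule has_vector_derivative_within_subset)
    moreover have "((\<lambda>s. s - of_int k * T) has_vector_derivative 1) (at t within ?I)"
      by (auto intro!: derivative_eq_intros)
    ultimately have "(y \<circ> (\<lambda>s. s - of_int k * T) has_vector_derivative
        1 *\<^sub>R F (t - of_int k * T) (y (t - of_int k * T))) (at t within ?I)"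
      by (intro vector_diff_chain_within) auto
    moreover have "F (t - of_int k * T) = F t" using perk[of "t - of_int k * T" k] by simp
    ultimately have "((\<lambda>s. y (s - of_int k * T)) has_vector_derivative F t (x t)) (at t within ?I)"
      by (simp add: o_def x_eq[OF t])
    then show ?thesis by (rule has_vector_derivative_transform[OF t, rotated]) (use x_eq in auto)
  qed
  have "(x has_vector_derivative F t (x t)) (at t)" for t
  proof -
    define k where "k = \<lfloor>t / T\<rfloor>"
    have k: "of_int k * T \<le> t" "t < (of_int k + 1) * T"
      unfolding k_def by (rule floor_divide_lower[OF T], rule floor_divide_upper[OF T])
    have R: "(x has_vector_derivative F t (x t)) (at t within {of_int k * T .. of_int (k + 1) * T})"
      by (rule der) (use k in auto)
    \<comment> \<open>Away from the seam \<open>t\<close> lies outside the closed interval on the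
      left; the filter is then \<open>bot\<close> and the derivative statement holds
      vacuously.\<close>
    have L: "(x has_vector_derivative F t (x t)) (at t within {of_int (k - 1) * T .. of_int (k - 1 + 1) * T})"
    proof (cases "t = of_int k * T")
      case True then show ?thesis by (intro der) (use T in \<open>auto simp: algebra_simps\<close>)
    next
      case False
      then have "t \<notin> {of_int (k - 1) * T .. of_int (k - 1 + 1) * T}" using k by auto
      then have "at t within {of_int (k - 1) * T .. of_int (k - 1 + 1) * T} = bot"
        by (simp add: at_within_eq_bot_iff)
      then show ?thesis by (simp add: has_vector_derivative_def has_derivative_def bounded_linear_scaleR_left)
    qed
    have U: "{of_int (k - 1) * T .. of_int (k - 1 + 1) * T} \<union> {of_int k * T .. of_int (k + 1) * T}
        = {of_int (k - 1) * T .. of_int (k + 1) * T}" using T by (auto simp: algebra_simps)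
    have "(x has_vector_derivative F t (x t)) (at t within {of_int (k - 1) * T .. of_int (k + 1) * T})"
      using has_vector_derivative_Un[OF L R] unfolding U .
    moreover have "t \<in> {of_int (k - 1) * T <..< of_int (k + 1) * T}" 
      using k T by (auto simp: algebra_simps)
    ultimately show ?thesis
      by (metis at_within_Icc_at greaterThanLessThan_iff)
  qed
  moreover have "x (t + T) = x t" for t
  proof -
    have "(t + T) / T = t / T + 1" using T by (simp add: field_simps)
    then have "\<lfloor>(t + T) / T\<rfloor> = \<lfloor>t / T\<rfloor> + 1" by simp
    then show ?thesis by (simp add: x_def algebra_simps)
  qed
  ultimately show ?thesis
    using that[of x] x_eq[of _ 0] by (auto simp: periodic_solution_def solves_ode_on_def)
qed

text \<open>The limit is taken in the integral equation: a common Lipschitz constant yields a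
  convergent subsequence, and dominated convergence carries over the right-hand sides. Continuity of
  \<open>G\<close> suffices for this, so systems without unique solutions can be reached from
  approximating ones.\<close>

lemma ode_limit:
  fixes G :: "real \<Rightarrow> real^2 \<Rightarrow> real^2"
  assumes T: "0 \<le> T" and cont: "continuous_on ({0..T} \<times> UNIV) (\<lambda>(t, x). G t x)"
    and M: "\<And>t x. t \<in> {0..T} \<Longrightarrow> norm (G t x) \<le> M"
    and B: "\<And>n. norm (y n 0) \<le> B"
    and der: "\<And>n t. t \<in> {0..T} \<Longrightarrow> (y n has_vector_derivative h n t) (at t within {0..T})"
    and d: "\<And>n t. t \<in> {0..T} \<Longrightarrow> norm (h n t - G t (y n t)) \<le> d n" and d0: "d \<longlonglongrightarrow> 0"
  obtains x k where "strict_mono (k :: nat \<Rightarrow> nat)" "solves_ode_on G x {0..T}"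
    "\<And>t. t \<in> {0..T} \<Longrightarrow> (\<lambda>n. y (k n) t) \<longlonglongrightarrow> x t"
proof -
  obtain D where D: "\<And>n. \<bar>d n\<bar> \<le> D" 
    using convergent_imp_Bseq[of d] d0 by (auto simp: convergent_def Bseq_def)
  have M0: "0 \<le> M" using M[of 0 0] T norm_ge_zero[of "G 0 0"] by (meson atLeastAtMost_iff order.refl order_trans)
  have D0: "0 \<le> D" using D[of 0] by linarith
  have hb: "norm (h n t) \<le> M + D" if "t \<in> {0..T}" for n t
    using d[OF that, of n] M[OF that, of "y n t"] D[of n] norm_triangle_ineq2[of "h n t" "G t (y n t)"] by linarith
  have lip: "norm (y n s - y n t) \<le> (M + D) * \<bar>s - t\<bar>" if "s \<in> {0..T}" "t \<in> {0..T}" for n s t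
  proof -
    have "norm (y n s - y n t) \<le> (M + D) * norm (s - t)"
      by (rule differentiable_bound[of "{0..T}" "y n" "\<lambda>t r. r *\<^sub>R h n t"])
        (use that der hb in \<open>auto simp: has_vector_derivative_def onorm_scaleR_left bounded_linear_ident onorm_id intro!: order_trans[OF onorm_scaleR_left_lemma]\<close>)
    then show ?thesis by simp
  qed
  have lip0: "norm (y n t) \<le> B + (M + D) * T" if "t \<in> {0..T}" for n t
  proof -
    have "(M + D) * \<bar>t - 0\<bar> \<le> (M + D) * T" using M0 D0 that by (intro mult_left_mono) auto
    then show ?thesis using lip[of t 0 n] B[of n] norm_triangle_ineq2[of "y n t" "y n 0"] that T by auto
  qed
  obtain x k where x: "continuous_on {0..T} x" and k: "strict_mono (k :: nat \<Rightarrow> nat)"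
    and conv: "\<And>e. 0 < e \<Longrightarrow> \<exists>N. \<forall>n t. n \<ge> N \<and> t \<in> {0..T} \<longrightarrow> norm (y (k n) t - x t) < e"
  proof (rule Arzela_Ascoli[of "{0..T}" y "B + (M + D) * T"])
    show "\<exists>\<delta>. 0 < \<delta> \<and> (\<forall>n s. s \<in> {0..T} \<and> norm (t - s) < \<delta> \<longrightarrow> norm (y n t - y n s) < e)"
      if "t \<in> {0..T}" "0 < e" for t e
    proof (intro exI[of _ "e / (M + D + 1)"] conjI allI impI)
      show "0 < e / (M + D + 1)" using that M0 D0 by simp
      fix n s assume s: "s \<in> {0..T} \<and> norm (t - s) < e / (M + D + 1)"
      then have "(M + D + 1) * \<bar>t - s\<bar> < e" using M0 D0 by (simp add: field_simps)
      moreover have "(M + D) * \<bar>t - s\<bar> \<le> (M + D + 1) * \<bar>t - s\<bar>" by (intro mult_right_mono) auto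
      ultimately show "norm (y n t - y n s) < e"
        using lip[of t s n] that s by linarith
    qed
  qed (use lip0 in auto)
  have ptw: "(\<lambda>n. y (k n) t) \<longlonglongrightarrow> x t" if "t \<in> {0..T}" for t
    unfolding LIMSEQ_iff using conv that by blast
  have cG: "continuous_on {0..T} (\<lambda>s. G s (x s))"
  proof -
    have "continuous_on {0..T} ((\<lambda>(t, x). G t x) \<circ> (\<lambda>s. (s, x s)))"
      by (intro continuous_on_compose continuous_intros x continuous_on_subset[OF cont]) auto
    then show ?thesis by (simp add: o_def)
  qed
  have "x t = x 0 + integral {0..t} (\<lambda>s. G s (x s))" if t: "t \<in> {0..T}" for t
  proof -
    have int: "(h n has_integral (y n t - y n 0)) {0..t}" for n
      by (rule fundamental_theorem_of_calculus)
        (use t in \<open>auto intro!: has_vector_derivative_within_subset[OF der]\<close>)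
    have "(\<lambda>n. integral {0..t} (h (k n))) \<longlonglongrightarrow> integral {0..t} (\<lambda>s. G s (x s))"
    proof (rule dominated_convergence(2))
      show "h (k n) integrable_on {0..t}" for n using int by blast
      show "(\<lambda>_. M + D) integrable_on {0..t}" by (rule integrable_continuous_real) auto
      show "norm (h (k n) s) \<le> M + D" if "s \<in> {0..t}" for n s using hb t that by auto
      show "(\<lambda>n. h (k n) s) \<longlonglongrightarrow> G s (x s)" if "s \<in> {0..t}" for s
      proof -
        have s: "s \<in> {0..T}" using that t by auto
        have "continuous_on UNIV (\<lambda>z. (\<lambda>(t, x). G t x) (s, z))"
          by (rule continuous_on_compose2[OF cont]) (use s in \<open>auto intro!: continuous_intros\<close>)
        then have "isCont (\<lambda>z. G s z) (x s)" by (simp add: continuous_on_eq_continuous_at)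
        then have "(\<lambda>n. G s (y (k n) s)) \<longlonglongrightarrow> G s (x s)"
          using ptw[OF s] by (rule isCont_tendsto_compose)
        moreover have "(\<lambda>n. h (k n) s - G s (y (k n) s)) \<longlonglongrightarrow> 0"
        proof (rule Lim_null_comparison)
          show "\<forall>\<^sub>F n in sequentially. norm (h (k n) s - G s (y (k n) s)) \<le> d (k n)"
            using d[OF s] by simp
          show "(\<lambda>n. d (k n)) \<longlonglongrightarrow> 0" using LIMSEQ_subseq_LIMSEQ[OF d0 k] by (simp add: o_def)
        qed
        ultimately show ?thesis using tendsto_add by fastforce
      qed
    qed
    then have "(\<lambda>n. y (k n) t - y (k n) 0) \<longlonglongrightarrow> integral {0..t} (\<lambda>s. G s (x s))"
      using int[THEN integral_unique] by simp
    moreover have "(\<lambda>n. y (k n) t - y (k n) 0) \<longlonglongrightarrow> x t - x 0"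
      using t T by (intro tendsto_diff ptw) auto
    ultimately have "x t - x 0 = integral {0..t} (\<lambda>s. G s (x s))" using LIMSEQ_unique by blast
    then show ?thesis by (simp add: algebra_simps)
  qed
  then have "solves_ode_on G x {0..T}"
    unfolding solves_ode_on_def using ode_integral_form[OF cG] by blast
  then show ?thesis using that k ptw by blast
qed

subsection \<open>Turns of planar loops\<close>

definition to_c :: "real^2 \<Rightarrow> complex" where "to_c v = Complex (v $ 1) (v $ 2)"

definition of_c :: "complex \<Rightarrow> real^2" where "of_c z = vector [Re z, Im z]"

lemma to_c_of_c [simp]: "to_c (of_c z) = z" and of_c_to_c [simp]: "of_c (to_c v) = v"
  by (simp_all add: to_c_def of_c_def vec_eq_iff forall_2)

lemma to_c_linear: "linear to_c" and of_c_linear: "linear of_c"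
  by (auto intro!: linearI simp: to_c_def of_c_def complex_eq_iff vec_eq_iff forall_2)

lemma norm_to_c [simp]: "norm (to_c v) = norm v"
  by (simp add: to_c_def norm_vec_def L2_set_def sum_2 cmod_def)

lemmas to_c_diff = linear_diff[OF to_c_linear] and to_c_add = linear_add[OF to_c_linear]
  and to_c_scaleR = linear_scale[OF to_c_linear] and to_c_0 = linear_0[OF to_c_linear]

lemma to_c_eq_0_iff [simp]: "to_c v = 0 \<longleftrightarrow> v = 0"
  by (metis norm_eq_zero norm_to_c)

lemma to_c_inject [simp]: "to_c v = to_c w \<longleftrightarrow> v = w"
  by (metis of_c_to_c)

lemma to_c_perp: "to_c (perp v) = \<i> * to_c v"
  by (simp add: to_c_def perp_def complex_eq_iff)

lemma continuous_on_to_c [continuous_intros]: "continuous_on S g \<Longrightarrow> continuous_on S (\<lambda>x. to_c (g x))"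
  by (rule bounded_linear.continuous_on[OF to_c_linear[unfolded linear_conv_bounded_linear]])

lemma continuous_on_of_c [continuous_intros]: "continuous_on S g \<Longrightarrow> continuous_on S (\<lambda>x. of_c (g x))"
  by (rule bounded_linear.continuous_on[OF of_c_linear[unfolded linear_conv_bounded_linear]])

lemma norm_perp [simp]: "norm (perp v) = norm v"
  by (simp add: perp_def norm_vec_def L2_set_def sum_2 add.commute)

lemma inner_perp_self [simp]: "v \<bullet> perp v = 0" "perp v \<bullet> v = 0"
  by (simp_all add: perp_def inner_vec_def sum_2)

lemma perp_linear: "linear perp"
  by (auto intro!: linearI simp: perp_def vec_eq_iff forall_2)

lemma continuous_on_perp [continuous_intros]: "continuous_on S g \<Longrightarrow> continuous_on S (\<lambda>x. perp (g x))"
  by (rule bounded_linear.continuous_on[OF perp_linear[unfolded linear_conv_bounded_linear]])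

section \<open>Turns of a closed field and their homotopy invariance\<close>

lemma complex_path_eq: "complex_path T v = (\<lambda>u. to_c (v (T * u)))"
  by (simp add: complex_path_def to_c_def)

lemma scale_unit_interval: "(0::real) \<le> T \<Longrightarrow> u \<in> {0..1} \<Longrightarrow> T * u \<in> {0..T}"
  using mult_left_mono[of u 1 T] by simp

lemma path_complex_path: "0 \<le> T \<Longrightarrow> continuous_on {0..T} v \<Longrightarrow> path (complex_path T v)"
  unfolding complex_path_eq path_def
  by (rule continuous_on_to_c, erule continuous_on_compose2)
    (auto intro!: continuous_intros intro: scale_unit_interval simp del: atLeastAtMost_iff)

definition turns :: "real \<Rightarrow> (real \<Rightarrow> real^2) \<Rightarrow> complex" where
  "turns T v = winding_number (complex_path T v) 0"

lemma turns_homotopic: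
  fixes H :: "real \<Rightarrow> real \<Rightarrow> real^2"
  assumes T: "0 \<le> T" and cont: "continuous_on ({0..1} \<times> {0..T}) (\<lambda>(l, t). H l t)"
    and nz: "\<And>l t. l \<in> {0..1} \<Longrightarrow> t \<in> {0..T} \<Longrightarrow> H l t \<noteq> 0"
    and loop: "\<And>l. l \<in> {0..1} \<Longrightarrow> H l T = H l 0"
  shows "turns T (H 0) = turns T (H 1)"
proof -
  have Tu: "T * u \<in> {0..T}" if "u \<in> {0..1}" for u
    using that T by (rule scale_unit_interval[rotated])
  have "continuous_on ({0..1} \<times> {0..1}) (\<lambda>z. to_c (((\<lambda>(l, t). H l t) \<circ> (\<lambda>z. (fst z, T * snd z))) z))"
    by (intro continuous_intros continuous_on_compose continuous_on_subset[OF cont])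
      (use Tu in auto)
  then have C: "continuous_on ({0..1} \<times> {0..1}) (\<lambda>z. to_c (H (fst z) (T * snd z)))"
    by (simp add: o_def split_def)
  have "homotopic_loops (-{0}) (complex_path T (H 0)) (complex_path T (H 1))"
    unfolding homotopic_loops
  proof (intro exI[of _ "\<lambda>z. to_c (H (fst z) (T * snd z))"] conjI C)
    show "(\<lambda>z. to_c (H (fst z) (T * snd z))) \<in> {0..1} \<times> {0..1} \<rightarrow> - {0}"
      using nz Tu by auto
  qed (use loop in \<open>auto simp: complex_path_eq pathstart_def pathfinish_def\<close>)
  then show ?thesis
    unfolding turns_def by (rule winding_number_homotopic_loops)
qed

text \<open>The segment from \<open>v t\<close> to \<open>w t\<close> is shorter than
  \<open>norm (v t)\<close>, so it misses the origin (Rouche).\<close>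

lemma turns_near:
  assumes T: "0 \<le> T" and v: "continuous_on {0..T} v" "v T = v 0" and w: "continuous_on {0..T} w" "w T = w 0"
    and near: "\<And>t. t \<in> {0..T} \<Longrightarrow> norm (v t - w t) < norm (v t)"
  shows "turns T v = turns T w"
proof -
  have "turns T (\<lambda>t. v t + 0 *\<^sub>R (w t - v t)) = turns T (\<lambda>t. v t + 1 *\<^sub>R (w t - v t))"
  proof (rule turns_homotopic[OF T])
    show "continuous_on ({0..1} \<times> {0..T}) (\<lambda>(l, t). v t + l *\<^sub>R (w t - v t))"
      unfolding split_def
      by (intro continuous_intros continuous_on_compose2[OF v(1)] continuous_on_compose2[OF w(1)]) auto
    fix l t :: real assume l: "l \<in> {0..1}" and t: "t \<in> {0..T}"
    have "norm (l *\<^sub>R (w t - v t)) \<le> norm (v t - w t)"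
      using l by (simp add: mult_left_le_one_le norm_minus_commute)
    then have "norm (l *\<^sub>R (w t - v t)) < norm (v t)" using near[OF t] by simp
    then show "v t + l *\<^sub>R (w t - v t) \<noteq> 0" by (metis add_eq_0_iff less_irrefl norm_minus_cancel)
  qed (use v w in auto)
  then show ?thesis by simp
qed

lemma turns_scale:
  assumes T: "0 \<le> T" and v: "continuous_on {0..T} v" "v T = v 0" 
    and nz: "\<And>t. t \<in> {0..T} \<Longrightarrow> v t \<noteq> 0" and c: "0 < c"
  shows "turns T (\<lambda>t. c *\<^sub>R v t) = turns T v"
proof -
  have "turns T (\<lambda>t. ((1 - 0) * c + 0) *\<^sub>R v t) = turns T (\<lambda>t. ((1 - 1) * c + 1) *\<^sub>R v t)"
  proof (rule turns_homotopic[OF T])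
    show "continuous_on ({0..1} \<times> {0..T}) (\<lambda>(l, t). ((1 - l) * c + l) *\<^sub>R v t)"
      unfolding split_def
      by (intro continuous_intros continuous_on_compose2[OF v(1)]) auto
    fix l t :: real assume l: "l \<in> {0..1}" and t: "t \<in> {0..T}"
    have "0 < (1 - l) * c + l" using l c by (cases "l = 0") (auto intro: add_nonneg_pos)
    then show "((1 - l) * c + l) *\<^sub>R v t \<noteq> 0" using nz[OF t] by simp
  qed (use v in auto)
  then show ?thesis by simp
qed

text \<open>The homotopy is linear from \<open>v\<close> to its quarter turn in either direction.
  Pairing with \<open>v t\<close>, which is orthogonal to \<open>perp (v t)\<close>, shows that it
  could vanish only at the end, where it is the turned vector.\<close>

lemma turns_perp:
  assumes T: "0 \<le> T" and v: "continuous_on {0..T} v" "v T = v 0" 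
    and nz: "\<And>t. t \<in> {0..T} \<Longrightarrow> v t \<noteq> 0"
  shows "turns T (\<lambda>t. perp (v t)) = turns T v" "turns T (\<lambda>t. - perp (v t)) = turns T v"
proof -
  have *: "turns T (\<lambda>t. (1 - l) *\<^sub>R v t + (s * l) *\<^sub>R perp (v t)) = turns T v"
    if "s \<in> {-1, 1}" "l = 1" for s l :: real
  proof -
    have "turns T (\<lambda>t. (1 - 0) *\<^sub>R v t + (s * 0) *\<^sub>R perp (v t)) = turns T (\<lambda>t. (1 - 1) *\<^sub>R v t + (s * 1) *\<^sub>R perp (v t))"
    proof (rule turns_homotopic[OF T])
      show "continuous_on ({0..1} \<times> {0..T}) (\<lambda>(l, t). (1 - l) *\<^sub>R v t + (s * l) *\<^sub>R perp (v t))"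
        unfolding split_def
        by (intro continuous_intros continuous_on_compose2[OF v(1)]) auto
      fix l t :: real assume l: "l \<in> {0..1}" and t: "t \<in> {0..T}"
      show "(1 - l) *\<^sub>R v t + (s * l) *\<^sub>R perp (v t) \<noteq> 0"
      proof
        assume 0: "(1 - l) *\<^sub>R v t + (s * l) *\<^sub>R perp (v t) = 0"
        then have "((1 - l) *\<^sub>R v t + (s * l) *\<^sub>R perp (v t)) \<bullet> v t = 0" by simp
        then have "l = 1" using nz[OF t] by (simp add: inner_left_distrib)
        then show False using 0 nz[OF t] that(1) by auto (metis norm_eq_zero norm_perp)+
      qed
    qed (use v in auto)
    then show ?thesis using that by simp
  qed
  show "turns T (\<lambda>t. perp (v t)) = turns T v" "turns T (\<lambda>t. - perp (v t)) = turns T v"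
    using *[of 1 1] *[of "-1" 1] by simp_all
qed

text \<open>The Jordan curve theorem is applied over \<open>complex\<close>, while the cycle lies in
  \<open>real^2\<close>. As a norm-preserving homeomorphism \<open>to_c\<close> respects the
  components of complements and their boundedness.\<close>

lemma inside_to_c: "to_c ` inside S = inside (to_c ` S)" and outside_to_c: "to_c ` outside S = outside (to_c ` S)"
proof -
  have surj: "to_c ` UNIV = UNIV" by (metis surjI to_c_of_c)
  have compl: "- (to_c ` S) = to_c ` (- S)"
    by (metis bij_image_Compl_eq bijI injI of_c_to_c surj)
  have hom: "homeomorphism (- S) (to_c ` (- S)) to_c of_c"
    by (rule homeomorphismI) (auto intro!: continuous_intros)
  have "connected_component_set (- (to_c ` S)) (to_c x) = to_c ` connected_component_set (- S) x" if "x \<in> - S" for x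
    unfolding compl by (rule connected_component_set_homeomorphism[OF hom that])
  moreover have "bounded (to_c ` A) \<longleftrightarrow> bounded A" for A
    by (auto simp: bounded_iff)
  ultimately have bd: "bounded (connected_component_set (- (to_c ` S)) (to_c x)) \<longleftrightarrow> bounded (connected_component_set (- S) x)"
    if "x \<in> - S" for x
    using that by simp
  show i: "to_c ` inside S = inside (to_c ` S)"
  proof (intro set_eqI iffI)
    fix z assume "z \<in> inside (to_c ` S)"
    then have "of_c z \<notin> S" "bounded (connected_component_set (- (to_c ` S)) (to_c (of_c z)))"
      unfolding inside_def by (force, simp)
    then show "z \<in> to_c ` inside S"
      using bd[of "of_c z"] by (intro image_eqI[of _ _ "of_c z"]) (auto simp: inside_def)
  qed (auto simp: inside_def bd)
  show "to_c ` outside S = outside (to_c ` S)"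
    unfolding outside_inside i[symmetric] image_Un[symmetric]
    by (metis bij_image_Compl_eq bijI injI of_c_to_c surj)
qed

text \<open>A loop in the inside of a Jordan curve is null-homotopic there, so it can be replaced by a point.\<close>

lemma winding_number_diff_inside_loop:
  fixes c q :: "real \<Rightarrow> complex"
  assumes c: "simple_path c" "pathfinish c = pathstart c"
    and q: "path q" "pathfinish q = pathstart q" "path_image q \<subseteq> inside (path_image c)"
  obtains w where "w \<in> inside (path_image c)" "winding_number (\<lambda>u. c u - q u) 0 = winding_number c w"
proof -
  let ?I = "inside (path_image c)"
  obtain w where w: "w \<in> ?I" using Jordan_inside_outside[OF c] by blast
  have "simply_connected ?I" by (rule simply_connected_inside_simple_path[OF c(1)])
  then have "homotopic_loops ?I q (linepath w w)"
    using q w unfolding simply_connected_def by auto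
  then obtain h :: "real \<times> real \<Rightarrow> complex" where h: "continuous_on ({0..1} \<times> {0..1}) h"
    and h2: "h \<in> {0..1} \<times> {0..1} \<rightarrow> ?I"
    and h0: "\<forall>x\<in>{0..1}. h (0, x) = q x" and h1: "\<forall>x\<in>{0..1}. h (1, x) = linepath w w x"
    and hp: "\<forall>t\<in>{0..1}. pathfinish (h \<circ> Pair t) = pathstart (h \<circ> Pair t)"
    unfolding homotopic_loops by blast
  have cc: "continuous_on {0..1} c" using c(1) by (simp add: simple_path_def path_def)
  have "homotopic_loops (-{0}) (\<lambda>u. c u - q u) (\<lambda>u. c u - w)"
    unfolding homotopic_loops
  proof (intro exI[of _ "\<lambda>z. c (snd z) - h z"] conjI ballI)
    show "continuous_on ({0..1} \<times> {0..1}) (\<lambda>z. c (snd z) - h z)"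
      by (intro continuous_intros h continuous_on_compose2[OF cc]) auto
    show "(\<lambda>z. c (snd z) - h z) \<in> {0..1} \<times> {0..1} \<rightarrow> - {0}"
    proof
      fix z :: "real \<times> real" assume z: "z \<in> {0..1} \<times> {0..1}"
      then have "h z \<in> ?I" "c (snd z) \<in> path_image c" using h2 by (auto simp: path_image_def)
      then have "c (snd z) \<noteq> h z" using inside_no_overlap[of "path_image c"] by (metis IntI empty_iff)
      then show "c (snd z) - h z \<in> - {0}" by simp
    qed
  qed (use h0 h1 hp c(2) in \<open>auto simp: pathfinish_def pathstart_def linepath_refl\<close>)
  then have "winding_number (\<lambda>u. c u - q u) 0 = winding_number (\<lambda>u. c u - w) 0"
    by (rule winding_number_homotopic_loops)
  then show ?thesis using that[OF w] winding_number_offset[of c w] by simp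
qed

text \<open>Where \<open>q / p\<close> avoids the nonpositive real axis, its principal logarithm is
  continuous. It differs from the difference of the logarithms along the two paths by a continuous
  function with values in a discrete set, hence by a constant. The paths need not be closed.\<close>

lemma winding_number_quotient:
  fixes p q :: "real \<Rightarrow> complex"
  assumes p: "path p" "0 \<notin> path_image p" and q: "path q" "0 \<notin> path_image q"
    and k: "\<And>u. u \<in> {0..1} \<Longrightarrow> q u / p u \<notin> \<real>\<^sub>\<le>\<^sub>0"
  shows "2 * of_real pi * \<i> * (winding_number q 0 - winding_number p 0) = Ln (q 1 / p 1) - Ln (q 0 / p 0)"
proof -
  obtain a where a: "path a" "pathfinish a - pathstart a = 2 * of_real pi * \<i> * winding_number p 0"
    "\<And>t. t \<in> {0..1} \<Longrightarrow> p t = exp (a t)"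
    using winding_number_as_continuous_log[OF p] by (metis add_0)
  obtain b where b: "path b" "pathfinish b - pathstart b = 2 * of_real pi * \<i> * winding_number q 0"
    "\<And>t. t \<in> {0..1} \<Longrightarrow> q t = exp (b t)"
    using winding_number_as_continuous_log[OF q] by (metis add_0)
  define d where "d t = b t - a t - Ln (q t / p t)" for t
  have cont: "continuous_on {0..1} d"
    unfolding d_def using a(1) b(1) p(1) q(1) k a(3)
    by (auto simp: path_def intro!: continuous_intros)
  have expd: "exp (d t) = 1" if "t \<in> {0..1}" for t
    using a(3)[OF that] b(3)[OF that] by (simp add: d_def exp_diff)
  have "d constant_on {0..1}"
  proof (rule continuous_discrete_range_constant[OF _ cont])
    fix x :: real assume x: "x \<in> {0..1}"
    show "\<exists>e>0. \<forall>y. y \<in> {0..1} \<and> d y \<noteq> d x \<longrightarrow> e \<le> norm (d y - d x)"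
    proof (intro exI[of _ "2 * pi"] conjI allI impI)
      fix y assume y: "y \<in> {0..1} \<and> d y \<noteq> d x"
      then have "exp (d y - d x) = 1" using expd x by (simp add: exp_diff)
      then obtain n :: int where n: "Re (d y - d x) = 0" "Im (d y - d x) = of_int (2 * n) * pi"
        by (auto simp: exp_eq_1)
      then have "n \<noteq> 0" using y by (auto simp: complex_eq_iff)
      then have "1 \<le> \<bar>real_of_int n\<bar>" by linarith
      then have "2 * pi \<le> \<bar>of_int (2 * n) * pi\<bar>" by (simp add: abs_mult)
      also have "\<dots> \<le> norm (d y - d x)" using abs_Im_le_cmod[of "d y - d x"] n by simp
      finally show "2 * pi \<le> norm (d y - d x)" .
    qed simp
  qed simp
  then have "d 0 = d 1" by (auto simp: constant_on_def)
  then show ?thesis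
    using a(2) b(2) by (simp add: d_def pathfinish_def pathstart_def algebra_simps)
qed

text \<open>The change of frame preserves each open half-plane and fixes the real axis. In the upper
  half-plane all arguments lie strictly between 0 and \<open>pi\<close>, so no vector is turned to
  its opposite, and two images of one vector differ by less than half a turn.\<close>

lemma triangular_Ln:
  fixes a b \<alpha> \<beta> \<alpha>' \<beta>' :: real
  assumes z: "Complex a b \<noteq> 0" and \<alpha>: "0 < \<alpha>" "0 < \<alpha>'"
  shows "Complex (a + \<beta> * b) (\<alpha> * b) / Complex a b \<notin> \<real>\<^sub>\<le>\<^sub>0" (is "?k \<alpha> \<beta> \<notin> _")
    and "\<bar>Im (Ln (Complex (a + \<beta> * b) (\<alpha> * b) / Complex a b)) 
      - Im (Ln (Complex (a + \<beta>' * b) (\<alpha>' * b) / Complex a b))\<bar> < pi"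
proof -
  have key: "(Complex (a + \<beta> * b) (\<alpha> * b) / Complex a b \<notin> \<real>\<^sub>\<le>\<^sub>0) \<and>
      \<bar>Im (Ln (Complex (a + \<beta> * b) (\<alpha> * b) / Complex a b)) 
      - Im (Ln (Complex (a + \<beta>' * b) (\<alpha>' * b) / Complex a b))\<bar> < pi"
    if z: "Complex a b \<noteq> 0" and b: "0 \<le> b" and \<alpha>: "0 < \<alpha>" "0 < \<alpha>'" for a b \<alpha> \<beta> \<alpha>' \<beta>'
  proof (cases "b = 0")
    case True
    then show ?thesis using z by (auto simp: complex_eq_iff)
  next
    case False
    have ImLn: "0 < Im (Ln w)" "Im (Ln w) < pi" if "0 < Im w" for w
      using that Im_Ln_pos_lt[of w] by (metis Im_complex_of_real less_irrefl of_real_0)+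
    define z where "z = Complex a b"
    have zb: "0 < Im z" using b False by (simp add: z_def)
    have L: "Ln (w / z) = Ln w - Ln z" "w / z \<notin> \<real>\<^sub>\<le>\<^sub>0" if w: "0 < Im w" for w
    proof -
      have nz: "w \<noteq> 0" "z \<noteq> 0" using w zb by auto
      have bd: "\<bar>Im (Ln w - Ln z)\<bar> < pi" using ImLn[OF w] ImLn[OF zb] by auto
      show eq: "Ln (w / z) = Ln w - Ln z"
        by (rule Ln_unique) (use nz bd in \<open>auto simp: exp_diff\<close>)
      show "w / z \<notin> \<real>\<^sub>\<le>\<^sub>0"
      proof
        assume "w / z \<in> \<real>\<^sub>\<le>\<^sub>0"
        then have "Re (w / z) \<le> 0" "Im (w / z) = 0" by (auto simp: complex_nonpos_Reals_iff)
        moreover have nz': "w / z \<noteq> 0" using nz by simp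
        ultimately have "Re (w / z) < 0" unfolding complex_eq_iff by auto
        then have "Im (Ln (w / z)) = pi" 
          using Im_Ln_eq_pi[OF nz'] \<open>Im (w / z) = 0\<close> by blast
        then show False using bd eq by simp
      qed
    qed
    show ?thesis
      using L[of "Complex (a + \<beta> * b) (\<alpha> * b)"] L[of "Complex (a + \<beta>' * b) (\<alpha>' * b)"]
        ImLn[of "Complex (a + \<beta> * b) (\<alpha> * b)"] ImLn[of "Complex (a + \<beta>' * b) (\<alpha>' * b)"] \<alpha> b False
      by (auto simp: z_def)
  qed
  have "(?k \<alpha> \<beta> \<notin> \<real>\<^sub>\<le>\<^sub>0) \<and> \<bar>Im (Ln (?k \<alpha> \<beta>)) - Im (Ln (Complex (a + \<beta>' * b) (\<alpha>' * b) / Complex a b))\<bar> < pi"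
  proof (cases "0 \<le> b")
    case True then show ?thesis using key[OF z _ \<alpha>] by blast
  next
    case False
    \<comment> \<open>The lower half-plane is reduced to the upper one by negating numerator and
      denominator.\<close>
    have *: "Complex (a + \<beta> * b) (\<alpha> * b) / Complex a b = Complex (- a + \<beta> * (- b)) (\<alpha> * (- b)) / Complex (- a) (- b)" for \<alpha> \<beta>
    proof -
      have "Complex (- a + \<beta> * (- b)) (\<alpha> * (- b)) = - Complex (a + \<beta> * b) (\<alpha> * b)" "Complex (-a) (-b) = - Complex a b"
        by (simp_all add: complex_eq_iff)
      then show ?thesis by (simp add: minus_divide_left[symmetric] divide_minus_right)
    qed
    show ?thesis unfolding *
      by (rule key) (use z False \<alpha> in \<open>auto simp: complex_eq_iff\<close>)
  qed
  then show "?k \<alpha> \<beta> \<notin> \<real>\<^sub>\<le>\<^sub>0" "\<bar>Im (Ln (?k \<alpha> \<beta>)) - Im (Ln (Complex (a + \<beta>' * b) (\<alpha>' * b) / Complex a b))\<bar> < pi"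
    by auto
qed

lemma turns_integer:
  assumes "0 \<le> T" "continuous_on {0..T} v" "v T = v 0" "\<And>t. t \<in> {0..T} \<Longrightarrow> v t \<noteq> 0"
  obtains n where "turns T v = of_int n"
proof -
  have "winding_number (complex_path T v) 0 \<in> \<int>"
  proof (rule integer_winding_number)
    show "path (complex_path T v)" by (rule path_complex_path[OF assms(1,2)])
    show "0 \<notin> path_image (complex_path T v)"
      using assms(4) scale_unit_interval[OF assms(1)] by (auto simp: path_image_def complex_path_eq simp del: atLeastAtMost_iff)
  qed (use assms(3) in \<open>simp add: complex_path_eq pathfinish_def pathstart_def\<close>)
  then show ?thesis using that unfolding turns_def by (auto elim: Ints_cases)
qed

text \<open>\<open>V\<close> need not close up, but two positive triangular changes of frame turn \<open>W 0 = W T\<close> by angles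
  that differ by less than half a turn. This is why rounding recovers the turns of \<open>W\<close>.\<close>

lemma poincare_index_triangular:
  fixes e W V :: "real \<Rightarrow> real^2" and a b \<alpha> \<beta> :: "real \<Rightarrow> real"
  assumes T: "0 \<le> T" and cW: "continuous_on {0..T} W" and cV: "continuous_on {0..T} V"
    and e: "\<And>t. t \<in> {0..T} \<Longrightarrow> e t \<noteq> 0" and eT: "e T = e 0" and aT: "a T = a 0" "b T = b 0"
    and W: "\<And>t. t \<in> {0..T} \<Longrightarrow> W t = a t *\<^sub>R e t + b t *\<^sub>R perp (e t)"
    and V: "\<And>t. t \<in> {0..T} \<Longrightarrow> V t = (a t + \<beta> t * b t) *\<^sub>R e t + (\<alpha> t * b t) *\<^sub>R perp (e t)"
    and nz: "\<And>t. t \<in> {0..T} \<Longrightarrow> W t \<noteq> 0" and \<alpha>: "\<And>t. t \<in> {0..T} \<Longrightarrow> 0 < \<alpha> t"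
  shows "turns T W = of_int (poincare_index T V)"
proof -
  have WT: "W T = W 0" using W[of 0] W[of T] T eT aT by simp
  obtain n where n: "turns T W = of_int n"
    using turns_integer[OF T cW WT nz] by blast
  have tW: "to_c (W t) = Complex (a t) (b t) * to_c (e t)" if "t \<in> {0..T}" for t
    unfolding W[OF that] to_c_add to_c_scaleR to_c_perp by (simp add: complex_eq_iff algebra_simps)
  have tV: "to_c (V t) = Complex (a t + \<beta> t * b t) (\<alpha> t * b t) * to_c (e t)" if "t \<in> {0..T}" for t
    unfolding V[OF that] to_c_add to_c_scaleR to_c_perp by (simp add: complex_eq_iff algebra_simps)
  have nz': "Complex (a t) (b t) \<noteq> 0" if "t \<in> {0..T}" for t
    using tW[OF that] nz[OF that] by auto
  \<comment> \<open>The frame vector \<open>to_c (e t)\<close> cancels in \<open>V / W\<close>,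
    which therefore depends on the coordinates only.\<close>
  define k where "k t = Complex (a t + \<beta> t * b t) (\<alpha> t * b t) / Complex (a t) (b t)" for t
  have k: "to_c (V t) / to_c (W t) = k t" if "t \<in> {0..T}" for t
    using e[OF that] by (simp add: k_def tW[OF that] tV[OF that])
  have kn: "k t \<notin> \<real>\<^sub>\<le>\<^sub>0" if "t \<in> {0..T}" for t
    unfolding k_def by (rule triangular_Ln(1)[OF nz'[OF that] \<alpha>[OF that] \<alpha>[OF that]])
  have Vnz: "V t \<noteq> 0" if "t \<in> {0..T}" for t
    using k[OF that] kn[OF that] by (auto simp: to_c_0)
  have Tu: "T * u \<in> {0..T}" if "u \<in> {0..1}" for u
    using that T by (rule scale_unit_interval[rotated])
  have "2 * of_real pi * \<i> * (winding_number (complex_path T V) 0 - winding_number (complex_path T W) 0)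
    = Ln (complex_path T V 1 / complex_path T W 1) - Ln (complex_path T V 0 / complex_path T W 0)"
  proof (rule winding_number_quotient)
    show "path (complex_path T V)" "path (complex_path T W)" by (rule path_complex_path[OF T] cV cW)+
    show "0 \<notin> path_image (complex_path T V)" "0 \<notin> path_image (complex_path T W)"
      using Vnz nz Tu by (auto simp: path_image_def complex_path_eq simp del: atLeastAtMost_iff)
    show "complex_path T V u / complex_path T W u \<notin> \<real>\<^sub>\<le>\<^sub>0" if "u \<in> {0..1}" for u
      using k[OF Tu[OF that]] kn[OF Tu[OF that]] by (simp add: complex_path_eq)
  qed
  also have "\<dots> = Ln (k T) - Ln (k 0)"
    using k[of T] k[of 0] T by (simp add: complex_path_eq)
  finally have "2 * of_real pi * \<i> * (winding_number (complex_path T V) 0 - of_int n) = Ln (k T) - Ln (k 0)"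
    using n by (simp add: turns_def)
  then have "Im (2 * of_real pi * \<i> * (winding_number (complex_path T V) 0 - of_int n)) = Im (Ln (k T) - Ln (k 0))"
    by simp
  then have "2 * pi * (Re (winding_number (complex_path T V) 0) - of_int n) = Im (Ln (k T)) - Im (Ln (k 0))"
    by simp
  \<comment> \<open>As \<open>a\<close> and \<open>b\<close> close up, \<open>k T\<close> and
    \<open>k 0\<close> are two changes of frame of one and the same vector.\<close>
  moreover have "\<bar>Im (Ln (k T)) - Im (Ln (k 0))\<bar> < pi"
    unfolding k_def aT by (rule triangular_Ln(2)) (use T nz' \<alpha> in auto)
  ultimately have "\<bar>2 * pi * (Re (winding_number (complex_path T V) 0) - of_int n)\<bar> < 2 * pi * (1 / 2)"
    by simp
  then have "2 * pi * \<bar>Re (winding_number (complex_path T V) 0) - of_int n\<bar> < 2 * pi * (1 / 2)"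
    by (simp only: abs_mult abs_numeral abs_of_pos pi_gt_zero)
  then have "\<bar>Re (winding_number (complex_path T V) 0) - of_int n\<bar> < 1 / 2"
    using mult_less_cancel_left_pos[of "2 * pi"] pi_gt_zero by (simp only: mult_pos_pos zero_less_numeral)
  then have "poincare_index T V = n"
    unfolding poincare_index_def by (intro round_unique') (simp add: abs_minus_commute)
  then show ?thesis using n by simp
qed

subsection \<open>The flow near the cycle\<close>

lemma norm_matrix_vector_le:
  fixes A :: "real^2^2"
  shows "norm (A *v h) \<le> 2 * norm A * norm h"
proof -
  have comp: "\<bar>vec_nth (A *v h) i\<bar> \<le> norm A * norm h" for i
  proof -
    have "vec_nth (A *v h) i = vec_nth A i \<bullet> h"
      by (simp add: matrix_vector_mult_def inner_vec_def)
    then have "\<bar>vec_nth (A *v h) i\<bar> \<le> norm (vec_nth A i) * norm h"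
      by (simp add: Cauchy_Schwarz_ineq2)
    also have "\<dots> \<le> norm A * norm h"
      using Finite_Cartesian_Product.norm_nth_le[of A i] by (intro mult_right_mono) auto
    finally show ?thesis .
  qed
  show ?thesis using norm_le_l1_cart[of "A *v h"] comp[of 1] comp[of 2] by (simp add: sum_2)
qed

lemma C1_lipschitz_on_cball:
  fixes f :: "real^2 \<Rightarrow> real^2" and f' :: "real^2 \<Rightarrow> real^2^2"
  assumes der: "\<And>x. (f has_derivative (\<lambda>h. f' x *v h)) (at x)"
    and cont: "continuous_on UNIV f'"
  obtains L where "0 < L" "\<And>y z. y \<in> cball 0 R \<Longrightarrow> z \<in> cball 0 R \<Longrightarrow> norm (f y - f z) \<le> L * norm (y - z)"
    "\<And>y h. y \<in> cball 0 R \<Longrightarrow> norm (f' y *v h) \<le> L * norm h"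
proof -
  have "compact (f' ` cball 0 R)"
    by (intro compact_continuous_image continuous_on_subset[OF cont]) auto
  then obtain B where B: "\<And>y. y \<in> cball 0 R \<Longrightarrow> norm (f' y) \<le> B"
    by (metis bounded_iff compact_imp_bounded imageI)
  define L where "L = max 1 (2 * B)"
  have le: "norm (f' y *v h) \<le> L * norm h" if "y \<in> cball 0 R" for y h
  proof -
    have "2 * norm (f' y) \<le> L" using B[OF that] by (simp add: L_def)
    then show ?thesis
      using norm_matrix_vector_le[of "f' y" h] mult_right_mono[of "2 * norm (f' y)" L "norm h"] by simp
  qed
  show ?thesis
  proof
    show "0 < L" by (simp add: L_def)
    show "norm (f y - f z) \<le> L * norm (y - z)" if "y \<in> cball 0 R" "z \<in> cball 0 R" for y z
    proof (rule differentiable_bound[of "cball 0 R" f "\<lambda>x h. f' x *v h"])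
      show "(f has_derivative (\<lambda>h. f' x *v h)) (at x within cball 0 R)" for x
        using der by (rule has_derivative_at_withinI)
      show "onorm ((*v) (f' x)) \<le> L" if "x \<in> cball 0 R" for x
        by (rule onorm_bound) (use le[OF that] in \<open>auto simp: L_def\<close>)
    qed (use that in auto)
  qed (use le in auto)
qed

lemma continuous_on_prod_lipschitz:
  fixes F :: "'a::real_normed_vector \<Rightarrow> 'b::metric_space \<Rightarrow> 'c::real_normed_vector"
  assumes lip: "\<And>a a' b. b \<in> B \<Longrightarrow> norm (F a b - F a' b) \<le> C * norm (a - a')"
    and cont: "\<And>a. continuous_on B (F a)"
  shows "continuous_on (UNIV \<times> B) (\<lambda>(a, b). F a b)"
  unfolding continuous_on_def
proof
  fix z assume z: "z \<in> (UNIV :: 'a set) \<times> B"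
  obtain a b where ab: "z = (a, b)" "b \<in> B" using z by auto
  let ?W = "at z within (UNIV :: 'a set) \<times> B"
  have fst: "((\<lambda>w. fst w) \<longlongrightarrow> a) ?W" and snd: "((\<lambda>w. snd w) \<longlongrightarrow> b) ?W"
    unfolding ab(1) by (auto intro!: tendsto_eq_intros)
  have 1: "((\<lambda>w. F a (snd w)) \<longlongrightarrow> F a b) ?W"
  proof (rule continuous_on_tendsto_compose[OF cont snd \<open>b \<in> B\<close>])
    show "\<forall>\<^sub>F w in ?W. snd w \<in> B" by (auto simp: eventually_at_filter mem_Times_iff)
  qed
  have 2: "((\<lambda>w. F (fst w) (snd w) - F a (snd w)) \<longlongrightarrow> 0) ?W"
  proof (rule Lim_null_comparison)
    show "\<forall>\<^sub>F w in ?W. norm (F (fst w) (snd w) - F a (snd w)) \<le> C * norm (fst w - a)"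
      using lip by (auto simp: eventually_at_filter mem_Times_iff)
    show "((\<lambda>w. C * norm (fst w - a)) \<longlongrightarrow> 0) ?W"
      by (rule tendsto_eq_intros fst refl)+ auto
  qed
  show "((\<lambda>(a, b). F a b) \<longlongrightarrow> (case z of (a, b) \<Rightarrow> F a b)) ?W"
    using tendsto_add[OF 1 2] by (simp add: split_def ab)
qed

text \<open>The ball of radius \<open>R\<close> contains the 1-neighbourhood of the cycle; on it
  \<open>L\<close> serves both as Lipschitz constant of \<open>f\<close> and as bound of the
  Jacobian. By \<open>simple\<close> the number \<open>T\<close> is the least period.\<close>

locale planar_cycle =
  fixes f :: "real^2 \<Rightarrow> real^2" and f' :: "real^2 \<Rightarrow> real^2^2"
    and x :: "real \<Rightarrow> real^2" and T R L :: real
  assumes f_deriv: "\<And>y. (f has_derivative (\<lambda>h. f' y *v h)) (at y)"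
    and f'_cont: "continuous_on UNIV f'"
    and cyc: "cycle T f x"
    and simple: "simple_path (complex_path T x)"
    and x_ball: "\<And>t. norm (x t) + 1 \<le> R"
    and L_pos: "0 < L"
    and f_lip: "\<And>y z. y \<in> cball 0 R \<Longrightarrow> z \<in> cball 0 R \<Longrightarrow> norm (f y - f z) \<le> L * norm (y - z)"
    and f'_bound: "\<And>y h. y \<in> cball 0 R \<Longrightarrow> norm (f' y *v h) \<le> L * norm h"
begin

lemma T_pos: "0 < T" using cyc by (simp add: cycle_def)

lemma x_deriv: "(x has_vector_derivative f (x t)) (at t)"
  using cyc by (simp add: cycle_def periodic_solution_def solves_ode_on_def)

lemma x_deriv_within: "(x has_vector_derivative f (x t)) (at t within S)"
  using x_deriv by (rule has_vector_derivative_at_within)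

lemma x_periodic: "x (t + T) = x t"
  using cyc by (simp add: cycle_def periodic_solution_def)

lemma x_periodic_int: "x (t + of_int k * T) = x t"
  by (rule periodic_int[of x T, OF x_periodic])

lemma x_cont: "continuous_on S x"
  using x_deriv by (meson continuous_at_imp_continuous_on has_vector_derivative_continuous)

lemma x_cont_compose [continuous_intros]: "continuous_on S g \<Longrightarrow> continuous_on S (\<lambda>z. x (g z))"
  using continuous_on_compose2[OF x_cont[of UNIV]] by blast

lemma f_cont: "continuous_on S f"
  using f_deriv by (meson continuous_at_imp_continuous_on has_derivative_continuous)

lemma f_cont_compose [continuous_intros]: "continuous_on S g \<Longrightarrow> continuous_on S (\<lambda>z. f (g z))"
  using continuous_on_compose2[OF f_cont[of UNIV]] by blast

lemma mod_period: obtains k where "t - of_int k * T \<in> {0..<T}"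
proof
  show "t - of_int \<lfloor>t / T\<rfloor> * T \<in> {0..<T}"
    using floor_divide_lower[OF T_pos, of t] floor_divide_upper[OF T_pos, of t]
    by (auto simp: algebra_simps)
qed

lemma x_range: "range x = x ` {0..T}"
proof (intro equalityI subsetI)
  fix y assume "y \<in> range x"
  then obtain t where t: "y = x t" by blast
  obtain k where k: "t - of_int k * T \<in> {0..<T}" using mod_period by blast
  have "y = x (t - of_int k * T)" using x_periodic_int[of "t - of_int k * T" k] t by simp
  then show "y \<in> x ` {0..T}" using k by force
qed auto

lemma x_range_compact: "compact (range x)"
  unfolding x_range by (intro compact_continuous_image x_cont) auto

lemma x_in_ball: "x t \<in> cball 0 R"
  using x_ball[of t] by auto

lemma near_in_ball: "norm (y - x t) \<le> 1 \<Longrightarrow> y \<in> cball 0 R"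
  using x_ball[of t] norm_triangle_ineq2[of y "x t"] by auto

text \<open>\<open>simple\<close> concerns the period that starts at 0. A window shorter than
  \<open>T\<close> is moved there by whole periods; if its right end still exceeds \<open>T\<close>,
  that end is moved back once more.\<close>

lemma x_inj:
  assumes eq: "x a = x b" and ab: "a \<le> b" "b < a + T"
  shows "a = b"
proof -
  obtain k where k: "a - of_int k * T \<in> {0..<T}" using mod_period by blast
  define a' b' where "a' = a - of_int k * T" and "b' = b - of_int k * T"
  have eq': "x a' = x b'"
    using eq x_periodic_int[of a' k] x_periodic_int[of b' k] by (simp add: a'_def b'_def)
  have a': "0 \<le> a'" "a' < T" and ab': "a' \<le> b'" "b' < a' + T" 
    using k ab by (auto simp: a'_def b'_def)
  have lf: "u = v \<or> u = 0 \<and> v = 1 \<or> u = 1 \<and> v = 0" if "u \<in> {0..1}" "v \<in> {0..1}" "x (T * u) = x (T * v)" for u v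
    using simple that by (simp add: simple_path_def loop_free_def complex_path_eq)
  have "a' = b'"
  proof (cases "b' \<le> T")
    case True
    then show ?thesis using lf[of "a' / T" "b' / T"] eq' a' ab' T_pos by (auto simp: field_simps)
  next
    case False
    then have "x a' = x (b' - T)" using eq' x_periodic[of "b' - T"] by simp
    moreover have "T * (a' / T) = a'" "T * ((b' - T) / T) = b' - T" using T_pos by simp_all
    moreover have "a' / T \<in> {0..1}" "(b' - T) / T \<in> {0..1}" using a' ab' False T_pos by (auto simp: field_simps)
    ultimately have "a' / T = (b' - T) / T \<or> a' / T = 0 \<and> (b' - T) / T = 1 \<or> a' / T = 1 \<and> (b' - T) / T = 0"
      using lf[of "a' / T" "(b' - T) / T"] by simp
    then show ?thesis using a' ab' False T_pos by (auto simp: field_simps)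
  qed
  then show ?thesis by (simp add: a'_def b'_def)
qed

text \<open>The truncation \<open>fh\<close> of \<open>f\<close> is globally Lipschitz and agrees with \<open>f\<close> near the cycle.\<close>

definition fh :: "real^2 \<Rightarrow> real^2" where "fh y = f (closest_point (cball 0 R) y)"

lemma R_pos: "0 < R" using x_ball[of 0] norm_ge_zero[of "x 0"] by linarith

lemma proj_in: "closest_point (cball 0 R) y \<in> cball 0 R" for y :: "real^2"
  using R_pos by (intro closest_point_in_set) auto

lemma proj_lip: "norm (closest_point (cball 0 R) y - closest_point (cball 0 R) z) \<le> norm (y - z)" for y :: "real^2"
  using closest_point_lipschitz[of "cball 0 R" y z] R_pos by (auto simp: dist_norm)

lemma fh_eq: "y \<in> cball 0 R \<Longrightarrow> fh y = f y"
  by (simp only: fh_def closest_point_self)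

lemma fh_lip: "norm (fh y - fh z) \<le> L * norm (y - z)"
proof -
  have "norm (fh y - fh z) \<le> L * norm (closest_point (cball 0 R) y - closest_point (cball 0 R) z)"
    unfolding fh_def by (rule f_lip[OF proj_in proj_in])
  also have "\<dots> \<le> L * norm (y - z)" using L_pos by (intro mult_left_mono proj_lip) auto
  finally show ?thesis .
qed

lemma proj_cont: "continuous_on S (closest_point (cball 0 R :: (real^2) set))"
  using R_pos by (intro continuous_on_closest_point) auto

lemma fh_cont: "continuous_on S fh"
  unfolding fh_def by (intro continuous_intros proj_cont)

lemma fh_cont_compose [continuous_intros]: "continuous_on S g \<Longrightarrow> continuous_on S (\<lambda>z. fh (g z))"
  using continuous_on_compose2[OF fh_cont[of UNIV]] by blast

text \<open>The defect \<open>\<kappa>\<close> lets one estimate serve all comparisons: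
  \<open>\<kappa> = 0\<close> gives uniqueness and Lipschitz dependence on the initial value, a
  defect of order \<epsilon> the distance between perturbed and unperturbed motion.\<close>

lemma fh_gronwall:
  assumes ab: "a \<le> b" "b - a \<le> T"
    and y: "\<And>t. t \<in> {a..b} \<Longrightarrow> (y has_vector_derivative y' t) (at t within {a..b})"
    and z: "\<And>t. t \<in> {a..b} \<Longrightarrow> (z has_vector_derivative z' t) (at t within {a..b})"
    and \<kappa>: "0 \<le> \<kappa>" and le: "\<And>t. t \<in> {a..b} \<Longrightarrow> norm ((y' t - z' t) - (fh (y t) - fh (z t))) \<le> \<kappa>"
    and t: "t \<in> {a..b}"
  shows "norm (y t - z t) \<le> (norm (y a - z a) + \<kappa> * T) * exp (L * T)"
proof -
  have "norm (y t - z t) \<le> (norm (y a - z a) + \<kappa> * (b - a)) * exp (L * (t - a))"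
  proof (rule norm_gronwall[of a b L \<kappa> "\<lambda>t. y t - z t" "\<lambda>t. y' t - z' t"])
    show "((\<lambda>t. y t - z t) has_vector_derivative y' t - z' t) (at t within {a..b})" if "t \<in> {a..b}" for t
      by (intro has_vector_derivative_diff y z that)
    show "norm (y' t - z' t) \<le> L * norm (y t - z t) + \<kappa>" if "t \<in> {a..b}" for t
      using le[OF that] fh_lip[of "y t" "z t"] norm_triangle_ineq2[of "y' t - z' t" "fh (y t) - fh (z t)"] by linarith
  qed (use ab t L_pos \<kappa> in auto)
  also have "\<dots> \<le> (norm (y a - z a) + \<kappa> * T) * exp (L * T)"
    using ab t L_pos \<kappa> by (intro mult_mono add_mono mult_left_mono order.refl) auto
  finally show ?thesis .
qed

section \<open>The flow of the truncated system up to time T\<close>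

definition flow :: "real^2 \<Rightarrow> real \<Rightarrow> real^2" where
  "flow \<xi> = (SOME y. y 0 = \<xi> \<and> solves_ode_on (\<lambda>t. fh) y {0..T})"

lemma flow: "flow \<xi> 0 = \<xi>" "solves_ode_on (\<lambda>t. fh) (flow \<xi>) {0..T}"
proof -
  obtain y where "y 0 = \<xi>" "\<And>t. t \<in> {0..T} \<Longrightarrow> (y has_vector_derivative fh (y t)) (at t within {0..T})"
  proof (rule picard_lindelof[of T "\<lambda>t. fh" L \<xi>])
    show "continuous_on ({0..T} \<times> UNIV) (\<lambda>(t, x). fh x)"
      unfolding split_def by (intro continuous_intros)
  qed (use T_pos L_pos fh_lip in auto)
  then have "\<exists>y. y 0 = \<xi> \<and> solves_ode_on (\<lambda>t. fh) y {0..T}" by (auto simp: solves_ode_on_def)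
  from someI_ex[OF this] show "flow \<xi> 0 = \<xi>" "solves_ode_on (\<lambda>t. fh) (flow \<xi>) {0..T}"
    by (auto simp: flow_def)
qed

lemma flow_deriv: "t \<in> {0..T} \<Longrightarrow> (flow \<xi> has_vector_derivative fh (flow \<xi> t)) (at t within {0..T})"
  using flow(2) by (simp add: solves_ode_on_def)

lemma flow_lip:
  assumes t: "t \<in> {0..T}"
  shows "norm (flow \<xi> t - flow \<eta> t) \<le> exp (L * T) * norm (\<xi> - \<eta>)"
  using fh_gronwall[of 0 T "flow \<xi>" _ "flow \<eta>" _ 0 t, OF _ _ flow_deriv flow_deriv] t T_pos
  by (simp add: flow(1) mult.commute)

lemma flow_unique:
  assumes b: "b \<in> {0..T}" and y: "\<And>t. t \<in> {0..b} \<Longrightarrow> (y has_vector_derivative fh (y t)) (at t within {0..b})"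
    and t: "t \<in> {0..b}"
  shows "y t = flow (y 0) t"
proof -
  have "norm (y t - flow (y 0) t) \<le> (norm (y 0 - flow (y 0) 0) + 0 * T) * exp (L * T)"
  proof (rule fh_gronwall[of 0 b y "\<lambda>t. fh (y t)" "flow (y 0)" "\<lambda>t. fh (flow (y 0) t)"])
    show "(flow (y 0) has_vector_derivative fh (flow (y 0) t)) (at t within {0..b})" if "t \<in> {0..b}" for t
      using flow_deriv by (rule has_vector_derivative_within_subset) (use that b in auto)
  qed (use y t b in auto)
  then show ?thesis by (simp add: flow(1))
qed

lemma flow_shift:
  assumes y: "\<And>s. s \<in> {a..a + b} \<Longrightarrow> (y has_vector_derivative fh (y s)) (at s within {a..a + b})"
    and b: "b \<in> {0..T}"
  shows "flow (y a) b = y (a + b)"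
proof -
  have "((\<lambda>s. y (a + s)) has_vector_derivative fh (y (a + t))) (at t within {0..b})" if t: "t \<in> {0..b}" for t
  proof -
    have im: "(\<lambda>s. a + s) ` {0..b} = {a..a + b}" by (simp add: image_add_atLeastAtMost)
    have "((\<lambda>s. a + s) has_vector_derivative 1) (at t within {0..b})" by (auto intro!: derivative_eq_intros)
    moreover have "(y has_vector_derivative fh (y (a + t))) (at (a + t) within (\<lambda>s. a + s) ` {0..b})"
      unfolding im by (rule y) (use t in auto)
    ultimately show ?thesis using vector_diff_chain_within by (fastforce simp: o_def)
  qed
  from flow_unique[OF b this] show ?thesis using b by simp
qed

lemma flow_x: "t \<in> {0..T} \<Longrightarrow> flow (x \<theta>) t = x (\<theta> + t)"
  by (rule flow_shift) (auto simp: fh_eq[OF x_in_ball] intro: x_deriv_within)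

lemma flow_cont_fst: "continuous_on {0..T} (flow \<xi>)"
  using flow_deriv by (rule continuous_on_vector_derivative)

lemma flow_cont: "continuous_on (UNIV \<times> {0..T}) (\<lambda>(\<xi>, t). flow \<xi> t)"
  by (rule continuous_on_prod_lipschitz[OF flow_lip flow_cont_fst])

lemma flow_cont_compose [continuous_intros]:
  assumes "continuous_on S p" "continuous_on S q" "\<And>z. z \<in> S \<Longrightarrow> q z \<in> {0..T}"
  shows "continuous_on S (\<lambda>z. flow (p z) (q z))"
proof -
  have "continuous_on S ((\<lambda>(\<xi>, t). flow \<xi> t) \<circ> (\<lambda>z. (p z, q z)))"
    by (intro continuous_on_compose continuous_intros assms continuous_on_subset[OF flow_cont]) (use assms in auto)
  then show ?thesis by (simp add: o_def)
qed

text \<open>At a zero of \<open>f\<close> the constant motion is a solution too; by uniqueness the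
  cycle would return after half a period.\<close>

lemma f_x_nonzero: "f (x t) \<noteq> 0"
proof
  assume "f (x t) = 0"
  then have "flow (x t) (T / 2) = x t"
    using flow_shift[of t "T / 2" "\<lambda>_. x t"] T_pos by (auto simp: fh_eq[OF x_in_ball])
  moreover have "flow (x t) (T / 2) = x (t + T / 2)" using T_pos by (intro flow_x) auto
  ultimately show False using x_inj[of t "t + T / 2"] T_pos by auto
qed

text \<open>This is \<open>(flow \<xi> l - \<xi>) / l\<close>, in a form that is also meaningful at \<open>l = 0\<close>.\<close>

definition quot :: "real \<Rightarrow> real^2 \<Rightarrow> real^2" where
  "quot l \<xi> = integral {0..1} (\<lambda>u. fh (flow \<xi> (l * u)))"

lemma quot_0: "quot 0 \<xi> = fh \<xi>"
  by (simp add: quot_def flow(1))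

lemma quot_eq:
  assumes l: "l \<in> {0..T}"
  shows "l *\<^sub>R quot l \<xi> = flow \<xi> l - \<xi>"
proof -
  have lu: "l * u \<in> {0..T}" if "u \<in> {0..1}" for u
    using scale_unit_interval[of l u] that l by auto
  have "((\<lambda>u. l *\<^sub>R fh (flow \<xi> (l * u))) has_integral (flow \<xi> (l * 1) - flow \<xi> (l * 0))) {0..1}"
  proof (rule fundamental_theorem_of_calculus)
    fix u :: real assume u: "u \<in> {0..1}"
    have "((\<lambda>u. l * u) has_vector_derivative l) (at u within {0..1})" by (auto intro!: derivative_eq_intros)
    moreover have "(flow \<xi> has_vector_derivative fh (flow \<xi> (l * u))) (at (l * u) within (\<lambda>u. l * u) ` {0..1})"
      using flow_deriv[OF lu[OF u]] by (rule has_vector_derivative_within_subset) (use lu in auto)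
    ultimately show "((\<lambda>u. flow \<xi> (l * u)) has_vector_derivative l *\<^sub>R fh (flow \<xi> (l * u))) (at u within {0..1})"
      using vector_diff_chain_within by (fastforce simp: o_def)
  qed auto
  then show ?thesis by (simp add: quot_def flow(1) integral_unique flip: integral_cmul)
qed

lemma quot_cont: "continuous_on ({0..T} \<times> UNIV) (\<lambda>(l, \<xi>). quot l \<xi>)"
proof -
  have "continuous_on (({0..T} \<times> UNIV) \<times> cbox 0 1) (\<lambda>(z, u). fh (flow (snd z) (fst z * u)))"
    unfolding split_def
    by (intro continuous_intros) (use scale_unit_interval in \<open>force\<close>)
  from integral_continuous_on_param[OF this] show ?thesis
    by (simp add: quot_def split_def)
qed

section \<open>Tubes around the cycle\<close>

definition tube :: "real \<Rightarrow> (real^2) set" where "tube \<delta> = {y. \<exists>t. norm (y - x t) \<le> \<delta>}"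

lemma tube_mono: "\<delta> \<le> \<delta>' \<Longrightarrow> tube \<delta> \<subseteq> tube \<delta>'"
  by (auto simp: tube_def intro: order_trans)

lemma x_in_tube: "0 \<le> \<delta> \<Longrightarrow> x t \<in> tube \<delta>"
  by (auto simp: tube_def intro!: exI[of _ t])

lemma tube_compact: "compact (tube \<delta>)"
proof -
  have "tube \<delta> = {a + b | a b. a \<in> range x \<and> b \<in> cball 0 \<delta>}"
  proof (intro equalityI subsetI)
    fix y assume "y \<in> tube \<delta>"
    then obtain t where "norm (y - x t) \<le> \<delta>" by (auto simp: tube_def)
    then show "y \<in> {a + b | a b. a \<in> range x \<and> b \<in> cball 0 \<delta>}"
      by (intro CollectI exI[of _ "x t"] exI[of _ "y - x t"]) auto
  qed (auto simp: tube_def, metis add_diff_cancel_left')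
  then show ?thesis using compact_sums[OF x_range_compact compact_cball[of 0 \<delta>]] by (simp only:)
qed

lemma tube_subset_open:
  assumes "open U" "range x \<subseteq> U"
  obtains \<delta> where "0 < \<delta>" "tube \<delta> \<subseteq> U"
proof -
  obtain d where d: "0 < d" "\<And>a b. a \<in> range x \<Longrightarrow> b \<in> - U \<Longrightarrow> d \<le> dist a b"
    using separate_compact_closed[OF x_range_compact, of "- U"] assms
    by (metis closed_Compl disjoint_eq_subset_Compl double_complement)
  have "tube (d / 2) \<subseteq> U"
  proof
    fix y assume "y \<in> tube (d / 2)"
    then obtain t where "norm (y - x t) \<le> d / 2" by (auto simp: tube_def)
    then show "y \<in> U" using d(2)[of "x t" y] d(1) by (force simp: dist_norm norm_minus_commute)
  qed
  then show ?thesis using that[of "d / 2"] d by simp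
qed

text \<open>The zeros in \<open>A \<times> tube 1\<close> form a compact set. Its projection to the
  plane is compact and misses the cycle, hence misses a tube as well.\<close>

lemma tube_nonzero:
  fixes F :: "'a::metric_space \<Rightarrow> real^2 \<Rightarrow> real^2"
  assumes A: "compact A" and cont: "continuous_on (A \<times> UNIV) (\<lambda>(a, y). F a y)"
    and nz: "\<And>a t. a \<in> A \<Longrightarrow> F a (x t) \<noteq> 0"
  obtains \<delta> where "0 < \<delta>" "\<And>a y. a \<in> A \<Longrightarrow> y \<in> tube \<delta> \<Longrightarrow> F a y \<noteq> 0"
proof -
  define Z where "Z = {z \<in> A \<times> tube 1. (case z of (a, y) \<Rightarrow> F a y) = 0}"
  have cK: "compact (A \<times> tube 1)" by (intro compact_Times A tube_compact)
  have "closed Z" unfolding Z_def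
    by (rule continuous_closed_preimage_constant)
      (use cK in \<open>auto intro: continuous_on_subset[OF cont] compact_imp_closed\<close>)
  then have "compact ((A \<times> tube 1) \<inter> Z)" using cK by blast
  moreover have "(A \<times> tube 1) \<inter> Z = Z" by (auto simp: Z_def)
  ultimately have "compact Z" by simp
  then have "compact (snd ` Z)" by (intro compact_continuous_image continuous_intros)
  then have "open (- (snd ` Z))" by (simp add: compact_imp_closed open_Compl)
  moreover have "range x \<subseteq> - (snd ` Z)" using nz by (auto simp: Z_def)
  ultimately obtain \<delta> where \<delta>: "0 < \<delta>" "tube \<delta> \<subseteq> - (snd ` Z)" by (rule tube_subset_open)
  show ?thesis
  proof (rule that[of "min \<delta> 1"])
    fix a y assume a: "a \<in> A" and y: "y \<in> tube (min \<delta> 1)"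
    have "y \<in> tube \<delta>" "y \<in> tube 1" using y tube_mono[of "min \<delta> 1" \<delta>] tube_mono[of "min \<delta> 1" 1] by auto
    then show "F a y \<noteq> 0" using \<delta>(2) a by (force simp: Z_def)
  qed (use \<delta> in simp)
qed

text \<open>While the solution stays within distance 1 of the accompanying point of the cycle,
  \<open>f\<close> and \<open>fh\<close> agree and the Gronwall estimate applies; since that
  estimate is below 1, the solution never leaves this range.\<close>

lemma tube_bootstrap:
  assumes ab: "a \<le> b" "b - a \<le> T"
    and y: "\<And>t. t \<in> {a..b} \<Longrightarrow> (y has_vector_derivative y' t) (at t within {a..b})"
    and le: "\<And>t. t \<in> {a..b} \<Longrightarrow> norm (y t - x (t + c)) \<le> 1 \<Longrightarrow> norm (y' t - f (y t)) \<le> \<kappa>"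
    and \<kappa>: "0 \<le> \<kappa>" and small: "(norm (y a - x (a + c)) + \<kappa> * T) * exp (L * T) < 1"
    and t: "t \<in> {a..b}"
  shows "norm (y t - x (t + c)) \<le> (norm (y a - x (a + c)) + \<kappa> * T) * exp (L * T)"
proof -
  have xd: "((\<lambda>t. x (t + c)) has_vector_derivative f (x (t + c))) (at t within S)" for t S
  proof -
    have "((\<lambda>t. t + c) has_vector_derivative 1) (at t within S)" by (auto intro!: derivative_eq_intros)
    then show ?thesis using vector_diff_chain_within[of "\<lambda>t. t + c" 1 t S x] x_deriv_within by (force simp: o_def)
  qed
  have bd: "norm (y t - x (t + c)) \<le> (norm (y a - x (a + c)) + \<kappa> * T) * exp (L * T)"
    if t: "t \<in> {a..b}" and 1: "\<And>s. s \<in> {a..t} \<Longrightarrow> norm (y s - x (s + c)) \<le> 1" for t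
  proof (rule fh_gronwall[of a t y y' "\<lambda>t. x (t + c)" "\<lambda>t. f (x (t + c))" \<kappa> t])
    show "(y has_vector_derivative y' s) (at s within {a..t})" if "s \<in> {a..t}" for s
      using y by (rule has_vector_derivative_within_subset) (use that t in auto)
    show "norm (y' s - f (x (s + c)) - (fh (y s) - fh (x (s + c)))) \<le> \<kappa>" if "s \<in> {a..t}" for s
      using le[of s] 1[OF that] that t by (simp add: fh_eq[OF x_in_ball] fh_eq[OF near_in_ball[OF 1[OF that]]])
  qed (use t ab xd \<kappa> in auto)
  have lt: "norm (y t - x (t + c)) < 1" if "t \<in> {a..b}" for t
  proof (rule continuity_bootstrap[of a b "\<lambda>t. norm (y t - x (t + c))"])
    have "continuous_on {a..b} y" using y by (rule continuous_on_vector_derivative)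
    then show "continuous_on {a..b} (\<lambda>t. norm (y t - x (t + c)))" by (intro continuous_intros)
    show "norm (y a - x (a + c)) < 1"
    proof -
      have "norm (y a - x (a + c)) + 0 \<le> norm (y a - x (a + c)) + \<kappa> * T"
        using \<kappa> T_pos by (intro add_left_mono mult_nonneg_nonneg) auto
      also have "\<dots> = (norm (y a - x (a + c)) + \<kappa> * T) * 1" by simp
      also have "\<dots> \<le> (norm (y a - x (a + c)) + \<kappa> * T) * exp (L * T)"
        using \<kappa> T_pos L_pos by (intro mult_left_mono) auto
      finally show ?thesis using small by simp
    qed
    show "norm (y t - x (t + c)) < 1" if "t \<in> {a..b}" "\<And>s. s \<in> {a..t} \<Longrightarrow> norm (y s - x (s + c)) \<le> 1" for t
      using bd[OF that] small by simp
  qed (use that in auto)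
  show ?thesis by (rule bd[OF t]) (use lt t in \<open>auto simp: less_imp_le\<close>)
qed

lemma isolated_flow:
  assumes "isolated_cycle T f x"
  obtains \<delta> where "0 < \<delta>" "\<And>\<xi>. \<xi> \<in> tube \<delta> \<Longrightarrow> flow \<xi> T = \<xi> \<Longrightarrow> \<xi> \<in> range x"
proof -
  from assms[unfolded isolated_cycle_def] obtain U where U: "open U" "range x \<subseteq> U"
    and iso: "\<forall>y. periodic_solution T (\<lambda>t. f) y \<and> range y \<subseteq> U \<longrightarrow> (\<exists>\<theta>. \<forall>t. y t = x (\<theta> + t))"
    by (elim exE conjE)
  obtain d where d: "0 < d" "tube d \<subseteq> U" using tube_subset_open[OF U] .
  \<comment> \<open>Distances grow by at most the factor \<open>exp (L * T)\<close>, so an orbit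
    from \<open>tube \<delta>\<close> stays within \<open>min d 1\<close>: \<open>d\<close> puts it
    into \<open>U\<close>, and 1 makes it a solution for \<open>f\<close> itself.\<close>
  define \<delta> where "\<delta> = min d 1 * exp (- L * T)"
  have \<delta>: "exp (L * T) * \<delta> = min d 1" by (simp add: \<delta>_def exp_minus)
  show ?thesis
  proof (rule that[of \<delta>])
    show "0 < \<delta>" using d by (simp add: \<delta>_def)
    fix \<xi> assume \<xi>: "\<xi> \<in> tube \<delta>" and fix_pt: "flow \<xi> T = \<xi>"
    obtain \<theta> where \<theta>: "norm (\<xi> - x \<theta>) \<le> \<delta>" using \<xi> by (auto simp: tube_def)
    have close: "norm (flow \<xi> t - x (\<theta> + t)) \<le> min d 1" if "t \<in> {0..T}" for t
    proof -
      have "norm (flow \<xi> t - x (\<theta> + t)) \<le> exp (L * T) * norm (\<xi> - x \<theta>)"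
        using flow_lip[OF that, of \<xi> "x \<theta>"] flow_x[OF that] by simp
      also have "\<dots> \<le> exp (L * T) * \<delta>" using \<theta> by (intro mult_left_mono) auto
      finally show ?thesis using \<delta> by simp
    qed
    have "solves_ode_on (\<lambda>t. f) (flow \<xi>) {0..T}"
      unfolding solves_ode_on_def
    proof
      fix t assume t: "t \<in> {0..T}"
      then show "(flow \<xi> has_vector_derivative f (flow \<xi> t)) (at t within {0..T})"
        using flow_deriv[OF t, of \<xi>] close[OF t] near_in_ball[of "flow \<xi> t" "\<theta> + t"] by (simp add: fh_eq)
    qed
    then obtain y where y: "periodic_solution T (\<lambda>t. f) y" "\<And>t. t \<in> {0..T} \<Longrightarrow> y t = flow \<xi> t"
      using periodic_extension[OF T_pos, of "\<lambda>t. f" "flow \<xi>"] fix_pt flow(1) by metis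
    have "range y \<subseteq> U"
    proof
      fix z assume "z \<in> range y"
      then obtain t where t: "z = y t" by blast
      obtain k where k: "t - of_int k * T \<in> {0..<T}" using mod_period by blast
      have "y (t + T) = y t" for t using y(1) by (simp add: periodic_solution_def)
      from periodic_int[of y T, OF this] have "z = y (t - of_int k * T)"
        using t by (metis diff_add_cancel)
      then have "z = flow \<xi> (t - of_int k * T)" using y(2)[of "t - of_int k * T"] k by auto
      then have "z \<in> tube d" using close[of "t - of_int k * T"] k by (auto simp: tube_def)
      then show "z \<in> U" using d by blast
    qed
    then obtain \<theta>' where "\<And>t. y t = x (\<theta>' + t)" using iso y(1) by blast
    then show "\<xi> \<in> range x" using y(2)[of 0] T_pos flow(1) by (metis atLeastAtMost_iff less_imp_le order.refl rangeI)
  qed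
qed

end

subsection \<open>Normal coordinates near the cycle\<close>

lemma compact_positive_lower_bound:
  fixes g :: "'a::topological_space \<Rightarrow> real"
  assumes "compact K" "continuous_on K g" "\<And>z. z \<in> K \<Longrightarrow> 0 < g z"
  obtains d where "0 < d" "\<And>z. z \<in> K \<Longrightarrow> d \<le> g z"
proof (cases "K = {}")
  case True
  then show ?thesis using that[of 1] by simp
next
  case False
  then show ?thesis using continuous_attains_inf[OF assms(1) False assms(2)] assms(3) that by blast
qed

lemma perp_eq_0_iff [simp]: "perp v = 0 \<longleftrightarrow> v = 0"
  by (metis norm_eq_zero norm_perp)

lemma planar_orthogonal:
  fixes v w :: "real^2"
  assumes "v \<bullet> w = 0" "w \<noteq> 0"
  obtains r where "v = r *\<^sub>R perp w"
proof
  define v1 v2 w1 w2 where "v1 = vec_nth v 1" and "v2 = vec_nth v 2" and "w1 = vec_nth w 1" and "w2 = vec_nth w 2"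
  note d = this
  have w: "w1 * w1 + w2 * w2 \<noteq> 0"
    using assms(2) by (auto simp: d vec_eq_iff forall_2 sum_squares_eq_zero_iff)
  have o: "v1 * w1 + v2 * w2 = 0" using assms(1) by (simp add: d inner_vec_def sum_2)
  have "v1 * (w1 * w1 + w2 * w2) = (v2 * w1 - v1 * w2) * - w2"
    using o by algebra
  moreover have "v2 * (w1 * w1 + w2 * w2) = (v2 * w1 - v1 * w2) * w1"
    using o by algebra
  ultimately have "v1 = (v2 * w1 - v1 * w2) * - w2 / (w1 * w1 + w2 * w2)"
    "v2 = (v2 * w1 - v1 * w2) * w1 / (w1 * w1 + w2 * w2)"
    using w by (simp_all only: nonzero_eq_divide_eq[OF w])
  then show "v = ((vec_nth v 2 * vec_nth w 1 - vec_nth v 1 * vec_nth w 2) /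
      (vec_nth w 1 * vec_nth w 1 + vec_nth w 2 * vec_nth w 2)) *\<^sub>R perp w"
    by (simp add: vec_eq_iff forall_2 perp_def d)
qed

context planar_cycle
begin

text \<open>For a start \<open>a\<close> in one period and a gap \<open>u\<close> between
  \<open>\<eta>\<close> and \<open>T - \<eta>\<close>, compactness keeps \<open>x a\<close> and
  \<open>x (a + u)\<close> apart. Points closer than that have a gap near 0 or near
  \<open>T\<close>, whence the integer \<open>k\<close>.\<close>

lemma x_unif_inj:
  assumes \<eta>: "0 < \<eta>"
  obtains \<delta> where "0 < \<delta>" "\<And>a b. norm (x a - x b) < \<delta> \<Longrightarrow> \<exists>k. \<bar>a - b - of_int k * T\<bar> < \<eta>"
proof -
  obtain d where d: "0 < d" "\<And>z. z \<in> {0..T} \<times> {\<eta>..T - \<eta>} \<Longrightarrow> d \<le> norm (x (fst z) - x (fst z + snd z))"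
  proof (rule compact_positive_lower_bound)
    show "compact ({0..T} \<times> {\<eta>..T - \<eta>})" by (intro compact_Times) auto
    show "continuous_on ({0..T} \<times> {\<eta>..T - \<eta>}) (\<lambda>z. norm (x (fst z) - x (fst z + snd z)))"
      by (intro continuous_intros)
    show "0 < norm (x (fst z) - x (fst z + snd z))" if "z \<in> {0..T} \<times> {\<eta>..T - \<eta>}" for z
      using x_inj[of "fst z" "fst z + snd z"] that \<eta> by fastforce
  qed auto
  show ?thesis
  proof (rule that[OF d(1)])
    fix a b assume close: "norm (x a - x b) < d"
    obtain k where k: "(b - a) - of_int k * T \<in> {0..<T}" using mod_period by blast
    obtain j where j: "a - of_int j * T \<in> {0..<T}" using mod_period by blast
    define u where "u = (b - a) - of_int k * T"
    have "x a = x (a - of_int j * T)" using x_periodic_int[of "a - of_int j * T" j] by simp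
    moreover have "x b = x (a - of_int j * T + u)"
      using x_periodic_int[of "a - of_int j * T + u" "j + k"] by (simp add: u_def algebra_simps)
    ultimately have "\<not> (\<eta> \<le> u \<and> u \<le> T - \<eta>)"
      using d(2)[of "(a - of_int j * T, u)"] close j by auto
    then consider "u < \<eta>" | "T - \<eta> < u" by linarith
    then show "\<exists>k. \<bar>a - b - of_int k * T\<bar> < \<eta>"
    proof cases
      case 1
      then have "\<bar>a - b - of_int (- k) * T\<bar> < \<eta>" using k by (auto simp: u_def)
      then show ?thesis by blast
    next
      case 2
      then have "\<bar>a - b - of_int (- k - 1) * T\<bar> < \<eta>" using k by (auto simp: u_def algebra_simps)
      then show ?thesis by blast
    qed
  qed
qed

lemma speed_bounds:
  obtains m M where "0 < m" "\<And>t. m \<le> norm (f (x t))" "0 < M" "\<And>t. norm (f (x t)) \<le> M"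
proof -
  have c: "continuous_on (range x) (\<lambda>y. norm (f y))" by (intro continuous_intros)
  obtain m where m: "0 < m" "\<And>y. y \<in> range x \<Longrightarrow> m \<le> norm (f y)"
    by (rule compact_positive_lower_bound[OF x_range_compact c]) (use f_x_nonzero in auto)
  obtain y where y: "y \<in> range x" "\<And>z. z \<in> range x \<Longrightarrow> norm (f z) \<le> norm (f y)"
    using continuous_attains_sup[OF x_range_compact _ c] by auto
  show ?thesis
    by (rule that[of m "norm (f y)"]) (use m y f_x_nonzero in auto)
qed

lemma x_lip:
  assumes "\<And>t. norm (f (x t)) \<le> M"
  shows "norm (x a - x b) \<le> M * \<bar>a - b\<bar>"
proof -
  have "norm (x a - x b) \<le> M * norm (a - b)"
  proof (rule differentiable_bound[of UNIV x "\<lambda>t h. h *\<^sub>R f (x t)"])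
    show "(x has_derivative (\<lambda>h. h *\<^sub>R f (x t))) (at t within UNIV)" for t
      using x_deriv by (simp add: has_vector_derivative_def)
    show "onorm (\<lambda>h. h *\<^sub>R f (x t)) \<le> M" for t
      by (rule onorm_bound) (use assms[of t] order_trans[OF norm_ge_zero assms[of t]] in \<open>auto simp: mult.commute[of M] intro!: mult_left_mono\<close>)
  qed auto
  then show ?thesis by simp
qed

lemma fx_deriv: "((\<lambda>t. f (x t)) has_vector_derivative f' (x t) *v f (x t)) (at t)"
proof -
  have "((\<lambda>t. f (x t)) has_derivative (\<lambda>h. f' (x t) *v (h *\<^sub>R f (x t)))) (at t)"
    by (rule has_derivative_compose[OF x_deriv[unfolded has_vector_derivative_def] f_deriv])
  then show ?thesis by (simp add: has_vector_derivative_def matrix_vector_mult_scaleR)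
qed

text \<open>Along the cycle \<open>s \<mapsto> (\<xi> - x s) \<bullet> x' s\<close> decreases strictly as long as \<open>x s\<close> stays close to \<open>\<xi>\<close>.\<close>

lemma normal_foot_unique:
  obtains \<delta> where "0 < \<delta>" "\<And>\<xi> a b. norm (\<xi> - x a) \<le> \<delta> \<Longrightarrow> norm (\<xi> - x b) \<le> \<delta> \<Longrightarrow>
    (\<xi> - x a) \<bullet> f (x a) = 0 \<Longrightarrow> (\<xi> - x b) \<bullet> f (x b) = 0 \<Longrightarrow> x a = x b"
proof -
  obtain m M where m: "0 < m" "\<And>t. m \<le> norm (f (x t))" and M: "0 < M" "\<And>t. norm (f (x t)) \<le> M"
    using speed_bounds by blast
  \<comment> \<open>As \<open>\<epsilon> * L < m\<close>, the pairing decreases wherever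
    \<open>norm (\<xi> - x s) \<le> \<epsilon>\<close>. Half of \<open>\<epsilon>\<close> is spent
    on the distance at \<open>a\<close>, half on moving by less than \<open>\<eta>\<close> at speed
    at most \<open>M\<close>. The bound \<open>d / 3\<close> makes two feet of one point closer than
    \<open>d\<close>, hence their parameters closer than \<open>\<eta>\<close> modulo
    \<open>T\<close>.\<close>
  define \<epsilon> where "\<epsilon> = m / (2 * L)"
  have \<epsilon>: "0 < \<epsilon>" "\<epsilon> * L < m" using m L_pos by (auto simp: \<epsilon>_def)
  define \<eta> where "\<eta> = \<epsilon> / (2 * M)"
  have \<eta>: "0 < \<eta>" "M * \<eta> = \<epsilon> / 2" using \<epsilon> M by (auto simp: \<eta>_def)
  obtain d where d: "0 < d" "\<And>a b. norm (x a - x b) < d \<Longrightarrow> \<exists>k. \<bar>a - b - of_int k * T\<bar> < \<eta>"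
    using x_unif_inj[OF \<eta>(1)] by blast
  define \<delta> where "\<delta> = min (\<epsilon> / 2) (d / 3)"
  have \<delta>: "0 < \<delta>" "\<delta> \<le> \<epsilon> / 2" "2 * \<delta> < d" using \<epsilon> d by (auto simp: \<delta>_def min_def)
  have strict: False
    if ab: "a < b" "b - a < \<eta>" and close: "norm (\<xi> - x a) \<le> \<delta>"
      and orth: "(\<xi> - x a) \<bullet> f (x a) = 0" "(\<xi> - x b) \<bullet> f (x b) = 0" for \<xi> a b
  proof -
    let ?h = "\<lambda>s. (\<xi> - x s) \<bullet> f (x s)"
    have "?h b < ?h a"
    proof (rule DERIV_neg_imp_decreasing[OF ab(1)])
      fix s assume s: "a \<le> s" "s \<le> b"
      have "(?h has_vector_derivative ((\<xi> - x s) \<bullet> (f' (x s) *v f (x s)) + (0 - f (x s)) \<bullet> f (x s))) (at s)"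
        by (rule bounded_bilinear.has_vector_derivative[OF bounded_bilinear_inner])
          (intro has_vector_derivative_diff has_vector_derivative_const x_deriv fx_deriv)+
      then have D: "(?h has_real_derivative ((\<xi> - x s) \<bullet> (f' (x s) *v f (x s)) - (norm (f (x s)))\<^sup>2)) (at s)"
        by (simp add: has_real_derivative_iff_has_vector_derivative power2_norm_eq_inner)
      have "norm (x a - x s) \<le> M * \<bar>a - s\<bar>" by (rule x_lip[OF M(2)])
      also have "\<dots> \<le> M * \<eta>" using s ab M by (intro mult_left_mono) auto
      finally have "norm (\<xi> - x s) \<le> \<epsilon>"
        using close \<delta> \<eta> norm_triangle_ineq[of "\<xi> - x a" "x a - x s"] by auto
      then have "(\<xi> - x s) \<bullet> (f' (x s) *v f (x s)) \<le> \<epsilon> * (L * norm (f (x s)))"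
        using norm_cauchy_schwarz[of "\<xi> - x s" "f' (x s) *v f (x s)"] f'_bound[OF x_in_ball, of s "f (x s)"] \<epsilon>
        by (meson mult_mono norm_ge_zero order_trans less_imp_le)
      also have "\<dots> = (\<epsilon> * L) * norm (f (x s))" by simp
      also have "\<dots> < norm (f (x s)) * norm (f (x s))"
        using \<epsilon>(2) m(1) m(2)[of s] by (intro mult_strict_right_mono) auto
      finally show "\<exists>y. (?h has_real_derivative y) (at s) \<and> y < 0"
        using D by (intro exI conjI) (assumption, simp add: power2_eq_square)
    qed
    then show False using orth by simp
  qed
  show ?thesis
  proof (rule that[OF \<delta>(1)])
    fix \<xi> a b assume A: "norm (\<xi> - x a) \<le> \<delta>" "norm (\<xi> - x b) \<le> \<delta>"
      "(\<xi> - x a) \<bullet> f (x a) = 0" "(\<xi> - x b) \<bullet> f (x b) = 0"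
    have "norm (x a - x b) \<le> norm (\<xi> - x a) + norm (\<xi> - x b)"
      using norm_triangle_ineq4[of "\<xi> - x b" "\<xi> - x a"] by simp
    then have "norm (x a - x b) < d" using A \<delta> by linarith
    then obtain k where k: "\<bar>a - b - of_int k * T\<bar> < \<eta>" using d by blast
    define c where "c = b + of_int k * T"
    have c: "x c = x b" "\<bar>a - c\<bar> < \<eta>" using x_periodic_int k by (auto simp: c_def algebra_simps)
    consider "a < c" | "c < a" | "a = c" by linarith
    then show "x a = x b"
    proof cases
      case 1 then show ?thesis using strict[of a c \<xi>] A c by auto
    next
      case 2 then show ?thesis using strict[of c a \<xi>] A c by auto
    qed (use c in auto)
  qed
qed

section \<open>Nearest points on the cycle\<close>

definition foot_radius :: real where
  "foot_radius = (SOME \<delta>. 0 < \<delta> \<and> (\<forall>\<xi> a b. norm (\<xi> - x a) \<le> \<delta> \<longrightarrow> norm (\<xi> - x b) \<le> \<delta> \<longrightarrow>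
    (\<xi> - x a) \<bullet> f (x a) = 0 \<longrightarrow> (\<xi> - x b) \<bullet> f (x b) = 0 \<longrightarrow> x a = x b))"

lemma foot_radius: "0 < foot_radius"
  and foot_unique: "norm (\<xi> - x a) \<le> foot_radius \<Longrightarrow> norm (\<xi> - x b) \<le> foot_radius \<Longrightarrow>
    (\<xi> - x a) \<bullet> f (x a) = 0 \<Longrightarrow> (\<xi> - x b) \<bullet> f (x b) = 0 \<Longrightarrow> x a = x b"
proof -
  have "\<exists>\<delta>. 0 < \<delta> \<and> (\<forall>\<xi> a b. norm (\<xi> - x a) \<le> \<delta> \<longrightarrow> norm (\<xi> - x b) \<le> \<delta> \<longrightarrow>
    (\<xi> - x a) \<bullet> f (x a) = 0 \<longrightarrow> (\<xi> - x b) \<bullet> f (x b) = 0 \<longrightarrow> x a = x b)"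
    using normal_foot_unique by metis
  from someI_ex[OF this]
  have "0 < foot_radius \<and> (\<forall>\<xi> a b. norm (\<xi> - x a) \<le> foot_radius \<longrightarrow> norm (\<xi> - x b) \<le> foot_radius \<longrightarrow>
    (\<xi> - x a) \<bullet> f (x a) = 0 \<longrightarrow> (\<xi> - x b) \<bullet> f (x b) = 0 \<longrightarrow> x a = x b)"
    unfolding foot_radius_def .
  then show "0 < foot_radius" "norm (\<xi> - x a) \<le> foot_radius \<Longrightarrow> norm (\<xi> - x b) \<le> foot_radius \<Longrightarrow>
    (\<xi> - x a) \<bullet> f (x a) = 0 \<Longrightarrow> (\<xi> - x b) \<bullet> f (x b) = 0 \<Longrightarrow> x a = x b"
    by blast+
qed

definition foot :: "real^2 \<Rightarrow> real^2" where "foot \<xi> = closest_point (range x) \<xi>"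

lemma foot_in: "foot \<xi> \<in> range x" and foot_le: "norm (\<xi> - foot \<xi>) \<le> norm (\<xi> - x t)"
  using closest_point_exists[of "range x" \<xi>] x_range_compact
  by (auto simp: foot_def compact_imp_closed dist_norm)

lemma nearest_orthogonal:
  assumes min: "\<And>t. norm (\<xi> - x a) \<le> norm (\<xi> - x t)"
  shows "(\<xi> - x a) \<bullet> f (x a) = 0"
proof -
  let ?h = "\<lambda>s. (\<xi> - x s) \<bullet> (\<xi> - x s)"
  have "(?h has_vector_derivative ((\<xi> - x a) \<bullet> (0 - f (x a)) + (0 - f (x a)) \<bullet> (\<xi> - x a))) (at a)"
    by (rule bounded_bilinear.has_vector_derivative[OF bounded_bilinear_inner])
      (intro has_vector_derivative_diff has_vector_derivative_const x_deriv)+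
  then have "(?h has_real_derivative ((\<xi> - x a) \<bullet> (0 - f (x a)) + (0 - f (x a)) \<bullet> (\<xi> - x a))) (at a)"
    by (simp add: has_real_derivative_iff_has_vector_derivative)
  moreover have "?h a \<le> ?h s" for s
    using min[of s] by (simp add: dot_square_norm power_mono)
  ultimately have "(\<xi> - x a) \<bullet> (0 - f (x a)) + (0 - f (x a)) \<bullet> (\<xi> - x a) = 0"
    by (intro DERIV_local_min[of ?h _ a 1]) auto
  then show ?thesis by (simp add: inner_commute)
qed

text \<open>The nearest point is orthogonal as well and no farther from \<open>\<xi>\<close>, so the
  uniqueness of feet within \<open>foot_radius\<close> identifies the two.\<close>

lemma foot_eqI:
  assumes "norm (\<xi> - x a) \<le> foot_radius" "(\<xi> - x a) \<bullet> f (x a) = 0"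
  shows "foot \<xi> = x a"
proof -
  obtain b where b: "foot \<xi> = x b" using foot_in[of \<xi>] by blast
  have "(\<xi> - x b) \<bullet> f (x b) = 0" using foot_le[of \<xi>] b by (intro nearest_orthogonal) auto
  moreover have "norm (\<xi> - x b) \<le> foot_radius" using foot_le[of \<xi> a] b assms(1) by simp
  ultimately show ?thesis using foot_unique[of \<xi> a b] assms b by simp
qed

lemma foot_x [simp]: "foot (x t) = x t"
  by (rule foot_eqI) (use foot_radius in auto)

lemma foot_dist: "\<xi> \<in> tube \<delta> \<Longrightarrow> norm (\<xi> - foot \<xi>) \<le> \<delta>"
  using foot_le[of \<xi>] by (auto simp: tube_def intro: order_trans)

lemma foot_orthogonal: "foot \<xi> = x a \<Longrightarrow> (\<xi> - x a) \<bullet> f (x a) = 0"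
  using foot_le[of \<xi>] by (intro nearest_orthogonal) auto

text \<open>Along the segment the vector from the foot is merely scaled: it stays orthogonal to the
  tangent and short, which determines the foot. A deformation along normals thus reaches the cycle
  at its end and not before.\<close>

lemma foot_segment:
  assumes \<xi>: "\<xi> \<in> tube \<delta>" "\<delta> \<le> foot_radius" and l: "l \<in> {0..1}"
  defines "\<zeta> \<equiv> (1 - l) *\<^sub>R \<xi> + l *\<^sub>R foot \<xi>"
  shows "\<zeta> \<in> tube \<delta>" "foot \<zeta> = foot \<xi>" "\<zeta> \<in> range x \<Longrightarrow> l = 1 \<or> \<xi> \<in> range x"
proof -
  obtain a where a: "foot \<xi> = x a" using foot_in[of \<xi>] by blast
  have eq: "\<zeta> - x a = (1 - l) *\<^sub>R (\<xi> - x a)" by (simp add: \<zeta>_def a algebra_simps)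
  have "norm (\<zeta> - x a) \<le> norm (\<xi> - x a)" unfolding eq using l by (simp add: mult_left_le_one_le)
  then have le: "norm (\<zeta> - x a) \<le> \<delta>" using foot_dist[OF \<xi>(1)] a by simp
  then show "\<zeta> \<in> tube \<delta>" by (auto simp: tube_def)
  show f\<zeta>: "foot \<zeta> = foot \<xi>" unfolding a
    by (rule foot_eqI) (use le \<xi>(2) foot_orthogonal[OF a] in \<open>auto simp: eq\<close>)
  show "l = 1 \<or> \<xi> \<in> range x" if "\<zeta> \<in> range x"
  proof -
    have "\<zeta> = foot \<zeta>" using that by auto
    then have "(1 - l) *\<^sub>R (\<xi> - x a) = 0" using eq f\<zeta> a by simp
    then show ?thesis by auto
  qed
qed

text \<open>The graph is cut out by the inequalities of minimality, whose only solution is the foot,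
  so it is closed; with values in a compact set this gives continuity.\<close>

lemma foot_cont: "continuous_on (tube foot_radius) foot"
proof (rule continuous_from_closed_graph[OF x_range_compact])
  show "foot \<in> tube foot_radius \<rightarrow> range x" using foot_in by auto
  have "(\<lambda>\<xi>. (\<xi>, foot \<xi>)) ` tube foot_radius =
      (tube foot_radius \<times> range x) \<inter> (\<Inter>t. {z. norm (fst z - snd z) \<le> norm (fst z - x t)})"
  proof (intro equalityI subsetI)
    fix z assume z: "z \<in> (tube foot_radius \<times> range x) \<inter> (\<Inter>t. {z. norm (fst z - snd z) \<le> norm (fst z - x t)})"
    then obtain \<xi> a where za: "z = (\<xi>, x a)" "\<xi> \<in> tube foot_radius" by auto
    have min: "norm (\<xi> - x a) \<le> norm (\<xi> - x t)" for t using z za by auto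
    have "norm (\<xi> - x a) \<le> foot_radius"
      using za(2) min by (auto simp: tube_def intro: order_trans)
    then have "foot \<xi> = x a" by (rule foot_eqI) (rule nearest_orthogonal[OF min])
    then show "z \<in> (\<lambda>\<xi>. (\<xi>, foot \<xi>)) ` tube foot_radius" using za by auto
  qed (use foot_in foot_le in auto)
  moreover have "closed ((tube foot_radius \<times> range x) \<inter> (\<Inter>t. {z. norm (fst z - snd z) \<le> norm (fst z - x t)}))"
    by (intro closed_Int closed_Times closed_INT ballI closed_Collect_le continuous_intros
        compact_imp_closed tube_compact x_range_compact)
  ultimately show "closed ((\<lambda>\<xi>. (\<xi>, foot \<xi>)) ` tube foot_radius)" by simp
qed

lemma foot_cont_compose [continuous_intros]:
  assumes "continuous_on S g" "\<And>z. z \<in> S \<Longrightarrow> g z \<in> tube foot_radius"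
  shows "continuous_on S (\<lambda>z. foot (g z))"
  by (rule continuous_on_compose2[OF foot_cont assms(1)]) (use assms(2) in auto)

section \<open>Parallel curves and the two sides of the cycle\<close>

definition normal_curve :: "real \<Rightarrow> real \<Rightarrow> real^2" where
  "normal_curve r t = x t + r *\<^sub>R perp (f (x t))"

lemma normal_curve_cont [continuous_intros]:
  "continuous_on S g \<Longrightarrow> continuous_on S h \<Longrightarrow> continuous_on S (\<lambda>z. normal_curve (g z) (h z))"
  unfolding normal_curve_def by (intro continuous_intros)

lemma normal_curve_periodic: "normal_curve r (t + T) = normal_curve r t"
  by (simp add: normal_curve_def x_periodic)

lemma norm_normal_curve: "norm (normal_curve r t - x t) = \<bar>r\<bar> * norm (f (x t))"
  by (simp add: normal_curve_def)

lemma normal_curve_foot: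
  assumes "\<bar>r\<bar> * norm (f (x t)) \<le> foot_radius"
  shows "foot (normal_curve r t) = x t" "r \<noteq> 0 \<Longrightarrow> normal_curve r t \<notin> range x"
proof -
  show eq: "foot (normal_curve r t) = x t"
    by (rule foot_eqI) (use assms in \<open>auto simp: normal_curve_def\<close>)
  show "normal_curve r t \<notin> range x" if "r \<noteq> 0"
  proof
    assume "normal_curve r t \<in> range x"
    then have "foot (normal_curve r t) = normal_curve r t" by auto
    then show False using eq norm_normal_curve[of r t] that f_x_nonzero[of t] by simp
  qed
qed

lemma normal_curve_surj:
  obtains r a where "\<xi> = normal_curve r a" "norm (\<xi> - foot \<xi>) = \<bar>r\<bar> * norm (f (x a))"
proof -
  obtain a where a: "foot \<xi> = x a" using foot_in[of \<xi>] by blast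
  obtain r where r: "\<xi> - x a = r *\<^sub>R perp (f (x a))"
    using planar_orthogonal[OF foot_orthogonal[OF a] f_x_nonzero] by blast
  have "\<xi> = normal_curve r a" using r by (simp add: normal_curve_def algebra_simps)
  then show ?thesis using that a norm_normal_curve[of r a] by simp
qed

text \<open>The two sides of the cycle, its inside and its outside, are treated alike.\<close>

definition side :: "(real^2) set \<Rightarrow> bool" where
  "side S \<longleftrightarrow> S \<inter> range x = {} \<and> x 0 \<in> closure S \<and> closed (S \<union> range x) \<and>
    (\<forall>C. connected C \<and> C \<inter> range x = {} \<and> C \<inter> S \<noteq> {} \<longrightarrow> C \<subseteq> S)"

lemma side_connected: "side S \<Longrightarrow> connected C \<Longrightarrow> C \<inter> range x = {} \<Longrightarrow> c \<in> C \<Longrightarrow> c \<in> S \<Longrightarrow> C \<subseteq> S"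
  unfolding side_def by blast

text \<open>Without its end the segment is connected and misses the cycle, so it cannot change
  sides.\<close>

lemma side_segment:
  assumes S: "side S" and \<xi>: "\<xi> \<in> S" "\<xi> \<in> tube foot_radius" and l: "l \<in> {0..1}"
  shows "(1 - l) *\<^sub>R \<xi> + l *\<^sub>R foot \<xi> \<in> S \<union> range x"
proof (cases "l = 1")
  case True then show ?thesis using foot_in[of \<xi>] by simp
next
  case False
  define C where "C = (\<lambda>l. (1 - l) *\<^sub>R \<xi> + l *\<^sub>R foot \<xi>) ` {0..<1::real}"
  have "C \<subseteq> S"
  proof (rule side_connected[OF S])
    show "connected C" unfolding C_def by (intro connected_continuous_image continuous_intros) auto
    have "\<xi> \<notin> range x" using S \<xi>(1) by (auto simp: side_def)
    then have "(1 - l) *\<^sub>R \<xi> + l *\<^sub>R foot \<xi> \<notin> range x" if "l \<in> {0..<1}" for l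
      using foot_segment(3)[OF \<xi>(2) order.refl, of l] that by auto
    then show "C \<inter> range x = {}" unfolding C_def by blast
    show "\<xi> \<in> C" unfolding C_def by (rule image_eqI[of _ _ 0]) auto
  qed (rule \<xi>(1))
  then show ?thesis using l False by (auto simp: C_def)
qed

text \<open>Each half-collar, for one sign of \<open>\<sigma>\<close>, is connected and misses the
  cycle, so it lies in \<open>S\<close> as soon as one of its points does. As \<open>x 0\<close> is
  in the closure of \<open>S\<close>, some point of \<open>S\<close> is close enough to belong to
  one of them.\<close>

lemma side_normal_curve:
  assumes S: "side S"
  obtains \<sigma> r0 where "\<sigma> \<in> {-1, 1::real}" "0 < r0"
    "\<And>r t. r \<in> {0<..r0} \<Longrightarrow> normal_curve (\<sigma> * r) t \<in> S"
proof -
  obtain m M where m: "0 < m" "\<And>t. m \<le> norm (f (x t))" and M: "0 < M" "\<And>t. norm (f (x t)) \<le> M"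
    using speed_bounds by blast
  define r0 where "r0 = foot_radius / M"
  have r0: "0 < r0" using foot_radius M by (simp add: r0_def)
  have small: "\<bar>\<sigma> * r\<bar> * norm (f (x t)) \<le> foot_radius" if "\<sigma> \<in> {-1, 1}" "r \<in> {0<..r0}" for \<sigma> r t
  proof -
    have "\<bar>\<sigma> * r\<bar> * norm (f (x t)) \<le> r0 * M" using that M(2)[of t] r0 by (intro mult_mono) auto
    then show ?thesis using M by (simp add: r0_def)
  qed
  define C where "C \<sigma> = (\<lambda>(r, t). normal_curve (\<sigma> * r) t) ` ({0<..r0} \<times> UNIV)" for \<sigma> :: real
  have conn: "connected (C \<sigma>)" for \<sigma>
    unfolding C_def split_def 
    by (intro connected_continuous_image continuous_intros connected_Times) auto
  have disj: "C \<sigma> \<inter> range x = {}" if "\<sigma> \<in> {-1, 1}" for \<sigma>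
  proof -
    have "normal_curve (\<sigma> * r) t \<notin> range x" if "r \<in> {0<..r0}" for r t
      by (rule normal_curve_foot(2)[OF small[OF \<open>\<sigma> \<in> {-1, 1}\<close> that]]) (use that \<open>\<sigma> \<in> {-1, 1}\<close> in auto)
    then show ?thesis unfolding C_def split_def by (auto simp del: greaterThanAtMost_iff) (metis rangeI)
  qed
  \<comment> \<open>A point with normal coordinate \<open>r\<close> has distance at least
    \<open>\<bar>r\<bar> * m\<close> from the cycle, so a distance below \<open>m * r0\<close>
    forces \<open>\<bar>r\<bar> < r0\<close>.\<close>
  define d where "d = min (m * r0) 1"
  have d: "0 < d" using m r0 by (simp add: d_def)
  obtain \<xi> where \<xi>: "\<xi> \<in> S" "norm (\<xi> - x 0) < d"
    using S d by (auto simp: side_def closure_approachable dist_norm)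
  obtain r a where ra: "\<xi> = normal_curve r a" "norm (\<xi> - foot \<xi>) = \<bar>r\<bar> * norm (f (x a))"
    by (rule normal_curve_surj)
  have "\<bar>r\<bar> * m \<le> \<bar>r\<bar> * norm (f (x a))" using m by (intro mult_left_mono) auto
  also have "\<dots> < d" using ra(2) foot_le[of \<xi> 0] \<xi>(2) by simp
  also have "\<dots> \<le> r0 * m" by (simp add: d_def mult.commute)
  finally have "\<bar>r\<bar> < r0" using m by simp
  moreover have "r \<noteq> 0"
  proof
    assume "r = 0"
    then have "\<xi> = x a" using ra(1) by (simp add: normal_curve_def)
    then show False using S \<xi>(1) by (auto simp: side_def)
  qed
  ultimately have "\<xi> \<in> C (sgn r)"
    unfolding C_def ra(1) by (intro image_eqI[of _ _ "(\<bar>r\<bar>, a)"]) (auto simp: sgn_mult_abs)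
  moreover have \<sigma>: "sgn r \<in> {-1, 1}" using \<open>r \<noteq> 0\<close> by (auto simp: sgn_if)
  ultimately have "C (sgn r) \<subseteq> S"
    using side_connected[OF S conn disj[OF \<sigma>]] \<xi>(1) by blast
  then show ?thesis by (intro that[OF \<sigma> r0]) (force simp: C_def image_subset_iff)
qed

lemma range_x_path_image: "to_c ` range x = path_image (complex_path T x)"
proof -
  have "{0..T} = (\<lambda>u. T * u) ` {0..1}" using T_pos by (simp add: image_mult_atLeastAtMost)
  then show ?thesis unfolding x_range by (simp add: path_image_def complex_path_eq image_image)
qed

lemma complex_path_x_loop: "pathfinish (complex_path T x) = pathstart (complex_path T x)"
  using x_periodic[of 0] by (simp add: pathfinish_def pathstart_def complex_path_eq)

lemma closure_to_c: "z \<in> closure A" if "to_c z \<in> closure (to_c ` A)"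
  using that unfolding closure_approachable by (auto simp: dist_norm simp flip: to_c_diff)

text \<open>By the Jordan curve theorem the cycle is the frontier of both sets, which puts
  \<open>x 0\<close> into both closures. A connected set off the cycle lies in one component of the
  complement.\<close>

lemma side_inside: "side (inside (range x))" and side_outside: "side (outside (range x))"
proof -
  note J = Jordan_inside_outside[OF simple complex_path_x_loop]
  have 0: "to_c (x 0) \<in> path_image (complex_path T x)" unfolding range_x_path_image[symmetric] by blast
  have cl: "closed (range x)" using x_range_compact by (rule compact_imp_closed)
  have "to_c (x 0) \<in> closure (to_c ` inside (range x))"
    unfolding inside_to_c range_x_path_image using J 0 by (auto simp: frontier_def)
  then have 1: "x 0 \<in> closure (inside (range x))" by (rule closure_to_c)
  have "to_c (x 0) \<in> closure (to_c ` outside (range x))"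
    unfolding outside_to_c range_x_path_image using J 0 by (auto simp: frontier_def)
  then have 2: "x 0 \<in> closure (outside (range x))" by (rule closure_to_c)
  have cc: "connected_component (- range x) c d" if "connected C" "C \<inter> range x = {}" "c \<in> C" "d \<in> C" for C c d
    using that unfolding connected_component_def by blast
  show "side (inside (range x))"
    unfolding side_def
  proof (intro conjI allI impI 1)
    show "closed (inside (range x) \<union> range x)"
      using open_outside[OF cl] by (metis Un_commute closed_Compl union_with_inside)
    fix C assume C: "connected C \<and> C \<inter> range x = {} \<and> C \<inter> inside (range x) \<noteq> {}"
    then obtain c where "c \<in> C" "c \<in> inside (range x)" by blast
    then show "C \<subseteq> inside (range x)" using inside_same_component cc C by blast
  qed simp
  show "side (outside (range x))"
    unfolding side_def
  proof (intro conjI allI impI 2)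
    show "closed (outside (range x) \<union> range x)"
      using open_inside[OF cl] by (metis Un_commute closed_Compl union_with_outside)
    fix C assume C: "connected C \<and> C \<inter> range x = {} \<and> C \<inter> outside (range x) \<noteq> {}"
    then obtain c where "c \<in> C" "c \<in> outside (range x)" by blast
    then show "C \<subseteq> outside (range x)" using outside_same_component cc C by blast
  qed simp
qed

text \<open>Hopf's theorem on the rotation of the tangent: pushing the curve along its normal to the inside
  leaves \<open>x - (x + r n) = - r n\<close>, and the pushed curve can be contracted to a point of the inside.\<close>

lemma tangent_turns:
  assumes pos: "positively_oriented T x"
  shows "turns T (\<lambda>t. f (x t)) = 1"
proof -
  obtain \<sigma> r where \<sigma>: "\<sigma> \<in> {-1, 1::real}" and r: "0 < r"
    and ins: "\<And>t. normal_curve (\<sigma> * r) t \<in> inside (range x)"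
    using side_normal_curve[OF side_inside] by (metis greaterThanAtMost_iff order.refl)
  have T0: "0 \<le> T" using T_pos by simp
  let ?q = "complex_path T (normal_curve (\<sigma> * r))"
  have xT: "x T = x 0" using x_periodic[of 0] by simp
  obtain w where w: "w \<in> inside (path_image (complex_path T x))"
    and eq: "winding_number (\<lambda>u. complex_path T x u - ?q u) 0 = winding_number (complex_path T x) w"
  proof (rule winding_number_diff_inside_loop[OF simple complex_path_x_loop, of ?q])
    show "path ?q" by (rule path_complex_path[OF T0]) (intro continuous_intros)
    show "pathfinish ?q = pathstart ?q"
      using xT by (simp add: pathfinish_def pathstart_def complex_path_eq normal_curve_def)
    show "path_image ?q \<subseteq> inside (path_image (complex_path T x))"
      using ins unfolding range_x_path_image[symmetric] inside_to_c[symmetric]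
      by (auto simp: path_image_def complex_path_eq)
  qed
  \<comment> \<open>Which normal direction points inside need not be known: both quarter turns of
    the tangent turn as often as the tangent.\<close>
  have "turns T (\<lambda>t. f (x t)) = turns T (\<lambda>t. (- \<sigma>) *\<^sub>R perp (f (x t)))"
  proof -
    have "continuous_on {0..T} (\<lambda>t. f (x t))" by (intro continuous_intros)
    then show ?thesis using \<sigma> turns_perp[OF T0, of "\<lambda>t. f (x t)"] xT f_x_nonzero by auto
  qed
  also have "\<dots> = turns T (\<lambda>t. r *\<^sub>R ((- \<sigma>) *\<^sub>R perp (f (x t))))"
    by (rule turns_scale[symmetric, OF T0])
      (use r \<sigma> xT f_x_nonzero in \<open>auto intro!: continuous_intros\<close>)
  also have "\<dots> = turns T (\<lambda>t. x t - normal_curve (\<sigma> * r) t)"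
    by (rule arg_cong[of _ _ "turns T"]) (auto simp: normal_curve_def)
  also have "\<dots> = winding_number (\<lambda>u. complex_path T x u - ?q u) 0"
    unfolding turns_def by (simp add: complex_path_eq to_c_diff)
  also have "\<dots> = 1" using eq pos w by (simp add: positively_oriented_def)
  finally show ?thesis .
qed

end

subsection \<open>The index of the translation operator on either side of the cycle\<close>

context planar_cycle
begin

lemma T_nonneg: "0 \<le> T" using T_pos by simp

text \<open>Before \<open>T\<close> has elapsed the cycle does not return, and at time 0 the
  quotient is the nonzero velocity. The limit \<open>T / 2\<close> suits \<open>side_loop\<close>,
  where a period \<open>u \<ge> T / 2\<close> leaves the remainder \<open>T - u\<close>.\<close>

lemma quot_nonzero:
  obtains \<delta> where "0 < \<delta>" "\<And>l y. l \<in> {0..T / 2} \<Longrightarrow> y \<in> tube \<delta> \<Longrightarrow> quot l y \<noteq> 0"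
proof (rule tube_nonzero[of "{0..T / 2}" quot])
  show "continuous_on ({0..T / 2} \<times> UNIV) (\<lambda>(a, y). quot a y)"
    by (rule continuous_on_subset[OF quot_cont]) (use T_pos in auto)
  show "quot l (x t) \<noteq> 0" if l: "l \<in> {0..T / 2}" for l t
  proof (cases "l = 0")
    case True
    then show ?thesis using f_x_nonzero by (simp add: quot_0 fh_eq[OF x_in_ball])
  next
    case False
    have "l *\<^sub>R quot l (x t) = x (t + l) - x t"
      using l T_pos by (subst quot_eq) (auto simp: flow_x)
    moreover have "x (t + l) \<noteq> x t"
      using x_inj[of t "t + l"] l False T_pos by auto
    ultimately show ?thesis by auto
  qed
qed (use that in auto)

text \<open>The cycle has no return in this range of times, so neither has a thin tube. Periods in
  \<open>{T / 2..T}\<close> near the cycle therefore exceed \<open>T - \<eta>\<close>.\<close>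

lemma period_near_T:
  assumes \<eta>: "0 < \<eta>"
  obtains \<delta> where "0 < \<delta>" "\<And>u y. u \<in> {T / 2..T - \<eta>} \<Longrightarrow> y \<in> tube \<delta> \<Longrightarrow> flow y u \<noteq> y"
proof -
  obtain \<delta> where \<delta>: "0 < \<delta>" "\<And>u y. u \<in> {T / 2..T - \<eta>} \<Longrightarrow> y \<in> tube \<delta> \<Longrightarrow> flow y u - y \<noteq> 0"
  proof (rule tube_nonzero[of "{T / 2..T - \<eta>}" "\<lambda>u y. flow y u - y"])
    show "continuous_on ({T / 2..T - \<eta>} \<times> UNIV) (\<lambda>(u, y). flow y u - y)"
      unfolding split_def by (intro continuous_intros) (use T_pos \<eta> in auto)
    show "flow (x t) u - x t \<noteq> 0" if "u \<in> {T / 2..T - \<eta>}" for u t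
      using that \<eta> T_pos x_inj[of t "t + u"] by (auto simp: flow_x)
  qed auto
  then show ?thesis using that by auto
qed

text \<open>The homotopy moves the loop along the normals onto the cycle, and then along the cycle.\<close>

lemma turns_onto_cycle:
  assumes S: "side S"
    and V: "continuous_on (tube \<delta> \<inter> (S \<union> range x)) V" "\<And>y. y \<in> tube \<delta> \<inter> (S \<union> range x) \<Longrightarrow> V y \<noteq> 0"
    and \<delta>: "0 < \<delta>" "\<delta> \<le> foot_radius"
    and c: "continuous_on {0..T} c" "c T = c 0" "\<And>t. t \<in> {0..T} \<Longrightarrow> c t \<in> S \<inter> tube \<delta>"
    and near: "\<And>t. t \<in> {0..T} \<Longrightarrow> norm (c t - x (\<theta> + t)) \<le> foot_radius / 2"
  shows "turns T (\<lambda>t. V (c t)) = turns T (\<lambda>t. V (x t))"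
proof -
  have ctf: "c t \<in> tube foot_radius" if "t \<in> {0..T}" for t
    using c(3)[OF that] tube_mono[OF \<delta>(2)] by auto
  have cycle_in: "y \<in> tube \<delta> \<inter> (S \<union> range x)" if "y \<in> range x" for y
    using that x_in_tube[of \<delta>] \<delta>(1) by auto
  have Vx: "continuous_on (range x) V" by (rule continuous_on_subset[OF V(1)]) (use cycle_in in auto)
  have c2: "continuous_on ({0..1} \<times> {0..T}) (\<lambda>z. c (snd z))" 
    by (rule continuous_on_compose2[OF c(1)]) (auto intro!: continuous_intros)
  let ?H = "\<lambda>l t. (1 - l) *\<^sub>R c t + l *\<^sub>R foot (c t)"
  have Hin: "?H l t \<in> tube \<delta> \<inter> (S \<union> range x)" if "l \<in> {0..1}" "t \<in> {0..T}" for l t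
    using foot_segment(1)[OF _ \<delta>(2) that(1), of "c t"] side_segment[OF S _ ctf[OF that(2)] that(1)] c(3)[OF that(2)]
    by auto
  have "turns T (\<lambda>t. V (?H 0 t)) = turns T (\<lambda>t. V (?H 1 t))"
  proof (rule turns_homotopic[OF T_nonneg])
    show "continuous_on ({0..1} \<times> {0..T}) (\<lambda>(l, t). V (?H l t))"
      unfolding split_def
    proof (rule continuous_on_compose2[OF V(1)])
      show "continuous_on ({0..1} \<times> {0..T}) (\<lambda>z. ?H (fst z) (snd z))"
        using ctf by (auto intro!: continuous_intros c2)
      show "(\<lambda>z. ?H (fst z) (snd z)) ` ({0..1} \<times> {0..T}) \<subseteq> tube \<delta> \<inter> (S \<union> range x)"
        using Hin by (intro image_subsetI) (metis mem_Times_iff)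
    qed
  qed (use Hin V(2) c(2) in auto)
  then have 1: "turns T (\<lambda>t. V (c t)) = turns T (\<lambda>t. V (foot (c t)))" by simp
  \<comment> \<open>The chord from the foot to \<open>x (\<theta> + t)\<close> is projected back
    onto the cycle. Its length is at most twice the distance of \<open>c t\<close> from
    \<open>x (\<theta> + t)\<close>, whence \<open>foot_radius / 2\<close> in
    \<open>near\<close>.\<close>
  let ?G = "\<lambda>l t. foot ((1 - l) *\<^sub>R foot (c t) + l *\<^sub>R x (\<theta> + t))"
  have Gin: "(1 - l) *\<^sub>R foot (c t) + l *\<^sub>R x (\<theta> + t) \<in> tube foot_radius" if "l \<in> {0..1}" "t \<in> {0..T}" for l t
  proof -
    have "(1 - l) *\<^sub>R foot (c t) + l *\<^sub>R x (\<theta> + t) - x (\<theta> + t) = (1 - l) *\<^sub>R (foot (c t) - x (\<theta> + t))"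
      by (simp add: algebra_simps)
    then have "norm ((1 - l) *\<^sub>R foot (c t) + l *\<^sub>R x (\<theta> + t) - x (\<theta> + t)) \<le> norm (foot (c t) - x (\<theta> + t))"
      using that by (simp add: mult_left_le_one_le)
    also have "\<dots> \<le> norm (c t - foot (c t)) + norm (c t - x (\<theta> + t))"
      using norm_triangle_ineq4[of "c t - x (\<theta> + t)" "c t - foot (c t)"] by simp
    also have "\<dots> \<le> foot_radius" using near[OF that(2)] foot_le[of "c t" "\<theta> + t"] by simp
    finally show ?thesis unfolding tube_def by blast
  qed
  have xT: "x (\<theta> + T) = x \<theta>" by (rule x_periodic)
  have "turns T (\<lambda>t. V (?G 0 t)) = turns T (\<lambda>t. V (?G 1 t))"
  proof (rule turns_homotopic[OF T_nonneg])
    show "continuous_on ({0..1} \<times> {0..T}) (\<lambda>(l, t). V (?G l t))"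
      unfolding split_def
      by (rule continuous_on_compose2[OF Vx]) (use Gin foot_in ctf in \<open>auto intro!: continuous_intros c2\<close>)
    show "V (?G l t) \<noteq> 0" for l t using V(2)[OF cycle_in[OF foot_in]] .
  qed (use c(2) xT in auto)
  moreover have "foot (foot y) = foot y" for y using foot_in[of y] by auto
  ultimately have 2: "turns T (\<lambda>t. V (foot (c t))) = turns T (\<lambda>t. V (x (\<theta> + t)))" by simp
  \<comment> \<open>What remains is the cycle with phase \<open>\<theta>\<close>, and the phase is
    lowered to 0.\<close>
  have "turns T (\<lambda>t. V (x ((1 - 0) * \<theta> + t))) = turns T (\<lambda>t. V (x ((1 - 1) * \<theta> + t)))"
  proof (rule turns_homotopic[OF T_nonneg])
    show "continuous_on ({0..1} \<times> {0..T}) (\<lambda>(l, t). V (x ((1 - l) * \<theta> + t)))"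
      unfolding split_def
      by (rule continuous_on_compose2[OF Vx]) (auto intro!: continuous_intros)
    show "V (x ((1 - l) * \<theta> + t)) \<noteq> 0" for l t using V(2)[OF cycle_in] by blast
    show "V (x ((1 - l) * \<theta> + T)) = V (x ((1 - l) * \<theta> + 0))" for l using x_periodic[of "(1 - l) * \<theta>"] by simp
  qed
  then show ?thesis using 1 2 by simp
qed

text \<open>\<open>L\<close> being a Lipschitz constant of \<open>fh\<close>, the condition
  \<open>near\<close> makes \<open>turns_near\<close> applicable to \<open>fh\<close> along
  \<open>c\<close> and the tangent of the cycle, which turns once.\<close>

lemma turns_fh_near_cycle:
  assumes pos: "positively_oriented T x"
    and c: "continuous_on {0..T} c" "c T = c 0" 
    and near: "\<And>t. t \<in> {0..T} \<Longrightarrow> L * norm (c t - x (\<theta> + t)) < norm (f (x (\<theta> + t)))"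
  shows "turns T (\<lambda>t. fh (c t)) = 1"
proof -
  have "turns T (\<lambda>t. f (x (\<theta> + t))) = turns T (\<lambda>t. fh (c t))"
  proof (rule turns_near[OF T_nonneg])
    show "continuous_on {0..T} (\<lambda>t. f (x (\<theta> + t)))" "continuous_on {0..T} (\<lambda>t. fh (c t))"
      by (intro continuous_intros c)+
    show "f (x (\<theta> + T)) = f (x (\<theta> + 0))" by (simp add: x_periodic)
    show "fh (c T) = fh (c 0)" using c(2) by simp
    show "norm (f (x (\<theta> + t)) - fh (c t)) < norm (f (x (\<theta> + t)))" if "t \<in> {0..T}" for t
      using near[OF that] fh_lip[of "x (\<theta> + t)" "c t"] by (simp add: fh_eq[OF x_in_ball] norm_minus_commute)
  qed
  moreover have "turns T (\<lambda>t. f (x ((1 - 0) * \<theta> + t))) = turns T (\<lambda>t. f (x ((1 - 1) * \<theta> + t)))"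
  proof (rule turns_homotopic[OF T_nonneg])
    show "continuous_on ({0..1} \<times> {0..T}) (\<lambda>(l, t). f (x ((1 - l) * \<theta> + t)))"
      unfolding split_def by (intro continuous_intros)
    show "f (x ((1 - l) * \<theta> + T)) = f (x ((1 - l) * \<theta> + 0))" for l using x_periodic[of "(1 - l) * \<theta>"] by simp
  qed (rule f_x_nonzero)
  ultimately show ?thesis using tangent_turns[OF pos] by simp
qed

text \<open>The displacement vanishes at time 0, but its quotient by the elapsed time does not: this
  quotient joins \<open>fh\<close> to a positive multiple of the displacement over time
  \<open>s\<close> without a zero.\<close>

lemma turns_quot:
  assumes pos: "positively_oriented T x"
    and c: "continuous_on {0..T} c" "c T = c 0" 
    and near: "\<And>t. t \<in> {0..T} \<Longrightarrow> L * norm (c t - x (\<theta> + t)) < norm (f (x (\<theta> + t)))"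
    and nz: "\<And>l t. l \<in> {0..T / 2} \<Longrightarrow> t \<in> {0..T} \<Longrightarrow> quot l (c t) \<noteq> 0"
    and s: "s \<in> {0<..T / 2}"
  shows "turns T (\<lambda>t. flow (c t) s - c t) = 1"
proof -
  have c2: "continuous_on ({0..1} \<times> {0..T}) (\<lambda>z. c (snd z))" 
    by (rule continuous_on_compose2[OF c(1)]) (auto intro!: continuous_intros)
  have ls: "l * s \<in> {0..T / 2}" if "l \<in> {0..1}" for l
  proof -
    have "l * s \<le> 1 * s" "0 \<le> l * s" "s \<le> T / 2" using that s by (intro mult_right_mono, auto)
    then show ?thesis unfolding atLeastAtMost_iff by linarith
  qed
  have sT: "s \<in> {0..T}" using s T_pos by auto
  have "turns T (\<lambda>t. quot (0 * s) (c t)) = turns T (\<lambda>t. quot (1 * s) (c t))"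
  proof (rule turns_homotopic[OF T_nonneg])
    have "continuous_on ({0..1} \<times> {0..T}) (\<lambda>z. (\<lambda>(l, \<xi>). quot l \<xi>) (fst z * s, c (snd z)))"
      by (rule continuous_on_compose2[OF quot_cont])
        (use ls T_pos in \<open>force intro!: continuous_intros c2\<close>)+
    then show "continuous_on ({0..1} \<times> {0..T}) (\<lambda>(l, t). quot (l * s) (c t))"
      by (simp add: split_def)
  qed (use ls nz c(2) in auto)
  moreover have "turns T (\<lambda>t. fh (c t)) = 1" by (rule turns_fh_near_cycle[OF pos c near])
  ultimately have 1: "turns T (\<lambda>t. quot s (c t)) = 1" by (simp add: quot_0)
  have "continuous_on {0..T} (\<lambda>t. (\<lambda>(l, \<xi>). quot l \<xi>) (s, c t))"
    by (rule continuous_on_compose2[OF quot_cont]) (use sT in \<open>auto intro!: continuous_intros c\<close>)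
  then have "turns T (\<lambda>t. s *\<^sub>R quot s (c t)) = turns T (\<lambda>t. quot s (c t))"
    by (intro turns_scale[OF T_nonneg]) (use s c nz in auto)
  then show ?thesis using 1 by (simp add: quot_eq[OF sT])
qed

text \<open>The loop is a curve parallel to the cycle if this carries no periodic point of period between
  \<open>T / 2\<close> and \<open>T\<close>. Otherwise the orbit of such a point is used.\<close>

lemma side_loop:
  assumes pos: "positively_oriented T x" and iso: "isolated_cycle T f x" and S: "side S"
    and \<delta>: "0 < \<delta>" "\<delta> \<le> foot_radius"
  obtains c \<theta> where "continuous_on {0..T} c" "c T = c 0" "\<And>t. t \<in> {0..T} \<Longrightarrow> c t \<in> S \<inter> tube \<delta>"
    "\<And>t. t \<in> {0..T} \<Longrightarrow> norm (c t - x (\<theta> + t)) \<le> foot_radius / 2"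
    "\<And>t. t \<in> {0..T} \<Longrightarrow> flow (c t) T \<noteq> c t"
    "turns T (\<lambda>t. flow (c t) T - c t) = 1"
proof -
  obtain m M where m: "0 < m" "\<And>t. m \<le> norm (f (x t))" and M: "0 < M" "\<And>t. norm (f (x t)) \<le> M"
    using speed_bounds by blast
  obtain dq where dq: "0 < dq" "\<And>l y. l \<in> {0..T / 2} \<Longrightarrow> y \<in> tube dq \<Longrightarrow> quot l y \<noteq> 0"
    using quot_nonzero by blast
  obtain di where di: "0 < di" "\<And>\<xi>. \<xi> \<in> tube di \<Longrightarrow> flow \<xi> T = \<xi> \<Longrightarrow> \<xi> \<in> range x"
    using isolated_flow[OF iso] by blast
  \<comment> \<open>In this order: nonzero quotients, no fixed points off the cycle, the tube asked
    for, the distance needed in \<open>turns_onto_cycle\<close>, and \<open>L * \<rho> < m\<close>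
    for \<open>turns_quot\<close>.\<close>
  define \<rho> where "\<rho> = Min {dq, di, \<delta>, foot_radius / 2, m / (2 * L)}"
  have \<rho>: "0 < \<rho>" "\<rho> \<le> dq" "\<rho> \<le> di" "\<rho> \<le> \<delta>" "\<rho> \<le> foot_radius / 2" "\<rho> \<le> m / (2 * L)"
    unfolding \<rho>_def using dq(1) di(1) \<delta>(1) foot_radius m(1) L_pos by (subst Min_gr_iff; simp) simp_all
  have "L * \<rho> \<le> L * (m / (2 * L))" using \<rho>(6) L_pos by (intro mult_left_mono) auto
  then have L\<rho>: "L * \<rho> < m" using m(1) L_pos by simp
  have SnT: "flow y T \<noteq> y" if "y \<in> S" "y \<in> tube \<rho>" for y
    using di(2)[of y] that tube_mono[OF \<rho>(3)] S by (auto simp: side_def)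
  \<comment> \<open>Stretching an orbit of period \<open>u > T - \<eta>\<close> to length
    \<open>T\<close> shifts its times by at most \<open>\<eta>\<close>, hence the accompanying
    points of the cycle by at most \<open>\<rho> / 2\<close>.\<close>
  define \<eta> where "\<eta> = \<rho> / (2 * M)"
  have \<eta>: "0 < \<eta>" "M * \<eta> = \<rho> / 2" using \<rho> M by (auto simp: \<eta>_def)
  obtain dp where dp: "0 < dp" "\<And>u y. u \<in> {T / 2..T - \<eta>} \<Longrightarrow> y \<in> tube dp \<Longrightarrow> flow y u \<noteq> y"
    using period_near_T[OF \<eta>(1)] by blast
  define E where "E = exp (L * T)"
  have E: "1 \<le> E" using L_pos T_pos by (simp add: E_def)
  \<comment> \<open>\<open>dp\<close> excludes periods in \<open>{T / 2..T - \<eta>}\<close>. The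
    factor \<open>E\<close> enlarges an initial distance \<open>d\<close> to at most
    \<open>\<rho> / 2\<close>, the other half of \<open>\<rho>\<close>.\<close>
  define d where "d = min dp (\<rho> / (2 * E))"
  have d: "0 < d" "d \<le> dp" "E * d \<le> \<rho> / 2"
    using dp \<rho> E by (auto simp: d_def min_def field_simps)
  have d\<rho>: "d \<le> \<rho>" using d(1,3) mult_right_mono[OF E, of d] \<rho>(1) by linarith
  obtain \<sigma> r0 where \<sigma>: "\<sigma> \<in> {-1, 1::real}" and r0: "0 < r0"
    and nc: "\<And>r t. r \<in> {0<..r0} \<Longrightarrow> normal_curve (\<sigma> * r) t \<in> S"
    using side_normal_curve[OF S] by blast
  define r where "r = min r0 (d / M)"
  have r: "r \<in> {0<..r0}" "r * M \<le> d" using r0 d M by (auto simp: r_def min_def field_simps)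
  let ?b = "normal_curve (\<sigma> * r)"
  have bS: "?b t \<in> S" for t using nc[OF r(1)] .
  have bx: "norm (?b t - x t) \<le> d" for t
  proof -
    have "norm (?b t - x t) \<le> r * M" unfolding norm_normal_curve
      using \<sigma> r M(2)[of t] by (intro mult_mono) auto
    then show ?thesis using r by simp
  qed
  have btube: "?b t \<in> tube d" for t using bx by (auto simp: tube_def)
  have bcont: "continuous_on A ?b" for A by (intro continuous_intros)
  have bT: "?b T = ?b 0" using normal_curve_periodic[of "\<sigma> * r" 0] by simp
  have tub: "tube d \<subseteq> tube \<rho>" "tube \<rho> \<subseteq> tube dq" "tube \<rho> \<subseteq> tube \<delta>" "tube d \<subseteq> tube dp"
    using tube_mono d\<rho> \<rho> d by blast+
  have closeL: "L * norm v < norm (f (x t))" if "norm v \<le> \<rho>" for v :: "real^2" and t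
  proof -
    have "L * norm v \<le> L * \<rho>" using that L_pos by (intro mult_left_mono) auto
    then show ?thesis using L\<rho> m(2)[of t] by linarith
  qed
  show ?thesis
  proof (cases "\<exists>u t. u \<in> {T / 2..T} \<and> flow (?b t) u = ?b t")
    case False
    have lT: "T / 2 + l * (T / 2) \<in> {T / 2..T}" if "l \<in> {0..1}" for l
    proof -
      have "l * (T / 2) \<le> 1 * (T / 2)" "0 \<le> l * (T / 2)" using that T_pos by (intro mult_right_mono, auto)
      then show ?thesis unfolding atLeastAtMost_iff by linarith
    qed
    \<comment> \<open>Without returns the time can grow from \<open>T / 2\<close> to
      \<open>T\<close>; at \<open>T / 2\<close> the count comes from
      \<open>turns_quot\<close>.\<close>
    have "turns T (\<lambda>t. flow (?b t) (T / 2 + 1 * (T / 2)) - ?b t) = turns T (\<lambda>t. flow (?b t) (T / 2 + 0 * (T / 2)) - ?b t)"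
    proof (rule turns_homotopic[OF T_nonneg, symmetric])
      show "continuous_on ({0..1} \<times> {0..T}) (\<lambda>(l, t). flow (?b t) (T / 2 + l * (T / 2)) - ?b t)"
        unfolding split_def by (intro continuous_intros bcont[of UNIV, THEN continuous_on_compose2]) (use lT T_pos in force)+
      show "flow (?b t) (T / 2 + l * (T / 2)) - ?b t \<noteq> 0" if "l \<in> {0..1}" for l t
        using False lT[OF that] by fastforce
    qed (use bT in auto)
    moreover have "turns T (\<lambda>t. flow (?b t) (T / 2) - ?b t) = 1"
    proof (rule turns_quot[OF pos bcont bT, of 0])
      show "L * norm (?b t - x (0 + t)) < norm (f (x (0 + t)))" for t
        using closeL[of "?b t - x t" t] bx[of t] d\<rho> by simp
      show "quot l (?b t) \<noteq> 0" if "l \<in> {0..T / 2}" for l t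
        using dq(2)[OF that] btube[of t] tub by blast
    qed (use T_pos in auto)
    ultimately have "turns T (\<lambda>t. flow (?b t) T - ?b t) = 1" by simp
    moreover have "flow (?b t) T \<noteq> ?b t" for t using SnT[OF bS] btube tub by blast
    moreover have "norm (?b t - x (0 + t)) \<le> foot_radius / 2" for t
      using bx[of t] d\<rho> \<rho>(5) by simp
    moreover have "?b t \<in> S \<inter> tube \<delta>" for t using bS btube tub by blast
    ultimately show ?thesis using that[of ?b 0, OF bcont bT] by blast
  next
    case True
    then obtain u \<theta> where u: "u \<in> {T / 2..T}" "flow (?b \<theta>) u = ?b \<theta>" by blast
    let ?\<xi> = "?b \<theta>"
    have "u \<noteq> T" using SnT[OF bS, of \<theta>] btube tub u by auto
    then have uT: "u < T" using u by simp
    have u\<eta>: "T - u < \<eta>"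
      using dp(2)[of u ?\<xi>] u btube[of \<theta>] tub by force
    have u0: "0 < u" using u T_pos by auto
    have sol: "solves_ode_on (\<lambda>t. fh) (flow ?\<xi>) {0..u}"
      unfolding solves_ode_on_def
    proof
      fix t assume "t \<in> {0..u}"
      then show "(flow ?\<xi> has_vector_derivative fh (flow ?\<xi> t)) (at t within {0..u})"
        using uT by (intro has_vector_derivative_within_subset[OF flow_deriv]) auto
    qed
    have close: "flow ?\<xi> u = flow ?\<xi> 0" using u flow(1) by simp
    obtain orb where orb: "periodic_solution u (\<lambda>t. fh) orb" "\<And>t. t \<in> {0..u} \<Longrightarrow> orb t = flow ?\<xi> t"
      using periodic_extension[of u "\<lambda>t. fh" "flow ?\<xi>", OF u0 refl sol close] by blast
    have oD: "(orb has_vector_derivative fh (orb t)) (at t within A)" for t A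
      using orb(1) by (auto simp: periodic_solution_def solves_ode_on_def intro: has_vector_derivative_at_within)
    have oP: "orb (t + u) = orb t" for t using orb(1) by (simp add: periodic_solution_def)
    have oF: "flow (orb t) s = orb (t + s)" if "s \<in> {0..T}" for s t
      by (rule flow_shift[OF _ that]) (rule oD)
    have o0: "orb 0 = ?\<xi>" using orb(2)[of 0] u0 flow(1) by simp
    have ocont: "continuous_on A orb" for A using oD by (rule continuous_on_vector_derivative)
    have oclose: "norm (orb t - x (\<theta> + t)) \<le> \<rho> / 2" if "t \<in> {0..u}" for t
    proof -
      have "norm (orb t - x (\<theta> + t)) \<le> E * norm (?\<xi> - x \<theta>)"
        using flow_lip[of t ?\<xi> "x \<theta>"] that uT by (simp add: orb(2) flow_x E_def)
      also have "\<dots> \<le> E * d" using bx[of \<theta>] E by (intro mult_left_mono) auto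
      finally show ?thesis using d by simp
    qed
    \<comment> \<open>If the orbit met the cycle, flowing on to the end of its period would bring
      its starting point onto the cycle.\<close>
    have oS: "orb t \<in> S" if t: "t \<in> {0..u}" for t
    proof -
      have "orb ` {0..u} \<subseteq> S"
      proof (rule side_connected[OF S _ _ _ bS[of \<theta>]])
        show "connected (orb ` {0..u})" by (intro connected_continuous_image ocont) auto
        show "?\<xi> \<in> orb ` {0..u}" using o0 u0 by (intro image_eqI[of _ _ 0]) auto
        show "orb ` {0..u} \<inter> range x = {}"
        proof (rule ccontr)
          assume "orb ` {0..u} \<inter> range x \<noteq> {}"
          then obtain t s where ts: "t \<in> {0..u}" "orb t = x s" by (force simp del: atLeastAtMost_iff)
          have "orb (t + (u - t)) = x (s + (u - t))"
            using oF[of "u - t" t] flow_x[of "u - t" s] ts uT by auto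
          then have "x (s + (u - t)) = ?\<xi>" using oP[of 0] o0 by simp
          then have "?\<xi> \<in> range x" by (metis rangeI)
          then show False using bS[of \<theta>] S by (auto simp: side_def)
        qed
      qed
      then show ?thesis using t by blast
    qed
    define c where "c t = orb (t * (u / T))" for t
    have tu: "t * (u / T) \<in> {0..u}" if "t \<in> {0..T}" for t
    proof -
      have "t * u \<le> T * u" using that u0 by (intro mult_right_mono) auto
      then have "t * (u / T) \<le> u" using T_pos by (simp add: field_simps)
      then show ?thesis using that u0 T_pos by auto
    qed
    have cc: "continuous_on {0..T} c"
      unfolding c_def by (rule continuous_on_compose2[OF ocont[of UNIV]]) (use T_pos in \<open>auto intro!: continuous_intros\<close>)
    have cT: "c T = c 0" using oP[of 0] T_pos by (simp add: c_def)
    have cclose: "norm (c t - x (\<theta> + t)) \<le> \<rho>" if t: "t \<in> {0..T}" for t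
    proof -
      have "t * (u / T) - t = - ((t / T) * (T - u))" using T_pos by (simp add: field_simps)
      moreover have "0 \<le> (t / T) * (T - u)" using t T_pos uT by auto
      ultimately have "\<bar>t * (u / T) - t\<bar> = (t / T) * (T - u)" by (simp only: abs_minus_cancel abs_of_nonneg)
      also have "\<dots> \<le> 1 * \<eta>" using t T_pos uT u\<eta> by (intro mult_mono) auto
      finally have "M * \<bar>(\<theta> + t * (u / T)) - (\<theta> + t)\<bar> \<le> M * \<eta>" using M by (intro mult_left_mono) auto
      then have "norm (x (\<theta> + t * (u / T)) - x (\<theta> + t)) \<le> \<rho> / 2"
        using x_lip[OF M(2), of "\<theta> + t * (u / T)" "\<theta> + t"] \<eta>(2) by linarith
      moreover have "norm (c t - x (\<theta> + t * (u / T))) \<le> \<rho> / 2" unfolding c_def by (rule oclose[OF tu[OF t]])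
      ultimately show ?thesis
        using norm_triangle_ineq[of "c t - x (\<theta> + t * (u / T))" "x (\<theta> + t * (u / T)) - x (\<theta> + t)"] by simp
    qed
    have ctube: "c t \<in> tube \<rho>" if "t \<in> {0..T}" for t using cclose[OF that] by (auto simp: tube_def)
    have cS: "c t \<in> S" if "t \<in> {0..T}" for t unfolding c_def by (rule oS[OF tu[OF that]])
    \<comment> \<open>Dropping one period \<open>u\<close> leaves a positive time of at most
      \<open>T / 2\<close>, the range of \<open>turns_quot\<close>.\<close>
    have flowc: "flow (c t) T = flow (c t) (T - u)" for t
    proof -
      have "flow (c t) T = orb (t * (u / T) + T)" unfolding c_def using T_pos by (intro oF) auto
      also have "\<dots> = orb (t * (u / T) + (T - u))" using oP[of "t * (u / T) + (T - u)"] by simp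
      also have "\<dots> = flow (c t) (T - u)" unfolding c_def using uT u0 by (intro oF[symmetric]) auto
      finally show ?thesis .
    qed
    have "turns T (\<lambda>t. flow (c t) (T - u) - c t) = 1"
    proof (rule turns_quot[OF pos cc cT, of \<theta>])
      show "L * norm (c t - x (\<theta> + t)) < norm (f (x (\<theta> + t)))" if "t \<in> {0..T}" for t
        by (rule closeL[OF cclose[OF that]])
      show "quot l (c t) \<noteq> 0" if "l \<in> {0..T / 2}" "t \<in> {0..T}" for l t
        using dq(2)[OF that(1)] ctube[OF that(2)] tub by blast
      show "T - u \<in> {0<..T / 2}" using u uT by auto
    qed
    then have "turns T (\<lambda>t. flow (c t) T - c t) = 1" by (simp add: flowc)
    moreover have "flow (c t) T \<noteq> c t" if "t \<in> {0..T}" for t using SnT[OF cS[OF that] ctube[OF that]] .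
    moreover have "norm (c t - x (\<theta> + t)) \<le> foot_radius / 2" if "t \<in> {0..T}" for t
      using cclose[OF that] \<rho>(5) by simp
    moreover have "c t \<in> S \<inter> tube \<delta>" if "t \<in> {0..T}" for t using cS[OF that] ctube[OF that] tub by blast
    ultimately show ?thesis using that[of c \<theta>, OF cc cT] by blast
  qed
qed

text \<open>On the loop of \<open>side_loop\<close> the unperturbed displacement has a positive
  minimum, so a nearby field turns once there; having no zero in the collar, it turns as often on
  the cycle. As \<open>\<kappa>\<close> is chosen before \<open>V\<close>, it serves for all
  \<epsilon> and all approximations of \<open>g\<close>.\<close>

lemma side_index:
  assumes pos: "positively_oriented T x" and iso: "isolated_cycle T f x" and S: "side S"
    and \<delta>: "0 < \<delta>" "\<delta> \<le> foot_radius"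
  obtains \<kappa> where "0 < \<kappa>"
    "\<And>V. continuous_on (tube \<delta> \<inter> (S \<union> range x)) V \<Longrightarrow>
      (\<And>y. y \<in> tube \<delta> \<inter> (S \<union> range x) \<Longrightarrow> V y \<noteq> 0 \<and> norm (V y - (flow y T - y)) \<le> \<kappa>) \<Longrightarrow>
      turns T (\<lambda>t. V (x t)) = 1"
proof -
  obtain c \<theta> where c: "continuous_on {0..T} c" "c T = c 0" "\<And>t. t \<in> {0..T} \<Longrightarrow> c t \<in> S \<inter> tube \<delta>"
    and near: "\<And>t. t \<in> {0..T} \<Longrightarrow> norm (c t - x (\<theta> + t)) \<le> foot_radius / 2"
    and nz: "\<And>t. t \<in> {0..T} \<Longrightarrow> flow (c t) T \<noteq> c t"
    and one: "turns T (\<lambda>t. flow (c t) T - c t) = 1"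
    using side_loop[OF assms] by blast
  have cont: "continuous_on {0..T} (\<lambda>t. flow (c t) T - c t)"
    by (intro continuous_intros c) (use T_pos in auto)
  obtain \<kappa> where \<kappa>: "0 < \<kappa>" "\<And>t. t \<in> {0..T} \<Longrightarrow> \<kappa> \<le> norm (flow (c t) T - c t)"
    by (rule compact_positive_lower_bound[OF compact_Icc continuous_on_norm[OF cont]]) (use nz in auto)
  show ?thesis
  proof (rule that[of "\<kappa> / 2"])
    show "0 < \<kappa> / 2" using \<kappa> by simp
    fix V assume V: "continuous_on (tube \<delta> \<inter> (S \<union> range x)) V"
      and V2: "\<And>y. y \<in> tube \<delta> \<inter> (S \<union> range x) \<Longrightarrow> V y \<noteq> 0 \<and> norm (V y - (flow y T - y)) \<le> \<kappa> / 2"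
    have cV: "continuous_on {0..T} (\<lambda>t. V (c t))"
      by (rule continuous_on_compose2[OF V c(1)]) (use c(3) in auto)
    have "turns T (\<lambda>t. flow (c t) T - c t) = turns T (\<lambda>t. V (c t))"
    proof (rule turns_near[OF T_nonneg cont _ cV])
      fix t assume t: "t \<in> {0..T}"
      have "norm (V (c t) - (flow (c t) T - c t)) \<le> \<kappa> / 2" using V2[of "c t"] c(3)[OF t] by blast
      then show "norm (flow (c t) T - c t - V (c t)) < norm (flow (c t) T - c t)"
        using \<kappa>(2)[OF t] \<kappa>(1) by (simp add: norm_minus_commute)
    qed (use c(2) in auto)
    moreover have "turns T (\<lambda>t. V (c t)) = turns T (\<lambda>t. V (x t))"
      by (rule turns_onto_cycle[OF S V _ \<delta> c near]) (use V2 in blast)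
    ultimately show "turns T (\<lambda>t. V (x t)) = 1" using one by simp
  qed
qed

end

subsection \<open>The adjoint system and the bifurcation functions\<close>

locale perturbed_cycle = planar_cycle +
  fixes g :: "real \<Rightarrow> real^2 \<Rightarrow> real^2" and zt zh :: "real \<Rightarrow> real^2"
  assumes g_cont: "continuous_on UNIV (\<lambda>(t, y). g t y)"
    and g_per: "\<And>t y. g (t + T) y = g t y"
    and zt: "adjoint_solution (\<lambda>t. f' (x t)) zt"
    and zt0: "zt 0 = perp (f (x 0))"
    and zh: "adjoint_solution (\<lambda>t. f' (x t)) zh"
    and zh0: "zh 0 = f (x 0) /\<^sub>R (norm (f (x 0)))\<^sup>2"
begin

section \<open>Solutions of the adjoint system\<close>

lemma adjoint_deriv:
  "adjoint_solution (\<lambda>t. f' (x t)) z \<Longrightarrow> (z has_vector_derivative - (z t v* f' (x t))) (at t within A)"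
  by (auto simp: adjoint_solution_def solves_ode_on_def intro: has_vector_derivative_at_within)

lemma adjointI:
  "(\<And>t. (z has_vector_derivative - (z t v* f' (x t))) (at t)) \<Longrightarrow> adjoint_solution (\<lambda>t. f' (x t)) z"
  by (simp add: adjoint_solution_def solves_ode_on_def)

lemma adjoint_cont: "adjoint_solution (\<lambda>t. f' (x t)) z \<Longrightarrow> continuous_on A z"
  using adjoint_deriv by (rule continuous_on_vector_derivative)

text \<open>The transpose inherits the bound of the Jacobian: pair \<open>w = z v* f' (x t)\<close>
  with itself and move the matrix to the other factor.\<close>

lemma norm_adjoint_le: "norm (z v* f' (x t)) \<le> L * norm z"
proof (cases "z v* f' (x t) = 0")
  case True then show ?thesis using L_pos by simp
next
  case False
  define w where "w = z v* f' (x t)"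
  have "norm w * norm w = w \<bullet> w" by (simp add: dot_square_norm power2_eq_square)
  also have "\<dots> = z \<bullet> (f' (x t) *v w)" unfolding w_def by (simp add: dot_lmul_matrix)
  also have "\<dots> \<le> norm z * norm (f' (x t) *v w)" by (rule norm_cauchy_schwarz)
  also have "\<dots> \<le> norm z * (L * norm w)" by (intro mult_left_mono f'_bound x_in_ball) auto
  finally have "norm w * norm w \<le> (L * norm z) * norm w" by (simp add: algebra_simps)
  then show ?thesis using False by (simp add: w_def)
qed

text \<open>Gronwall forward in time, and backward for the reversed function \<open>w\<close>.
  Applied to linear combinations of solutions, this extends relations at time 0 to all
  times.\<close>

lemma adjoint_zero:
  assumes z: "adjoint_solution (\<lambda>t. f' (x t)) z" and 0: "z a = 0"
  shows "z t = 0"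
proof (cases "a \<le> t")
  case True
  have "norm (z t) \<le> (norm (z a) + 0 * (t - a)) * exp (L * (t - a))"
    by (rule norm_gronwall[OF True, of L 0 z "\<lambda>t. - (z t v* f' (x t))"])
      (use True L_pos norm_adjoint_le adjoint_deriv[OF z] in auto)
  then show ?thesis using 0 by simp
next
  case False
  define w where "w s = z (- s)" for s
  have wd: "(w has_vector_derivative z (- s) v* f' (x (- s))) (at s within A)" for s A
  proof -
    have "((\<lambda>s. - s :: real) has_vector_derivative - 1) (at s within A)" by (auto intro!: derivative_eq_intros)
    then have "(z \<circ> (\<lambda>s. - s) has_vector_derivative (- 1) *\<^sub>R - (z (- s) v* f' (x (- s)))) (at s within A)"
      by (rule vector_diff_chain_within) (rule adjoint_deriv[OF z])
    moreover have "w = z \<circ> (\<lambda>s. - s)" by (simp add: w_def fun_eq_iff)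
    ultimately show ?thesis by simp
  qed
  have "norm (w (- t)) \<le> (norm (w (- a)) + 0 * (- t - - a)) * exp (L * (- t - - a))"
    by (rule norm_gronwall[of "- a" "- t" L 0 w "\<lambda>s. z (- s) v* f' (x (- s))"])
      (use False L_pos norm_adjoint_le wd in \<open>auto simp: w_def\<close>)
  then show ?thesis using 0 by (simp add: w_def)
qed

lemma adjoint_lincomb:
  assumes "adjoint_solution (\<lambda>t. f' (x t)) y" "adjoint_solution (\<lambda>t. f' (x t)) z"
  shows "adjoint_solution (\<lambda>t. f' (x t)) (\<lambda>t. y t - c *\<^sub>R z t)"
proof (rule adjointI)
  fix t
  have "((\<lambda>t. y t - c *\<^sub>R z t) has_vector_derivative
      (- (y t v* f' (x t)) - c *\<^sub>R - (z t v* f' (x t)))) (at t)"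
    by (intro has_vector_derivative_diff bounded_linear.has_vector_derivative[OF bounded_linear_scaleR_right] adjoint_deriv assms)
  moreover have "- (y t v* f' (x t)) - c *\<^sub>R - (z t v* f' (x t)) = - ((y t - c *\<^sub>R z t) v* f' (x t))"
    by (simp add: vec_eq_iff vector_matrix_mult_def algebra_simps sum_subtractf sum_distrib_left)
  ultimately show "((\<lambda>t. y t - c *\<^sub>R z t) has_vector_derivative - ((y t - c *\<^sub>R z t) v* f' (x t))) (at t)" by simp
qed

lemma adjoint_shift:
  assumes "adjoint_solution (\<lambda>t. f' (x t)) z"
  shows "adjoint_solution (\<lambda>t. f' (x t)) (\<lambda>t. z (t + T))"
proof (rule adjointI)
  fix t
  have "((\<lambda>t. t + T) has_vector_derivative 1) (at t)" by (auto intro!: derivative_eq_intros)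
  then have "(z \<circ> (\<lambda>t. t + T) has_vector_derivative 1 *\<^sub>R - (z (t + T) v* f' (x (t + T)))) (at t)"
    by (rule vector_diff_chain_within) (rule adjoint_deriv[OF assms])
  then show "((\<lambda>t. z (t + T)) has_vector_derivative - (z (t + T) v* f' (x t))) (at t)"
    by (simp add: o_def x_periodic)
qed

text \<open>The velocity \<open>f (x t)\<close> solves the linearised system, whose solutions have
  constant pairings with those of the adjoint system.\<close>

lemma adjoint_inner_const:
  assumes z: "adjoint_solution (\<lambda>t. f' (x t)) z"
  shows "z t \<bullet> f (x t) = z 0 \<bullet> f (x 0)"
proof -
  have "((\<lambda>t. z t \<bullet> f (x t)) has_real_derivative 0) (at s)" for s
  proof -
    have "((\<lambda>t. z t \<bullet> f (x t)) has_vector_derivative 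
        z s \<bullet> (f' (x s) *v f (x s)) + (- (z s v* f' (x s))) \<bullet> f (x s)) (at s)"
      by (rule bounded_bilinear.has_vector_derivative[OF bounded_bilinear_inner adjoint_deriv[OF z] fx_deriv])
    moreover have "z s \<bullet> (f' (x s) *v f (x s)) + (- (z s v* f' (x s))) \<bullet> f (x s) = 0"
      by (simp add: dot_lmul_matrix)
    ultimately show ?thesis by (simp only: has_real_derivative_iff_has_vector_derivative)
  qed
  then show ?thesis using DERIV_isconst_all[of "\<lambda>t. z t \<bullet> f (x t)" t 0] by blast
qed

lemma zt_inner: "zt t \<bullet> f (x t) = 0" and zh_inner: "zh t \<bullet> f (x t) = 1"
  using adjoint_inner_const[OF zt, of t] adjoint_inner_const[OF zh, of t] f_x_nonzero[of 0]
  by (simp_all add: zt0 zh0 dot_square_norm)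

lemma zt_perp: obtains a where "zt t = a *\<^sub>R perp (f (x t))"
  using planar_orthogonal[OF zt_inner f_x_nonzero] by blast

definition \<alpha> :: "real \<Rightarrow> real" where "\<alpha> t = zt t \<bullet> perp (f (x t))"

text \<open>\<open>zt\<close> is a multiple of the normal and never zero, so \<open>\<alpha>\<close>
  has no zero and keeps the sign it has at 0. This is the positivity that
  \<open>poincare_index_triangular\<close> asks of the change of frame.\<close>

lemma \<alpha>_pos: "0 < \<alpha> t"
proof -
  have nz: "zt s \<noteq> 0" for s
    using adjoint_zero[OF zt, of s 0] f_x_nonzero[of 0] by (auto simp: zt0)
  have anz: "\<alpha> s \<noteq> 0" for s
  proof -
    obtain a where a: "zt s = a *\<^sub>R perp (f (x s))" using zt_perp by blast
    then show ?thesis using nz[of s] by (simp add: \<alpha>_def)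
  qed
  have cont: "continuous_on A \<alpha>" for A
    unfolding \<alpha>_def by (intro continuous_intros adjoint_cont[OF zt])
  have 0: "0 < \<alpha> 0" using f_x_nonzero[of 0] by (simp add: \<alpha>_def zt0)
  show ?thesis
  proof (rule ccontr)
    assume "\<not> 0 < \<alpha> t"
    have "connected (range \<alpha>)" by (intro connected_continuous_image cont) auto
    then have "0 \<in> range \<alpha>"
      using connectedD_interval[of "range \<alpha>" "\<alpha> t" "\<alpha> 0" 0] 0 \<open>\<not> 0 < \<alpha> t\<close> by auto
    then show False using anz by auto
  qed
qed

text \<open>The Floquet multiplier of the adjoint system and the Jordan entry that couples \<open>zh\<close> to \<open>zt\<close>.\<close>

lemma floquet:
  obtains c a where "c \<noteq> 0" "\<And>t. zt (t + T) = c *\<^sub>R zt t" "\<And>t. zh (t + T) = zh t + a *\<^sub>R zt t"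
proof -
  have xT: "x T = x 0" using x_periodic[of 0] by simp
  obtain c where c: "zt T = c *\<^sub>R perp (f (x 0))" using zt_perp[of T] xT by metis
  have c0: "zt (0 + T) - c *\<^sub>R zt 0 = 0" using c by (simp add: zt0)
  have 1: "zt (t + T) = c *\<^sub>R zt t" for t
    using adjoint_zero[OF adjoint_lincomb[OF adjoint_shift[OF zt] zt], where a = 0 and t = t] c0 by simp
  have "c \<noteq> 0" using \<alpha>_pos[of T] c xT by (auto simp: \<alpha>_def)
  have "(zh T - zh 0) \<bullet> f (x 0) = 0" using zh_inner[of T] zh_inner[of 0] xT by (simp add: inner_diff_left)
  then obtain a where a: "zh T - zh 0 = a *\<^sub>R zt 0"
    using planar_orthogonal[OF _ f_x_nonzero] zt0 by metis
  have a0: "(zh (0 + T) - 1 *\<^sub>R zh 0) - a *\<^sub>R zt 0 = 0" using a by simp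
  have "zh (t + T) = zh t + a *\<^sub>R zt t" for t
    using adjoint_zero[OF adjoint_lincomb[OF adjoint_lincomb[OF adjoint_shift[OF zh] zh, of 1] zt, of a], where a = 0 and t = t] a0
    by (simp add: algebra_simps)
  with 1 \<open>c \<noteq> 0\<close> show ?thesis using that by blast
qed

section \<open>The bifurcation integrals as functions of window and phase\<close>

lemma g_cont_compose [continuous_intros]:
  assumes "continuous_on S p" "continuous_on S q"
  shows "continuous_on S (\<lambda>z. g (p z) (q z))"
proof -
  have "continuous_on S (\<lambda>z. (\<lambda>(t, y). g t y) (p z, q z))"
    by (rule continuous_on_compose2[OF g_cont]) (auto intro!: continuous_intros assms)
  then show ?thesis by simp
qed

text \<open>Window and phase are independent here: \<open>s\<close> is the time at which a solution
  leaves the cycle, \<open>\<theta>\<close> the delay of the forcing. In \<open>bif_fun\<close> the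
  window is tied to the phase.\<close>

definition bif :: "(real \<Rightarrow> real^2) \<Rightarrow> real \<Rightarrow> real \<Rightarrow> real" where
  "bif z s \<theta> = integral {s..s + T} (\<lambda>\<tau>. z \<tau> \<bullet> g (\<tau> - \<theta>) (x \<tau>))"

lemma bif_fun_eq: "bif_fun T g x z s \<theta> = bif z (s - T + \<theta>) \<theta>"
  by (simp add: bif_def bif_fun_def)

lemma integral_shift_Icc: "integral {a + c..b + c} h = integral {a..b} (\<lambda>t. h (t + c))" for h :: "real \<Rightarrow> real" and a b c :: real
  using integral_shift_cbox_plus[of a b h c] by (simp add: add.commute o_def)

lemma bif_shift: "bif z (s + T) \<theta> = integral {s..s + T} (\<lambda>\<tau>. z (\<tau> + T) \<bullet> g (\<tau> - \<theta>) (x \<tau>))"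
proof -
  have "bif z (s + T) \<theta> = integral {s..s + T} (\<lambda>\<tau>. z (\<tau> + T) \<bullet> g (\<tau> + T - \<theta>) (x (\<tau> + T)))"
    unfolding bif_def by (rule integral_shift_Icc)
  moreover have "g (\<tau> + T - \<theta>) = g (\<tau> - \<theta>)" for \<tau>
    using g_per[of "\<tau> - \<theta>"] by (simp add: fun_eq_iff algebra_simps)
  ultimately show ?thesis by (simp add: x_periodic)
qed

lemma bif_int: "continuous_on UNIV z \<Longrightarrow> (\<lambda>\<tau>. z \<tau> \<bullet> g (\<tau> - \<theta>) (x \<tau>)) integrable_on {a..b}"
  by (intro integrable_continuous_real continuous_intros) (auto intro: continuous_on_subset)

text \<open>The integrands inherit the Floquet relations of \<open>zt\<close> and \<open>zh\<close>.
  For \<open>c \<noteq> 0\<close> the two integrals vanish together on one window if and only if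
  they do on the next.\<close>

lemma bif_floquet:
  assumes "\<And>t. zt (t + T) = c *\<^sub>R zt t" "\<And>t. zh (t + T) = zh t + a *\<^sub>R zt t"
  shows "bif zt (s + T) \<theta> = c * bif zt s \<theta>" "bif zh (s + T) \<theta> = bif zh s \<theta> + a * bif zt s \<theta>"
proof -
  show "bif zt (s + T) \<theta> = c * bif zt s \<theta>"
    by (simp add: bif_shift assms) (simp add: bif_def)
  have "bif zh (s + T) \<theta> = integral {s..s + T} (\<lambda>\<tau>. zh \<tau> \<bullet> g (\<tau> - \<theta>) (x \<tau>) + a * (zt \<tau> \<bullet> g (\<tau> - \<theta>) (x \<tau>)))"
    by (simp add: bif_shift assms inner_add_left)
  also have "\<dots> = bif zh s \<theta> + a * bif zt s \<theta>"
    by (subst Henstock_Kurzweil_Integration.integral_add)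
      (auto simp: bif_def intro!: bif_int adjoint_cont zt zh integrable_on_mult_right)
  finally show "bif zh (s + T) \<theta> = bif zh s \<theta> + a * bif zt s \<theta>" .
qed

lemma bif_period: "bif z s (\<theta> + T) = bif z s \<theta>"
proof -
  have "g (\<tau> - (\<theta> + T)) = g (\<tau> - \<theta>)" for \<tau>
    using g_per[of "\<tau> - (\<theta> + T)"] by (simp add: fun_eq_iff algebra_simps)
  then show ?thesis by (simp add: bif_def)
qed

text \<open>Substitution moves the window to \<open>{0..T}\<close>, so that the parameters enter the
  integrand only.\<close>

lemma bif_cont:
  assumes z: "continuous_on UNIV z"
  shows "continuous_on UNIV (\<lambda>(s, \<theta>). bif z s \<theta>)"
proof -
  have "bif z s \<theta> = integral (cbox 0 T) (\<lambda>u. z (u + s) \<bullet> g (u + s - \<theta>) (x (u + s)))" for s \<theta>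
    unfolding bif_def using integral_shift_Icc[of 0 s T "\<lambda>\<tau>. z \<tau> \<bullet> g (\<tau> - \<theta>) (x \<tau>)"] by (simp add: add.commute)
  moreover have "continuous_on (UNIV \<times> cbox 0 T) (\<lambda>(p, u). z (u + fst p) \<bullet> g (u + fst p - snd p) (x (u + fst p)))"
    unfolding split_def by (intro continuous_intros continuous_on_compose2[OF z]) auto
  from integral_continuous_on_param[OF this]
  have "continuous_on UNIV (\<lambda>p. integral (cbox 0 T) (\<lambda>u. z (u + fst p) \<bullet> g (u + fst p - snd p) (x (u + fst p))))" .
  ultimately show ?thesis by (simp add: split_def)
qed

section \<open>First-order expansion along the cycle\<close>

lemma g_bounded:
  obtains B where "0 \<le> B" "\<And>t y. y \<in> cball 0 R \<Longrightarrow> norm (g t y) \<le> B"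
proof -
  have "compact ((\<lambda>(t, y). g t y) ` ({0..T} \<times> cball 0 R))"
    by (intro compact_continuous_image compact_Times continuous_on_subset[OF g_cont]) auto
  then have "bounded ((\<lambda>(t, y). g t y) ` ({0..T} \<times> cball 0 R))" by (rule compact_imp_bounded)
  then obtain B where "\<forall>p\<in>{0..T} \<times> cball 0 R. norm (case p of (t, y) \<Rightarrow> g t y) \<le> B"
    unfolding bounded_iff by blast
  then have B: "norm (g t y) \<le> B" if "t \<in> {0..T}" "y \<in> cball 0 R" for t y
    using that by (metis SigmaI case_prod_conv)
  have "norm (g t y) \<le> B" if "y \<in> cball 0 R" for t y
  proof -
    obtain k where k: "t - of_int k * T \<in> {0..<T}" using mod_period by blast
    have "g t = g (t - of_int k * T)" using periodic_int[of g T "t - of_int k * T" k] g_per by (simp add: fun_eq_iff)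
    then show ?thesis using B[OF _ that, of "t - of_int k * T"] k by auto
  qed
  moreover have "0 \<le> B" using order_trans[OF norm_ge_zero B[OF _ x_in_ball[of 0], of 0]] T_pos by simp
  ultimately show ?thesis using that by blast
qed

lemma g_unif_cont:
  assumes "0 < \<omega>"
  obtains d where "0 < d" "\<And>t y y'. y \<in> cball 0 R \<Longrightarrow> y' \<in> cball 0 R \<Longrightarrow> norm (y - y') < d \<Longrightarrow> norm (g t y - g t y') < \<omega>"
proof -
  have "uniformly_continuous_on ({0..T} \<times> cball 0 R) (\<lambda>(t, y). g t y)"
    by (intro compact_uniformly_continuous compact_Times continuous_on_subset[OF g_cont]) auto
  then obtain d where d: "0 < d" "\<And>p q. p \<in> {0..T} \<times> cball 0 R \<Longrightarrow> q \<in> {0..T} \<times> cball 0 R \<Longrightarrow> dist q p < d \<Longrightarrow>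
      dist ((\<lambda>(t, y). g t y) q) ((\<lambda>(t, y). g t y) p) < \<omega>"
    using assms unfolding uniformly_continuous_on_def by metis
  have "norm (g t y - g t y') < \<omega>" if y: "y \<in> cball 0 R" "y' \<in> cball 0 R" "norm (y - y') < d" for t y y'
  proof -
    obtain k where k: "t - of_int k * T \<in> {0..<T}" using mod_period by blast
    have "g t = g (t - of_int k * T)" using periodic_int[of g T "t - of_int k * T" k] g_per by (simp add: fun_eq_iff)
    moreover have "dist (t - of_int k * T, y) (t - of_int k * T, y') < d" using y by (simp add: dist_Pair_Pair dist_norm)
    ultimately show ?thesis
      using d(2)[of "(t - of_int k * T, y')" "(t - of_int k * T, y)"] k y by (auto simp: dist_norm)
  qed
  then show ?thesis using that d by blast
qed

lemma f_unif_diff: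
  assumes \<omega>: "0 < \<omega>"
  obtains d where "0 < d" "\<And>y t. y \<in> cball 0 R \<Longrightarrow> norm (y - x t) \<le> d \<Longrightarrow>
    norm (f y - f (x t) - f' (x t) *v (y - x t)) \<le> \<omega> * norm (y - x t)"
proof -
  have "uniformly_continuous_on (cball 0 R) f'"
    by (intro compact_uniformly_continuous continuous_on_subset[OF f'_cont]) auto
  then obtain d where d: "0 < d" "\<And>p q. p \<in> cball 0 R \<Longrightarrow> q \<in> cball 0 R \<Longrightarrow> dist q p < d \<Longrightarrow> dist (f' q) (f' p) < \<omega> / 2"
    using \<omega> unfolding uniformly_continuous_on_def by (metis half_gt_zero)
  show ?thesis
  proof (rule that[of "d / 2"])
    fix y t assume y: "y \<in> cball 0 R" "norm (y - x t) \<le> d / 2"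
    let ?S = "closed_segment (x t) y"
    have S: "p \<in> cball 0 R" "dist p (x t) < d" if "p \<in> ?S" for p
    proof -
      show "p \<in> cball 0 R" using closed_segment_subset[OF x_in_ball y(1) convex_cball] that by blast
      have "norm (p - x t) \<le> norm (y - x t)" using segment_bound(1)[OF that] .
      then show "dist p (x t) < d" using y(2) d(1) by (simp add: dist_norm)
    qed
    \<comment> \<open>The mean value inequality is applied to \<open>f\<close> minus its linear part
      at \<open>x t\<close>; \<open>\<omega> / 2\<close> makes up for the factor 2 in
      \<open>norm_matrix_vector_le\<close>.\<close>
    have "norm ((f y - f' (x t) *v y) - (f (x t) - f' (x t) *v x t)) \<le> \<omega> * norm (y - x t)"
    proof (rule differentiable_bound[of ?S "\<lambda>p. f p - f' (x t) *v p" "\<lambda>p h. f' p *v h - f' (x t) *v h"])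
      fix p assume p: "p \<in> ?S"
      show "((\<lambda>p. f p - f' (x t) *v p) has_derivative (\<lambda>h. f' p *v h - f' (x t) *v h)) (at p within ?S)"
        by (intro has_derivative_diff has_derivative_at_withinI[OF f_deriv] bounded_linear.has_derivative[OF matrix_vector_mul_bounded_linear] has_derivative_ident)
      show "onorm (\<lambda>h. f' p *v h - f' (x t) *v h) \<le> \<omega>"
      proof (rule onorm_bound)
        fix h
        have "norm (f' p *v h - f' (x t) *v h) \<le> 2 * norm (f' p - f' (x t)) * norm h"
          using norm_matrix_vector_le[of "f' p - f' (x t)" h] by (simp add: matrix_vector_mult_diff_rdistrib)
        also have "\<dots> \<le> \<omega> * norm h"
          using d(2)[OF x_in_ball S(1)[OF p], of t] S(2)[OF p] by (intro mult_right_mono) (auto simp: dist_norm)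
        finally show "norm (f' p *v h - f' (x t) *v h) \<le> \<omega> * norm h" .
      qed (use \<omega> in auto)
    qed auto
    then show "norm (f y - f (x t) - f' (x t) *v (y - x t)) \<le> \<omega> * norm (y - x t)"
      by (simp add: matrix_vector_mult_diff_distrib algebra_simps)
  qed (use d in auto)
qed

text \<open>The perturbation \<open>h\<close> is only required to be close to \<open>g\<close>, so that approximations of \<open>g\<close> are covered.\<close>

definition expands :: "(real \<Rightarrow> real^2) \<Rightarrow> real \<Rightarrow> real \<Rightarrow> real \<Rightarrow> bool" where
  "expands z \<eta> \<delta> \<epsilon>0 \<longleftrightarrow> (\<forall>\<epsilon> s \<theta> y h. \<epsilon> \<in> {0<..<\<epsilon>0} \<longrightarrow> s \<in> {0..T} \<longrightarrow> y s = x s \<longrightarrow>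
    (\<forall>\<tau>\<in>{s..s + T}. (y has_vector_derivative f (y \<tau>) + \<epsilon> *\<^sub>R h \<tau>) (at \<tau> within {s..s + T}) \<and>
      (norm (y \<tau> - x \<tau>) \<le> 1 \<longrightarrow> norm (h \<tau> - g (\<tau> - \<theta>) (y \<tau>)) \<le> \<delta>)) \<longrightarrow>
    \<bar>z (s + T) \<bullet> (y (s + T) - x s) - \<epsilon> * bif z s \<theta>\<bar> \<le> \<epsilon> * \<eta>)"

text \<open>In the derivative of \<open>z \<bullet> (y - x)\<close> the adjoint equation cancels the
  part linear in \<open>y - x\<close>. Besides the integrand of \<open>bif\<close> there remain the
  Taylor remainder of \<open>f\<close>, the error of \<open>h\<close> against \<open>g\<close> along
  \<open>y\<close>, and the error of replacing \<open>y\<close> by \<open>x\<close> inside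
  \<open>g\<close>.\<close>

lemma expansion:
  assumes z: "adjoint_solution (\<lambda>t. f' (x t)) z" and \<eta>: "0 < \<eta>"
  obtains \<delta> \<epsilon>0 where "0 < \<delta>" "0 < \<epsilon>0" "expands z \<eta> \<delta> \<epsilon>0"
proof -
  obtain B where B: "0 \<le> B" "\<And>t y. y \<in> cball 0 R \<Longrightarrow> norm (g t y) \<le> B" using g_bounded by blast
  \<comment> \<open>\<open>B + 1\<close> bounds \<open>h\<close>, because
    \<open>\<delta> \<le> 1\<close>; Gronwall over one period then yields
    \<open>norm (y \<tau> - x \<tau>) \<le> \<epsilon> * C\<close>.\<close>
  define C where "C = (B + 1) * T * exp (L * T)"
  have C: "0 < C" using B T_pos by (simp add: C_def)
  \<comment> \<open>Both \<open>s\<close> and the length of the window are at most \<open>T\<close>,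
    so times up to \<open>2 * T\<close> occur.\<close>
  have "compact (z ` {0..2 * T})" by (intro compact_continuous_image adjoint_cont[OF z]) auto
  then have "bounded (z ` {0..2 * T})" by (rule compact_imp_bounded)
  then obtain Z where "\<forall>p\<in>z ` {0..2 * T}. norm p \<le> Z" unfolding bounded_iff by blast
  then have Z: "norm (z t) \<le> Z" if "t \<in> {0..2 * T}" for t using that by blast
  have Z0: "0 \<le> Z" using order_trans[OF norm_ge_zero Z[of 0]] T_pos by simp
  \<comment> \<open>Three errors of size \<open>Z * (\<epsilon> * \<omega>)\<close> over the time
    \<open>T\<close> are to add up to at most \<open>\<epsilon> * \<eta>\<close>;
    \<open>Z + 1\<close> keeps \<open>D\<close> positive.\<close>
  define D where "D = T * (Z + 1)"
  have D: "0 < D" using T_pos Z0 by (simp add: D_def)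
  define \<omega> where "\<omega> = \<eta> / (3 * D)"
  have \<omega>: "0 < \<omega>" "D * \<omega> = \<eta> / 3" using \<eta> D by (auto simp: \<omega>_def)
  obtain d1 where d1: "0 < d1" "\<And>y t. y \<in> cball 0 R \<Longrightarrow> norm (y - x t) \<le> d1 \<Longrightarrow>
    norm (f y - f (x t) - f' (x t) *v (y - x t)) \<le> \<omega> / C * norm (y - x t)"
    using f_unif_diff[of "\<omega> / C"] \<omega> C by auto
  obtain d2 where d2: "0 < d2" "\<And>t y y'. y \<in> cball 0 R \<Longrightarrow> y' \<in> cball 0 R \<Longrightarrow> norm (y - y') < d2 \<Longrightarrow> norm (g t y - g t y') < \<omega>"
    using g_unif_cont[OF \<omega>(1)] by blast
  \<comment> \<open>Keeps \<open>\<epsilon> * C\<close> below 1 for the bootstrap, and below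
    \<open>d1\<close> and \<open>d2\<close>.\<close>
  define \<epsilon>0 where "\<epsilon>0 = Min {1, d1, d2} / C"
  define \<delta> where "\<delta> = min 1 \<omega>"
  show ?thesis
  proof (rule that)
    show "0 < \<delta>" "0 < \<epsilon>0" using \<omega> d1 d2 C by (auto simp: \<delta>_def \<epsilon>0_def)
    show "expands z \<eta> \<delta> \<epsilon>0"
      unfolding expands_def
    proof (intro allI impI)
      fix \<epsilon> s \<theta> y h
      assume \<epsilon>: "\<epsilon> \<in> {0<..<\<epsilon>0}" and s: "s \<in> {0..T}" and ys: "y s = x s"
        and sol: "\<forall>\<tau>\<in>{s..s + T}. (y has_vector_derivative f (y \<tau>) + \<epsilon> *\<^sub>R h \<tau>) (at \<tau> within {s..s + T}) \<and>
      (norm (y \<tau> - x \<tau>) \<le> 1 \<longrightarrow> norm (h \<tau> - g (\<tau> - \<theta>) (y \<tau>)) \<le> \<delta>)"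
      have \<epsilon>C: "0 < \<epsilon>" "\<epsilon> * C < 1" "\<epsilon> * C < d1" "\<epsilon> * C < d2"
        using \<epsilon> C by (auto simp: \<epsilon>0_def pos_less_divide_eq)
      have close: "norm (y \<tau> - x \<tau>) \<le> \<epsilon> * C" if \<tau>: "\<tau> \<in> {s..s + T}" for \<tau>
      proof -
        have "norm (y \<tau> - x (\<tau> + 0)) \<le> (norm (y s - x (s + 0)) + (\<epsilon> * (B + 1)) * T) * exp (L * T)"
        proof (rule tube_bootstrap[of s "s + T" y "\<lambda>\<tau>. f (y \<tau>) + \<epsilon> *\<^sub>R h \<tau>" 0 "\<epsilon> * (B + 1)" \<tau>])
          show "norm (f (y r) + \<epsilon> *\<^sub>R h r - f (y r)) \<le> \<epsilon> * (B + 1)" if r: "r \<in> {s..s + T}" "norm (y r - x (r + 0)) \<le> 1" for r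
          proof -
            have "norm (h r - g (r - \<theta>) (y r)) \<le> 1" using sol r by (auto simp: \<delta>_def)
            moreover have "norm (g (r - \<theta>) (y r)) \<le> B" using B(2) near_in_ball[of "y r" r] r by auto
            ultimately have "norm (h r) \<le> B + 1" using norm_triangle_ineq2[of "h r" "g (r - \<theta>) (y r)"] by linarith
            then show ?thesis using \<epsilon>C by simp
          qed
          show "(norm (y s - x (s + 0)) + \<epsilon> * (B + 1) * T) * exp (L * T) < 1"
            using \<epsilon>C ys by (simp add: C_def mult.assoc)
        qed (use sol T_pos \<epsilon>C B \<tau> in auto)
        then show ?thesis using ys by (simp add: C_def mult.assoc)
      qed
      have ball: "y \<tau> \<in> cball 0 R" if "\<tau> \<in> {s..s + T}" for \<tau>
        using close[OF that] \<epsilon>C near_in_ball[of "y \<tau>" \<tau>] by auto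
      define K where "K \<tau> = z \<tau> \<bullet> (y \<tau> - x \<tau>) - \<epsilon> * integral {s..\<tau>} (\<lambda>\<tau>. z \<tau> \<bullet> g (\<tau> - \<theta>) (x \<tau>))" for \<tau>
      define K' where "K' \<tau> = z \<tau> \<bullet> (f (y \<tau>) - f (x \<tau>) - f' (x \<tau>) *v (y \<tau> - x \<tau>)) + \<epsilon> * (z \<tau> \<bullet> (h \<tau> - g (\<tau> - \<theta>) (x \<tau>)))" for \<tau>
      have KD: "(K has_vector_derivative K' \<tau>) (at \<tau> within {s..s + T})" if \<tau>: "\<tau> \<in> {s..s + T}" for \<tau>
      proof -
        have 1: "((\<lambda>\<tau>. z \<tau> \<bullet> (y \<tau> - x \<tau>)) has_vector_derivative
            z \<tau> \<bullet> (f (y \<tau>) + \<epsilon> *\<^sub>R h \<tau> - f (x \<tau>)) + (- (z \<tau> v* f' (x \<tau>))) \<bullet> (y \<tau> - x \<tau>)) (at \<tau> within {s..s + T})"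
          by (rule bounded_bilinear.has_vector_derivative[OF bounded_bilinear_inner adjoint_deriv[OF z]])
            (intro has_vector_derivative_diff x_deriv_within, use sol \<tau> in blast)
        have 2: "((\<lambda>\<tau>. integral {s..\<tau>} (\<lambda>\<tau>. z \<tau> \<bullet> g (\<tau> - \<theta>) (x \<tau>))) has_vector_derivative z \<tau> \<bullet> g (\<tau> - \<theta>) (x \<tau>)) (at \<tau> within {s..s + T})"
          by (rule integral_has_vector_derivative[OF _ \<tau>]) (intro continuous_intros adjoint_cont[OF z])
        have "(K has_vector_derivative
            (z \<tau> \<bullet> (f (y \<tau>) + \<epsilon> *\<^sub>R h \<tau> - f (x \<tau>)) + (- (z \<tau> v* f' (x \<tau>))) \<bullet> (y \<tau> - x \<tau>)) - \<epsilon> * (z \<tau> \<bullet> g (\<tau> - \<theta>) (x \<tau>))) (at \<tau> within {s..s + T})"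
          unfolding K_def
          by (intro has_vector_derivative_diff 1 bounded_linear.has_vector_derivative[OF bounded_linear_mult_right 2])
        moreover have "(z \<tau> \<bullet> (f (y \<tau>) + \<epsilon> *\<^sub>R h \<tau> - f (x \<tau>)) + (- (z \<tau> v* f' (x \<tau>))) \<bullet> (y \<tau> - x \<tau>)) - \<epsilon> * (z \<tau> \<bullet> g (\<tau> - \<theta>) (x \<tau>)) = K' \<tau>"
          unfolding K'_def inner_minus_left dot_lmul_matrix
          by (simp add: inner_add_right inner_diff_right right_diff_distrib)
        ultimately show ?thesis by simp
      qed
      have K'b: "norm (K' \<tau>) \<le> Z * (3 * (\<epsilon> * \<omega>))" if \<tau>: "\<tau> \<in> {s..s + T}" for \<tau>
      proof -
        have zZ: "norm (z \<tau>) \<le> Z" using Z \<tau> s by auto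
        have "norm (f (y \<tau>) - f (x \<tau>) - f' (x \<tau>) *v (y \<tau> - x \<tau>)) \<le> \<omega> / C * norm (y \<tau> - x \<tau>)"
          using d1(2)[OF ball[OF \<tau>]] close[OF \<tau>] \<epsilon>C by auto
        also have "\<dots> \<le> \<omega> / C * (\<epsilon> * C)" using close[OF \<tau>] \<omega> C by (intro mult_left_mono) auto
        also have "\<dots> = \<epsilon> * \<omega>" using C by simp
        finally have 1: "norm (f (y \<tau>) - f (x \<tau>) - f' (x \<tau>) *v (y \<tau> - x \<tau>)) \<le> \<epsilon> * \<omega>" .
        have "norm (h \<tau> - g (\<tau> - \<theta>) (y \<tau>)) \<le> \<omega>"
          using sol \<tau> close[OF \<tau>] \<epsilon>C by (force simp: \<delta>_def)
        moreover have "norm (g (\<tau> - \<theta>) (y \<tau>) - g (\<tau> - \<theta>) (x \<tau>)) < \<omega>"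
          using d2(2)[OF ball[OF \<tau>] x_in_ball] close[OF \<tau>] \<epsilon>C by auto
        ultimately have 2: "norm (h \<tau> - g (\<tau> - \<theta>) (x \<tau>)) \<le> 2 * \<omega>"
          using norm_triangle_ineq[of "h \<tau> - g (\<tau> - \<theta>) (y \<tau>)" "g (\<tau> - \<theta>) (y \<tau>) - g (\<tau> - \<theta>) (x \<tau>)"] by simp
        have "norm (K' \<tau>) \<le> \<bar>z \<tau> \<bullet> (f (y \<tau>) - f (x \<tau>) - f' (x \<tau>) *v (y \<tau> - x \<tau>))\<bar> + \<epsilon> * \<bar>z \<tau> \<bullet> (h \<tau> - g (\<tau> - \<theta>) (x \<tau>))\<bar>"
          using \<epsilon>C abs_triangle_ineq[of "z \<tau> \<bullet> (f (y \<tau>) - f (x \<tau>) - f' (x \<tau>) *v (y \<tau> - x \<tau>))" "\<epsilon> * (z \<tau> \<bullet> (h \<tau> - g (\<tau> - \<theta>) (x \<tau>)))"]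
          by (simp add: K'_def abs_mult)
        also have "\<dots> \<le> Z * (\<epsilon> * \<omega>) + \<epsilon> * (Z * (2 * \<omega>))"
          using 1 2 zZ Z0 \<epsilon>C
          by (intro add_mono mult_left_mono order_trans[OF Cauchy_Schwarz_ineq2] mult_mono) auto
        finally show ?thesis by (simp add: algebra_simps)
      qed
      have "norm (K (s + T) - K s) \<le> (Z * (3 * (\<epsilon> * \<omega>))) * norm (s + T - s)"
      proof (rule differentiable_bound[of "{s..s + T}" K "\<lambda>\<tau> r. r *\<^sub>R K' \<tau>"])
        show "(K has_derivative (\<lambda>r. r *\<^sub>R K' \<tau>)) (at \<tau> within {s..s + T})" if "\<tau> \<in> {s..s + T}" for \<tau>
          using KD[OF that] by (simp add: has_vector_derivative_def)
        show "onorm (\<lambda>r. r *\<^sub>R K' \<tau>) \<le> Z * (3 * (\<epsilon> * \<omega>))" if "\<tau> \<in> {s..s + T}" for \<tau>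
        proof (rule onorm_bound)
          show "norm (r *\<^sub>R K' \<tau>) \<le> Z * (3 * (\<epsilon> * \<omega>)) * norm r" for r
            using mult_right_mono[OF K'b[OF that], of "\<bar>r\<bar>"] by (simp add: abs_mult mult.commute)
        qed (use Z0 \<epsilon>C \<omega> in auto)
      qed (use T_pos in auto)
      also have "\<dots> = \<epsilon> * (3 * ((T * Z) * \<omega>))" using T_pos by (simp add: algebra_simps)
      also have "\<dots> \<le> \<epsilon> * (3 * (D * \<omega>))"
        using \<epsilon>C \<omega> T_pos by (intro mult_left_mono mult_right_mono) (auto simp: D_def)
      also have "\<dots> = \<epsilon> * \<eta>" using \<omega> by simp
      finally have "\<bar>K (s + T) - K s\<bar> \<le> \<epsilon> * \<eta>" by simp
      moreover have "K s = 0" using ys by (simp add: K_def)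
      moreover have "K (s + T) = z (s + T) \<bullet> (y (s + T) - x s) - \<epsilon> * bif z s \<theta>"
        by (simp add: K_def bif_def x_periodic)
      ultimately show "\<bar>z (s + T) \<bullet> (y (s + T) - x s) - \<epsilon> * bif z s \<theta>\<bar> \<le> \<epsilon> * \<eta>" by simp
    qed
  qed
qed

lemma expands_mono:
  assumes ex: "expands z \<eta> \<delta> \<epsilon>0" and le: "\<delta>' \<le> \<delta>" "\<epsilon>0' \<le> \<epsilon>0"
  shows "expands z \<eta> \<delta>' \<epsilon>0'"
  unfolding expands_def
proof (intro allI impI)
  fix \<epsilon> s \<theta> y h
  assume \<epsilon>: "\<epsilon> \<in> {0<..<\<epsilon>0'}" and s: "s \<in> {0..T}" and ys: "y s = x s"
    and sol: "\<forall>\<tau>\<in>{s..s + T}. (y has_vector_derivative f (y \<tau>) + \<epsilon> *\<^sub>R h \<tau>) (at \<tau> within {s..s + T}) \<and>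
      (norm (y \<tau> - x \<tau>) \<le> 1 \<longrightarrow> norm (h \<tau> - g (\<tau> - \<theta>) (y \<tau>)) \<le> \<delta>')"
  have "\<epsilon> \<in> {0<..<\<epsilon>0}" using \<epsilon> le by auto
  moreover have "\<forall>\<tau>\<in>{s..s + T}. (y has_vector_derivative f (y \<tau>) + \<epsilon> *\<^sub>R h \<tau>) (at \<tau> within {s..s + T}) \<and>
      (norm (y \<tau> - x \<tau>) \<le> 1 \<longrightarrow> norm (h \<tau> - g (\<tau> - \<theta>) (y \<tau>)) \<le> \<delta>)"
    using sol order_trans[OF _ le(1)] by blast
  ultimately show "\<bar>z (s + T) \<bullet> (y (s + T) - x s) - \<epsilon> * bif z s \<theta>\<bar> \<le> \<epsilon> * \<eta>"
    using ex[unfolded expands_def] s ys by blast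
qed

end

subsection \<open>Periodic solutions on either side\<close>

lemma real_polynomial_function_lipschitz:
  assumes "real_polynomial_function p" "bounded S"
  shows "\<exists>B C. 0 \<le> B \<and> 0 \<le> C \<and> (\<forall>a\<in>S. \<bar>p a\<bar> \<le> B) \<and> (\<forall>a\<in>S. \<forall>b\<in>S. \<bar>p a - p b\<bar> \<le> C * norm (a - b))"
  using assms(1)
proof (induction p rule: real_polynomial_function.induct)
  case (linear q)
  obtain K where K: "0 < K" "\<And>a. \<bar>q a\<bar> \<le> norm a * K"
    using bounded_linear.pos_bounded[OF linear] by auto
  obtain B where B: "0 < B" "\<And>a. a \<in> S \<Longrightarrow> norm a \<le> B" using assms(2) bounded_pos by metis
  have "\<bar>q a\<bar> \<le> B * K" if "a \<in> S" for a
    using K(2)[of a] mult_right_mono[OF B(2)[OF that], of K] K(1) by linarith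
  moreover have "\<bar>q a - q b\<bar> \<le> K * norm (a - b)" for a b
    using K(2)[of "a - b"] by (simp add: linear_diff[OF bounded_linear.linear[OF linear]] mult.commute)
  ultimately show ?case using K B by (intro exI[of _ "B * K"] exI[of _ K]) auto
next
  case (const c)
  then show ?case by (intro exI[of _ "\<bar>c\<bar>"] exI[of _ 0]) auto
next
  case (add p q)
  then obtain B C B' C' where 1: "0 \<le> B" "0 \<le> C" "\<forall>a\<in>S. \<bar>p a\<bar> \<le> B" "\<forall>a\<in>S. \<forall>b\<in>S. \<bar>p a - p b\<bar> \<le> C * norm (a - b)"
    and 2: "0 \<le> B'" "0 \<le> C'" "\<forall>a\<in>S. \<bar>q a\<bar> \<le> B'" "\<forall>a\<in>S. \<forall>b\<in>S. \<bar>q a - q b\<bar> \<le> C' * norm (a - b)" by blast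
  have "\<bar>p a + q a\<bar> \<le> B + B'" if "a \<in> S" for a
    using 1(3) 2(3) that abs_triangle_ineq[of "p a" "q a"] by fastforce
  moreover have "\<bar>(p a + q a) - (p b + q b)\<bar> \<le> (C + C') * norm (a - b)" if "a \<in> S" "b \<in> S" for a b
  proof -
    have "\<bar>p a - p b\<bar> \<le> C * norm (a - b)" "\<bar>q a - q b\<bar> \<le> C' * norm (a - b)" using 1 2 that by auto
    then show ?thesis unfolding distrib_right by linarith
  qed
  ultimately show ?case using 1 2 by (intro exI[of _ "B + B'"] exI[of _ "C + C'"]) auto
next
  \<comment> \<open>Here the bounds on the values, carried along in the induction, enter the
    Lipschitz constant.\<close>
  case (mult p q)
  then obtain B C B' C' where 1: "0 \<le> B" "0 \<le> C" "\<forall>a\<in>S. \<bar>p a\<bar> \<le> B" "\<forall>a\<in>S. \<forall>b\<in>S. \<bar>p a - p b\<bar> \<le> C * norm (a - b)"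
    and 2: "0 \<le> B'" "0 \<le> C'" "\<forall>a\<in>S. \<bar>q a\<bar> \<le> B'" "\<forall>a\<in>S. \<forall>b\<in>S. \<bar>q a - q b\<bar> \<le> C' * norm (a - b)" by blast
  have "\<bar>p a * q a\<bar> \<le> B * B'" if "a \<in> S" for a
    unfolding abs_mult using 1 2 that by (intro mult_mono) auto
  moreover have "\<bar>p a * q a - p b * q b\<bar> \<le> (B * C' + C * B') * norm (a - b)" if "a \<in> S" "b \<in> S" for a b
  proof -
    have "\<bar>p a * (q a - q b)\<bar> \<le> B * (C' * norm (a - b))"
      unfolding abs_mult using 1 2 that by (intro mult_mono) auto
    moreover have "\<bar>(p a - p b) * q b\<bar> \<le> (C * norm (a - b)) * B'"
      unfolding abs_mult using 1 2 that by (intro mult_mono) auto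
    moreover have "p a * q a - p b * q b = p a * (q a - q b) + (p a - p b) * q b" by (simp add: algebra_simps)
    ultimately show ?thesis
      using abs_triangle_ineq[of "p a * (q a - q b)" "(p a - p b) * q b"] by (simp add: algebra_simps)
  qed
  ultimately show ?case using 1 2 by (intro exI[of _ "B * B'"] exI[of _ "B * C' + C * B'"]) auto
qed

lemma polynomial_function_lipschitz:
  fixes p :: "'a::real_normed_vector \<Rightarrow> real^2"
  assumes "polynomial_function p" "bounded S"
  obtains C where "0 \<le> C" "\<And>a b. a \<in> S \<Longrightarrow> b \<in> S \<Longrightarrow> norm (p a - p b) \<le> C * norm (a - b)"
proof -
  have "\<exists>C\<ge>0. \<forall>a\<in>S. \<forall>b\<in>S. \<bar>vec_nth (p a) i - vec_nth (p b) i\<bar> \<le> C * norm (a - b)" for i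
  proof -
    have "real_polynomial_function ((\<lambda>v. vec_nth v i) \<circ> p)"
      using assms(1) bounded_linear_vec_nth unfolding polynomial_function_def by blast
    then have "real_polynomial_function (\<lambda>a. vec_nth (p a) i)" by (simp add: o_def)
    from real_polynomial_function_lipschitz[OF this assms(2)] show ?thesis by blast
  qed
  then obtain C where C: "\<And>i. 0 \<le> C i" "\<And>i a b. a \<in> S \<Longrightarrow> b \<in> S \<Longrightarrow> \<bar>vec_nth (p a) i - vec_nth (p b) i\<bar> \<le> C i * norm (a - b)"
    by metis
  have "norm (p a - p b) \<le> (C 1 + C 2) * norm (a - b)" if "a \<in> S" "b \<in> S" for a b
    using norm_le_l1_cart[of "p a - p b"] C(2)[OF that, of 1] C(2)[OF that, of 2] by (simp add: sum_2 distrib_right)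
  then show ?thesis using that C(1) by (metis add_nonneg_nonneg)
qed

text \<open>Solutions with error \<open>d\<close> exist below a threshold for \<epsilon> that
  depends on \<open>d\<close>. For each \<epsilon> an error just above the infimum of the attainable
  ones is taken; the infimum tends to 0, and the summand \<open>\<epsilon>\<close> in
  \<open>D\<close> ensures that something below \<open>D \<epsilon>\<close> is attained.\<close>

lemma shrinking_selection:
  fixes Q :: "real \<Rightarrow> real \<Rightarrow> 'a \<Rightarrow> bool"
  assumes mono: "\<And>\<epsilon> d d' X. Q \<epsilon> d X \<Longrightarrow> d \<le> d' \<Longrightarrow> Q \<epsilon> d' X"
    and ex: "\<And>d. 0 < d \<Longrightarrow> \<exists>e>0. \<forall>\<epsilon>\<in>{0<..<e}. \<exists>X. Q \<epsilon> d X"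
  obtains e F D where "0 < e" "\<And>\<epsilon>. \<epsilon> \<in> {0<..<e} \<Longrightarrow> Q \<epsilon> (D \<epsilon>) (F \<epsilon>)" "(D \<longlongrightarrow> (0::real)) (at_right 0)"
proof -
  define A where "A \<epsilon> = {d. 0 < d \<and> (\<exists>X. Q \<epsilon> d X)}" for \<epsilon>
  define D where "D \<epsilon> = Inf (A \<epsilon>) + \<epsilon>" for \<epsilon>
  obtain e where e: "0 < e" "\<forall>\<epsilon>\<in>{0<..<e}. \<exists>X. Q \<epsilon> 1 X" using ex[of 1] by auto
  have bdd: "bdd_below (A \<epsilon>)" for \<epsilon> by (rule bdd_belowI[of _ 0]) (auto simp: A_def)
  have "\<exists>X. Q \<epsilon> (D \<epsilon>) X" if "\<epsilon> \<in> {0<..<e}" for \<epsilon>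
  proof -
    have "1 \<in> A \<epsilon>" using e that by (auto simp: A_def)
    then have "A \<epsilon> \<noteq> {}" by blast
    moreover have "Inf (A \<epsilon>) < D \<epsilon>" using that by (simp add: D_def)
    ultimately obtain d where d: "d \<in> A \<epsilon>" "d < D \<epsilon>" using cInf_lessD by blast
    then show ?thesis using mono[of \<epsilon> d _ "D \<epsilon>"] by (auto simp: A_def)
  qed
  then obtain F where F: "\<And>\<epsilon>. \<epsilon> \<in> {0<..<e} \<Longrightarrow> Q \<epsilon> (D \<epsilon>) (F \<epsilon>)" by metis
  have "(D \<longlongrightarrow> 0) (at_right 0)"
  proof (rule tendstoI)
    fix d :: real assume d: "0 < d"
    obtain e' where e': "0 < e'" "\<forall>\<epsilon>\<in>{0<..<e'}. \<exists>X. Q \<epsilon> (d / 2) X" using ex[of "d / 2"] d by auto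
    have "dist (D \<epsilon>) 0 < d" if \<epsilon>: "0 < \<epsilon>" "\<epsilon> < min e' (d / 2)" for \<epsilon>
    proof -
      have "d / 2 \<in> A \<epsilon>" using e' \<epsilon> d by (auto simp: A_def)
      then have "Inf (A \<epsilon>) \<le> d / 2" by (rule cInf_lower[OF _ bdd])
      moreover have "0 \<le> Inf (A \<epsilon>)"
      proof (rule cInf_greatest)
        show "A \<epsilon> \<noteq> {}" using \<open>d / 2 \<in> A \<epsilon>\<close> by blast
      qed (simp add: A_def)
      ultimately show ?thesis using \<epsilon> by (simp add: D_def dist_real_def)
    qed
    then show "\<forall>\<^sub>F \<epsilon> in at_right 0. dist (D \<epsilon>) 0 < d"
      unfolding eventually_at_right_field using e' d by (intro exI[of _ "min e' (d / 2)"]) auto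
  qed
  then show ?thesis using that e(1) F by blast
qed

locale nondegenerate_cycle = perturbed_cycle +
  assumes nondegenerate: "\<And>s \<theta>. s \<in> {0..T} \<Longrightarrow> \<theta> \<in> {0..T} \<Longrightarrow>
    bif_fun T g x zt s \<theta> = 0 \<Longrightarrow> bif_fun T g x zh s \<theta> \<noteq> 0"
begin

text \<open>Condition (A) covers the windows that start between \<open>\<theta> - T\<close> and
  \<open>\<theta>\<close>. For \<open>s > \<theta>\<close> the start \<open>s - T\<close> is among
  them, and the Floquet relations lead back to \<open>s\<close>.\<close>

lemma bif_nonzero:
  assumes s: "s \<in> {0..T}" and \<theta>: "\<theta> \<in> {0..T}"
  shows "bif zt s \<theta> \<noteq> 0 \<or> bif zh s \<theta> \<noteq> 0"
proof (cases "s \<le> \<theta>")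
  case True
  then show ?thesis using nondegenerate[of "s + T - \<theta>" \<theta>] s \<theta> by (auto simp: bif_fun_eq)
next
  case False
  obtain c a where ca: "c \<noteq> 0" "\<And>t. zt (t + T) = c *\<^sub>R zt t" "\<And>t. zh (t + T) = zh t + a *\<^sub>R zt t"
    using floquet by blast
  show ?thesis
    using nondegenerate[of "s - \<theta>" \<theta>] bif_floquet[OF ca(2,3), of "s - T" \<theta>] ca(1) s \<theta> False
    by (auto simp: bif_fun_eq algebra_simps)
qed

text \<open>Compactness gives \<open>\<mu>\<close>. The accuracy \<open>\<mu> / 3\<close> is chosen
  because two integrals of at most this size cannot add up to \<open>\<mu>\<close>.\<close>

lemma uniform_expansion:
  obtains \<mu> \<delta> \<epsilon>0 where "0 < \<mu>" "0 < \<delta>" "0 < \<epsilon>0" "expands zt (\<mu> / 3) \<delta> \<epsilon>0" "expands zh (\<mu> / 3) \<delta> \<epsilon>0"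
    "\<And>s \<theta>. s \<in> {0..T} \<Longrightarrow> \<theta> \<in> {0..T} \<Longrightarrow> \<mu> \<le> \<bar>bif zt s \<theta>\<bar> + \<bar>bif zh s \<theta>\<bar>"
proof -
  obtain \<mu> where \<mu>: "0 < \<mu>" "\<And>p. p \<in> {0..T} \<times> {0..T} \<Longrightarrow> \<mu> \<le> \<bar>bif zt (fst p) (snd p)\<bar> + \<bar>bif zh (fst p) (snd p)\<bar>"
  proof (rule compact_positive_lower_bound[of "{0..T} \<times> {0..T}"])
    have c: "continuous_on ({0..T} \<times> {0..T}) (\<lambda>p. bif z (fst p) (snd p))" if "continuous_on UNIV z" for z
      using continuous_on_subset[OF bif_cont[OF that]] by (auto simp: split_def)
    show "continuous_on ({0..T} \<times> {0..T}) (\<lambda>p. \<bar>bif zt (fst p) (snd p)\<bar> + \<bar>bif zh (fst p) (snd p)\<bar>)"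
      by (intro continuous_intros c adjoint_cont zt zh)
    show "0 < \<bar>bif zt (fst p) (snd p)\<bar> + \<bar>bif zh (fst p) (snd p)\<bar>" if "p \<in> {0..T} \<times> {0..T}" for p
      using bif_nonzero[of "fst p" "snd p"] that by auto
  qed (auto intro: compact_Times)
  obtain \<delta>1 \<epsilon>1 where 1: "0 < \<delta>1" "0 < \<epsilon>1" "expands zt (\<mu> / 3) \<delta>1 \<epsilon>1"
    using expansion[OF zt, of "\<mu> / 3"] \<mu>(1) by auto
  obtain \<delta>2 \<epsilon>2 where 2: "0 < \<delta>2" "0 < \<epsilon>2" "expands zh (\<mu> / 3) \<delta>2 \<epsilon>2"
    using expansion[OF zh, of "\<mu> / 3"] \<mu>(1) by auto
  show ?thesis
  proof (rule that[of \<mu> "min \<delta>1 \<delta>2" "min \<epsilon>1 \<epsilon>2"])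
    show "expands zt (\<mu> / 3) (min \<delta>1 \<delta>2) (min \<epsilon>1 \<epsilon>2)" using 1(3) by (rule expands_mono) auto
    show "expands zh (\<mu> / 3) (min \<delta>1 \<delta>2) (min \<epsilon>1 \<epsilon>2)" using 2(3) by (rule expands_mono) auto
  qed (use \<mu> 1 2 in force)+
qed

text \<open>A periodic solution that meets the cycle has zero displacement after \<open>T\<close>,
  so both expansions bound their integrals by \<open>\<mu> / 3\<close>.\<close>

lemma periodic_solutions_avoid_cycle:
  obtains \<epsilon>0 where "0 < \<epsilon>0" "\<And>\<epsilon> X t s. \<epsilon> \<in> {0<..<\<epsilon>0} \<Longrightarrow>
    periodic_solution T (\<lambda>t y. f y + \<epsilon> *\<^sub>R g t y) X \<Longrightarrow> X t \<noteq> x s"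
proof -
  obtain \<mu> \<delta> \<epsilon>0 where \<mu>: "0 < \<mu>" and \<delta>: "0 < \<delta>" and \<epsilon>0: "0 < \<epsilon>0"
    and et: "expands zt (\<mu> / 3) \<delta> \<epsilon>0" and eh: "expands zh (\<mu> / 3) \<delta> \<epsilon>0"
    and low: "\<And>s \<theta>. s \<in> {0..T} \<Longrightarrow> \<theta> \<in> {0..T} \<Longrightarrow> \<mu> \<le> \<bar>bif zt s \<theta>\<bar> + \<bar>bif zh s \<theta>\<bar>"
    using uniform_expansion by blast
  show ?thesis
  proof (rule that[OF \<epsilon>0])
    fix \<epsilon> X t s
    assume \<epsilon>: "\<epsilon> \<in> {0<..<\<epsilon>0}" and X: "periodic_solution T (\<lambda>t y. f y + \<epsilon> *\<^sub>R g t y) X"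
    have Xper: "X (t + T) = X t" for t using X by (simp add: periodic_solution_def)
    show "X t \<noteq> x s"
    proof
      assume eq: "X t = x s"
      obtain k where k: "s - of_int k * T \<in> {0..<T}" using mod_period by blast
      define s' where "s' = s - of_int k * T"
      obtain j where j: "(s' - t) - of_int j * T \<in> {0..<T}" using mod_period by blast
      \<comment> \<open>Delayed by \<open>\<theta>\<close>, the solution meets the cycle at the time
        \<open>s'\<close> that belongs to the point, and the forcing is delayed as in
        \<open>expands\<close>.\<close>
      define \<theta> where "\<theta> = (s' - t) - of_int j * T"
      define y where "y \<tau> = X (\<tau> - \<theta>)" for \<tau>
      have s': "s' \<in> {0..T}" and \<theta>: "\<theta> \<in> {0..T}" using k j by (auto simp: s'_def \<theta>_def)
      have ys: "y s' = x s'"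
      proof -
        have "y s' = X (t + of_int j * T)" by (simp add: y_def \<theta>_def)
        also have "\<dots> = X t" by (rule periodic_int[of X, OF Xper])
        finally show ?thesis using eq x_periodic_int[of s' k] by (simp add: s'_def)
      qed
      have yT: "y (s' + T) = x s'" using Xper[of "s' - \<theta>"] ys by (simp add: y_def algebra_simps)
      have yd: "(y has_vector_derivative f (y \<tau>) + \<epsilon> *\<^sub>R g (\<tau> - \<theta>) (y \<tau>)) (at \<tau> within A)" for \<tau> A
      proof -
        have "((\<lambda>\<tau>. \<tau> - \<theta>) has_vector_derivative 1) (at \<tau> within A)" by (auto intro!: derivative_eq_intros)
        moreover have "(X has_vector_derivative f (X (\<tau> - \<theta>)) + \<epsilon> *\<^sub>R g (\<tau> - \<theta>) (X (\<tau> - \<theta>))) (at (\<tau> - \<theta>) within B)" for B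
          using X by (auto simp: periodic_solution_def solves_ode_on_def intro: has_vector_derivative_at_within)
        ultimately have "(X \<circ> (\<lambda>\<tau>. \<tau> - \<theta>) has_vector_derivative 1 *\<^sub>R (f (X (\<tau> - \<theta>)) + \<epsilon> *\<^sub>R g (\<tau> - \<theta>) (X (\<tau> - \<theta>)))) (at \<tau> within A)"
          by (rule vector_diff_chain_within)
        moreover have "X \<circ> (\<lambda>\<tau>. \<tau> - \<theta>) = y" by (simp add: y_def fun_eq_iff)
        ultimately show ?thesis by (simp add: y_def)
      qed
      have sol: "\<forall>\<tau>\<in>{s'..s' + T}. (y has_vector_derivative f (y \<tau>) + \<epsilon> *\<^sub>R g (\<tau> - \<theta>) (y \<tau>)) (at \<tau> within {s'..s' + T}) \<and>
          (norm (y \<tau> - x \<tau>) \<le> 1 \<longrightarrow> norm (g (\<tau> - \<theta>) (y \<tau>) - g (\<tau> - \<theta>) (y \<tau>)) \<le> \<delta>)"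
        using yd \<delta> by auto
      have "\<epsilon> * \<bar>bif z s' \<theta>\<bar> \<le> \<epsilon> * (\<mu> / 3)" if "expands z (\<mu> / 3) \<delta> \<epsilon>0" for z
        using that[unfolded expands_def, rule_format, of \<epsilon> s' y, OF \<epsilon> s' ys sol[rule_format]] yT \<epsilon>
        by (simp add: abs_mult)
      then have "\<bar>bif zt s' \<theta>\<bar> \<le> \<mu> / 3" "\<bar>bif zh s' \<theta>\<bar> \<le> \<mu> / 3" using et eh \<epsilon> by auto
      then show False using low[OF s' \<theta>] \<mu> by linarith
    qed
  qed
qed

text \<open>The limit, as \<open>\<epsilon> \<rightarrow> 0\<close>, of the displacement after one period divided by \<open>\<epsilon>\<close>, in the frame of the
  tangent and its normal. Up to a triangular change of the frame it is the field \<open>\<Phi>\<close>.\<close>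

definition normal_part :: "real \<Rightarrow> real" where
  "normal_part \<theta> = bif_fun T g x zt 0 \<theta> / \<alpha> \<theta>"

definition tangent_part :: "real \<Rightarrow> real" where
  "tangent_part \<theta> = bif_fun T g x zh 0 \<theta> - (zh \<theta> \<bullet> perp (f (x \<theta>))) * normal_part \<theta>"

definition displacement :: "real \<Rightarrow> real^2" where
  "displacement \<theta> = tangent_part \<theta> *\<^sub>R f (x \<theta>) + normal_part \<theta> *\<^sub>R perp (f (x \<theta>))"

text \<open>The coordinates solve a triangular system: \<open>zt\<close> annihilates the tangent and
  pairs with the normal to \<open>\<alpha>\<close>, while \<open>zh\<close> pairs with the tangent
  to 1.\<close>

lemma displacement_inner:
  "zt \<theta> \<bullet> displacement \<theta> = bif_fun T g x zt 0 \<theta>" "zh \<theta> \<bullet> displacement \<theta> = bif_fun T g x zh 0 \<theta>"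
  using \<alpha>_pos[of \<theta>]
  by (simp_all add: displacement_def inner_add_right zt_inner zh_inner tangent_part_def normal_part_def flip: \<alpha>_def)

text \<open>The expansion uses the window after \<open>\<theta>\<close>, the field \<Phi> the one
  before it. The vectors in the pairings and the integrals change by the same Floquet
  relations.\<close>

lemma displacement_inner_shift:
  "zt (\<theta> + T) \<bullet> displacement \<theta> = bif zt \<theta> \<theta>" "zh (\<theta> + T) \<bullet> displacement \<theta> = bif zh \<theta> \<theta>"
proof -
  obtain c a where ca: "c \<noteq> 0" "\<And>t. zt (t + T) = c *\<^sub>R zt t" "\<And>t. zh (t + T) = zh t + a *\<^sub>R zt t"
    using floquet by blast
  show "zt (\<theta> + T) \<bullet> displacement \<theta> = bif zt \<theta> \<theta>" "zh (\<theta> + T) \<bullet> displacement \<theta> = bif zh \<theta> \<theta>"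
    using bif_floquet[OF ca(2,3), of "\<theta> - T" \<theta>]
    by (simp_all add: ca inner_add_left displacement_inner bif_fun_eq)
qed

lemma bif_fun_cont: "adjoint_solution (\<lambda>t. f' (x t)) z \<Longrightarrow> continuous_on A (bif_fun T g x z 0)"
proof -
  assume z: "adjoint_solution (\<lambda>t. f' (x t)) z"
  have "continuous_on A (\<lambda>\<theta>. (\<lambda>(s, \<theta>). bif z s \<theta>) (0 - T + \<theta>, \<theta>))"
    by (rule continuous_on_compose2[OF bif_cont[OF adjoint_cont[OF z]]]) (auto intro!: continuous_intros)
  then show ?thesis by (simp add: bif_fun_eq fun_eq_iff)
qed

lemma parts_cont: "continuous_on A normal_part" "continuous_on A tangent_part"
proof -
  have "\<alpha> t \<noteq> 0" for t using \<alpha>_pos[of t] by simp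
  then show n: "continuous_on A normal_part"
    unfolding normal_part_def \<alpha>_def
    by (intro continuous_intros bif_fun_cont[OF zt] adjoint_cont[OF zt]) (simp flip: \<alpha>_def)
  show "continuous_on A tangent_part"
    unfolding tangent_part_def by (intro continuous_intros bif_fun_cont[OF zh] adjoint_cont[OF zh] n)
qed

lemma displacement_cont: "continuous_on A displacement"
  unfolding displacement_def by (intro continuous_intros parts_cont)

lemma displacement_nonzero:
  assumes "\<theta> \<in> {0..T}" shows "displacement \<theta> \<noteq> 0"
  using displacement_inner[of \<theta>] nondegenerate[of 0 \<theta>] assms T_pos by force

text \<open>Over a period \<open>c\<close> and \<open>a\<close> change the integrals, and in the
  same way \<open>\<alpha>\<close> and the pairing of \<open>zh\<close> with the normal; the changes
  cancel. So \<open>displacement\<close> closes up although \<open>Phi_field\<close> need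
  not.\<close>

lemma parts_periodic: "normal_part T = normal_part 0" "tangent_part T = tangent_part 0"
proof -
  obtain c a where ca: "c \<noteq> 0" "\<And>t. zt (t + T) = c *\<^sub>R zt t" "\<And>t. zh (t + T) = zh t + a *\<^sub>R zt t"
    using floquet by blast
  have xT: "x T = x 0" using x_periodic[of 0] by simp
  have t: "bif_fun T g x zt 0 T = c * bif_fun T g x zt 0 0"
    and h: "bif_fun T g x zh 0 T = bif_fun T g x zh 0 0 + a * bif_fun T g x zt 0 0"
    using bif_floquet[OF ca(2,3), of "- T" 0] bif_period[of _ _ 0] by (simp_all add: bif_fun_eq)
  have \<alpha>T: "\<alpha> T = c * \<alpha> 0" using ca(2)[of 0] xT by (simp add: \<alpha>_def)
  show n: "normal_part T = normal_part 0"
    using ca(1) by (simp add: normal_part_def t \<alpha>T)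
  have \<beta>: "zh T \<bullet> perp (f (x T)) = zh 0 \<bullet> perp (f (x 0)) + a * \<alpha> 0"
    using ca(3)[of 0] xT by (simp add: \<alpha>_def inner_add_left)
  have "\<alpha> 0 * normal_part 0 = bif_fun T g x zt 0 0" using \<alpha>_pos[of 0] by (simp add: normal_part_def)
  then show "tangent_part T = tangent_part 0"
    by (simp add: tangent_part_def n h \<beta> algebra_simps)
qed

lemma displacement_periodic: "displacement T = displacement 0"
  using parts_periodic x_periodic[of 0] by (simp add: displacement_def)

lemma turns_displacement: "turns T displacement = of_int (poincare_index T (Phi_field T g x zt zh))"
proof (rule poincare_index_triangular[where e = "\<lambda>t. f (x t)" and a = tangent_part and b = normal_part
      and \<alpha> = \<alpha> and \<beta> = "\<lambda>t. zh t \<bullet> perp (f (x t))"])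
  have xd: "vector_derivative x (at t) = f (x t)" for t
    using x_deriv by (rule vector_derivative_at)
  show V: "Phi_field T g x zt zh t = (tangent_part t + zh t \<bullet> perp (f (x t)) * normal_part t) *\<^sub>R f (x t) +
      (\<alpha> t * normal_part t) *\<^sub>R perp (f (x t))" for t
    using \<alpha>_pos[of t] by (simp add: Phi_field_def xd tangent_part_def normal_part_def)
  show "continuous_on {0..T} (Phi_field T g x zt zh)"
    unfolding Phi_field_def xd by (intro continuous_intros bif_fun_cont zt zh)
qed (use T_pos displacement_cont f_x_nonzero x_periodic[of 0] parts_periodic displacement_nonzero \<alpha>_pos in
    \<open>auto simp: displacement_def\<close>)

section \<open>Translation operators of the approximating systems\<close>

lemma g_lipschitz_approx:
  assumes \<delta>: "0 < \<delta>"
  obtains gp C where "continuous_on UNIV (\<lambda>(t, y). gp t y)" "0 \<le> C"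
    "\<And>t y z. t \<in> {0..T} \<Longrightarrow> y \<in> cball 0 R \<Longrightarrow> z \<in> cball 0 R \<Longrightarrow> norm (gp t y - gp t z) \<le> C * norm (y - z)"
    "\<And>t y. t \<in> {0..T} \<Longrightarrow> y \<in> cball 0 R \<Longrightarrow> norm (gp t y - g t y) \<le> \<delta>"
proof -
  let ?K = "{0..T} \<times> (cball 0 R :: (real^2) set)"
  have K: "compact ?K" by (intro compact_Times) auto
  obtain p where p: "polynomial_function p" "\<And>z. z \<in> ?K \<Longrightarrow> norm ((case z of (t, y) \<Rightarrow> g t y) - p z) < \<delta>"
    using Stone_Weierstrass_polynomial_function[OF K continuous_on_subset[OF g_cont] \<delta>] by auto
  obtain C where C: "0 \<le> C" "\<And>a b. a \<in> ?K \<Longrightarrow> b \<in> ?K \<Longrightarrow> norm (p a - p b) \<le> C * norm (a - b)"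
    using polynomial_function_lipschitz[OF p(1) compact_imp_bounded[OF K]] by blast
  show ?thesis
  \<comment> \<open>The polynomial need not be periodic in \<open>t\<close>; it is used over the
    single period \<open>{0..T}\<close>.\<close>
  proof (rule that[of "\<lambda>t y. p (t, y)" C])
    show "continuous_on UNIV (\<lambda>(t, y). p (t, y))"
      using continuous_on_polymonial_function[OF p(1)] by (simp add: split_def)
    show "norm (p (t, y) - p (t, z)) \<le> C * norm (y - z)" if "t \<in> {0..T}" "y \<in> cball 0 R" "z \<in> cball 0 R" for t y z
      using C(2)[of "(t, y)" "(t, z)"] that by (simp add: norm_Pair)
    show "norm (p (t, y) - g t y) \<le> \<delta>" if "t \<in> {0..T}" "y \<in> cball 0 R" for t y
      using p(2)[of "(t, y)"] that by (simp add: norm_minus_commute)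
  qed (rule C)
qed

text \<open>The projection onto the ball turns the Lipschitz bound there into a global one, so
  solutions over the whole period exist and depend continuously on the initial value.\<close>

lemma translation_operator:
  assumes gp: "continuous_on UNIV (\<lambda>(t, y). gp t y)" and C: "0 \<le> C" and \<epsilon>: "0 \<le> \<epsilon>"
    and lip: "\<And>t y z. t \<in> {0..T} \<Longrightarrow> y \<in> cball 0 R \<Longrightarrow> z \<in> cball 0 R \<Longrightarrow> norm (gp t y - gp t z) \<le> C * norm (y - z)"
  obtains X where "\<And>\<xi>. X \<xi> 0 = \<xi>"
    "\<And>\<xi> t. t \<in> {0..T} \<Longrightarrow> (X \<xi> has_vector_derivative fh (X \<xi> t) + \<epsilon> *\<^sub>R gp t (closest_point (cball 0 R) (X \<xi> t))) (at t within {0..T})"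
    "continuous_on UNIV (\<lambda>\<xi>. X \<xi> T)"
proof -
  let ?G = "\<lambda>t y. fh y + \<epsilon> *\<^sub>R gp t (closest_point (cball 0 R) y)"
  define L' where "L' = L + \<epsilon> * C"
  have L': "0 \<le> L'" using L_pos \<epsilon> C by (simp add: L'_def)
  have Glip: "norm (?G t y - ?G t z) \<le> L' * norm (y - z)" if t: "t \<in> {0..T}" for t y z
  proof -
    have "norm (gp t (closest_point (cball 0 R) y) - gp t (closest_point (cball 0 R) z))
        \<le> C * norm (closest_point (cball 0 R) y - closest_point (cball 0 R) z)" by (rule lip[OF t proj_in proj_in])
    also have "\<dots> \<le> C * norm (y - z)" using C by (intro mult_left_mono proj_lip)
    finally have "norm (\<epsilon> *\<^sub>R (gp t (closest_point (cball 0 R) y) - gp t (closest_point (cball 0 R) z))) \<le> \<epsilon> * (C * norm (y - z))"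
      using \<epsilon> by (simp add: mult_left_mono)
    moreover have "?G t y - ?G t z = (fh y - fh z) + \<epsilon> *\<^sub>R (gp t (closest_point (cball 0 R) y) - gp t (closest_point (cball 0 R) z))"
      by (simp add: algebra_simps)
    ultimately show ?thesis
      using fh_lip[of y z] norm_triangle_ineq[of "fh y - fh z" "\<epsilon> *\<^sub>R (gp t (closest_point (cball 0 R) y) - gp t (closest_point (cball 0 R) z))"]
      by (simp add: L'_def algebra_simps)
  qed
  have Gcont: "continuous_on ({0..T} \<times> UNIV) (\<lambda>(t, y). ?G t y)"
  proof -
    have "continuous_on ({0..T} \<times> UNIV) (\<lambda>p. (\<lambda>(t, y). gp t y) (fst p, closest_point (cball 0 R) (snd p)))"
      by (rule continuous_on_compose2[OF gp])
        (auto intro!: continuous_intros continuous_on_compose2[OF proj_cont[of UNIV]])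
    then show ?thesis unfolding split_def by (auto intro!: continuous_intros)
  qed
  have "\<exists>y. y 0 = \<xi> \<and> (\<forall>t\<in>{0..T}. (y has_vector_derivative ?G t (y t)) (at t within {0..T}))" for \<xi>
    using picard_lindelof[OF T_nonneg Gcont L' Glip, of \<xi>] by metis
  then obtain X where X: "\<And>\<xi>. X \<xi> 0 = \<xi>"
    "\<And>\<xi> t. t \<in> {0..T} \<Longrightarrow> (X \<xi> has_vector_derivative ?G t (X \<xi> t)) (at t within {0..T})" by metis
  have "norm (X \<xi> T - X \<eta> T) \<le> exp (L' * T) * norm (\<xi> - \<eta>)" for \<xi> \<eta>
  proof -
    have "norm (X \<xi> T - X \<eta> T) \<le> (norm (X \<xi> 0 - X \<eta> 0) + 0 * (T - 0)) * exp (L' * (T - 0))"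
    proof (rule norm_gronwall[of 0 T L' 0 "\<lambda>t. X \<xi> t - X \<eta> t"])
      show "((\<lambda>t. X \<xi> t - X \<eta> t) has_vector_derivative ?G t (X \<xi> t) - ?G t (X \<eta> t)) (at t within {0..T})" if "t \<in> {0..T}" for t
        by (intro has_vector_derivative_diff X that)
      show "norm (?G t (X \<xi> t) - ?G t (X \<eta> t)) \<le> L' * norm (X \<xi> t - X \<eta> t) + 0" if "t \<in> {0..T}" for t
        using Glip[OF that] by simp
    qed (use T_pos L' in auto)
    then show ?thesis by (simp add: X mult.commute)
  qed
  then have "(exp (L' * T))-lipschitz_on UNIV (\<lambda>\<xi>. X \<xi> T)"
    by (intro lipschitz_onI) (auto simp: dist_norm)
  then have "continuous_on UNIV (\<lambda>\<xi>. X \<xi> T)" by (rule lipschitz_on_continuous_on)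
  then show ?thesis using that X by blast
qed

text \<open>If the translation operator of the approximating system had no fixed point in \<open>K\<close>, its field would turn
  once around the cycle, whereas near \<open>\<epsilon> = 0\<close> it turns like \<open>displacement\<close>.\<close>

lemma approximate_periodic_solution:
  assumes index: "turns T displacement \<noteq> 1"
    and et: "expands zt (\<mu> / 3) \<delta> \<epsilon>0" and eh: "expands zh (\<mu> / 3) \<delta> \<epsilon>0" and \<mu>: "0 < \<mu>"
    and low: "\<And>s \<theta>. s \<in> {0..T} \<Longrightarrow> \<theta> \<in> {0..T} \<Longrightarrow> \<mu> \<le> \<bar>bif zt s \<theta>\<bar> + \<bar>bif zh s \<theta>\<bar>"
    and B: "0 \<le> B" "\<And>t y. y \<in> cball 0 R \<Longrightarrow> norm (g t y) \<le> B"
    and one: "\<And>V. continuous_on K V \<Longrightarrow>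
      (\<And>y. y \<in> K \<Longrightarrow> V y \<noteq> 0 \<and> norm (V y - (flow y T - y)) \<le> \<kappa>) \<Longrightarrow> turns T (\<lambda>t. V (x t)) = 1"
    and \<epsilon>: "\<epsilon> \<in> {0<..<\<epsilon>0}" "\<epsilon> * (B + 1) * T * exp (L * T) \<le> \<kappa>" and \<delta>': "0 < \<delta>'" "\<delta>' \<le> 1" "\<delta>' \<le> \<delta>"
  obtains y h where "y 0 \<in> K" "y T = y 0"
    "\<And>t. t \<in> {0..T} \<Longrightarrow> (y has_vector_derivative h t) (at t within {0..T})"
    "\<And>t. t \<in> {0..T} \<Longrightarrow> norm (h t - (fh (y t) + \<epsilon> *\<^sub>R g t (closest_point (cball 0 R) (y t)))) \<le> \<epsilon> * \<delta>'"
proof -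
  let ?p = "closest_point (cball 0 R :: (real^2) set)"
  have \<epsilon>0: "0 < \<epsilon>" using \<epsilon> by auto
  obtain gp C where gp: "continuous_on UNIV (\<lambda>(t, y). gp t y)" "0 \<le> C"
    "\<And>t y z. t \<in> {0..T} \<Longrightarrow> y \<in> cball 0 R \<Longrightarrow> z \<in> cball 0 R \<Longrightarrow> norm (gp t y - gp t z) \<le> C * norm (y - z)"
    and gpg: "\<And>t y. t \<in> {0..T} \<Longrightarrow> y \<in> cball 0 R \<Longrightarrow> norm (gp t y - g t y) \<le> \<delta>'"
    using g_lipschitz_approx[OF \<delta>'(1)] by blast
  obtain X where X0: "\<And>\<xi>. X \<xi> 0 = \<xi>"
    and XD: "\<And>\<xi> t. t \<in> {0..T} \<Longrightarrow> (X \<xi> has_vector_derivative fh (X \<xi> t) + \<epsilon> *\<^sub>R gp t (?p (X \<xi> t))) (at t within {0..T})"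
    and Xc: "continuous_on UNIV (\<lambda>\<xi>. X \<xi> T)"
    using translation_operator[OF gp(1,2) less_imp_le[OF \<epsilon>0] gp(3)] by blast
  have gpB: "norm (gp t y) \<le> B + 1" if "t \<in> {0..T}" "y \<in> cball 0 R" for t y
    using gpg[OF that] B(2)[OF that(2), of t] \<delta>' norm_triangle_ineq2[of "gp t y" "g t y"] by linarith
  define V where "V \<xi> = X \<xi> T - \<xi>" for \<xi>
  have Vc: "continuous_on A V" for A
    unfolding V_def by (intro continuous_intros continuous_on_subset[OF Xc]) auto
  have V\<kappa>: "norm (V \<xi> - (flow \<xi> T - \<xi>)) \<le> \<kappa>" for \<xi>
  proof -
    have "norm (X \<xi> T - flow \<xi> T) \<le> (norm (X \<xi> 0 - flow \<xi> 0) + \<epsilon> * (B + 1) * T) * exp (L * T)"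
    proof (rule fh_gronwall[of 0 T "X \<xi>" _ "flow \<xi>", OF _ _ XD flow_deriv])
      show "norm (fh (X \<xi> t) + \<epsilon> *\<^sub>R gp t (?p (X \<xi> t)) - fh (flow \<xi> t) - (fh (X \<xi> t) - fh (flow \<xi> t))) \<le> \<epsilon> * (B + 1)"
        if "t \<in> {0..T}" for t
        using gpB[OF that proj_in, of "X \<xi> t"] \<epsilon>0 by simp
    qed (use T_pos \<epsilon>0 B in auto)
    then show ?thesis using \<epsilon>(2) by (simp add: X0 flow(1) V_def)
  qed
  \<comment> \<open>The solution from \<open>x \<theta>\<close> is made to start at time
    \<open>\<theta>\<close>, so that window and phase in \<open>expands\<close> coincide.\<close>
  have inner: "\<bar>z (\<theta> + T) \<bullet> V (x \<theta>) - \<epsilon> * bif z \<theta> \<theta>\<bar> \<le> \<epsilon> * (\<mu> / 3)"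
    if z: "expands z (\<mu> / 3) \<delta> \<epsilon>0" and \<theta>: "\<theta> \<in> {0..T}" for z \<theta>
  proof -
    define y where "y \<tau> = X (x \<theta>) (\<tau> - \<theta>)" for \<tau>
    \<comment> \<open>\<open>expands\<close> is stated for \<open>f\<close>, but the solution obeys
      \<open>fh\<close>. The difference is charged to \<open>h\<close> and vanishes near the cycle,
      where \<open>h\<close> has to be close to \<open>g\<close>.\<close>
    define h where "h \<tau> = gp (\<tau> - \<theta>) (?p (y \<tau>)) + (1 / \<epsilon>) *\<^sub>R (fh (y \<tau>) - f (y \<tau>))" for \<tau>
    have ys: "y \<theta> = x \<theta>" by (simp add: y_def X0)
    have sol: "(y has_vector_derivative f (y \<tau>) + \<epsilon> *\<^sub>R h \<tau>) (at \<tau> within {\<theta>..\<theta> + T}) \<and>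
        (norm (y \<tau> - x \<tau>) \<le> 1 \<longrightarrow> norm (h \<tau> - g (\<tau> - \<theta>) (y \<tau>)) \<le> \<delta>)" if \<tau>: "\<tau> \<in> {\<theta>..\<theta> + T}" for \<tau>
    proof
      have t: "\<tau> - \<theta> \<in> {0..T}" using \<tau> by auto
      have im: "(\<lambda>\<tau>. \<tau> - \<theta>) ` {\<theta>..\<theta> + T} \<subseteq> {0..T}" by auto
      have "((\<lambda>\<tau>. \<tau> - \<theta>) has_vector_derivative 1) (at \<tau> within {\<theta>..\<theta> + T})" by (auto intro!: derivative_eq_intros)
      moreover have "(X (x \<theta>) has_vector_derivative fh (X (x \<theta>) (\<tau> - \<theta>)) + \<epsilon> *\<^sub>R gp (\<tau> - \<theta>) (?p (X (x \<theta>) (\<tau> - \<theta>))))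
          (at (\<tau> - \<theta>) within (\<lambda>\<tau>. \<tau> - \<theta>) ` {\<theta>..\<theta> + T})"
        using XD[OF t] im by (rule has_vector_derivative_within_subset)
      ultimately have "(X (x \<theta>) \<circ> (\<lambda>\<tau>. \<tau> - \<theta>) has_vector_derivative
          1 *\<^sub>R (fh (X (x \<theta>) (\<tau> - \<theta>)) + \<epsilon> *\<^sub>R gp (\<tau> - \<theta>) (?p (X (x \<theta>) (\<tau> - \<theta>))))) (at \<tau> within {\<theta>..\<theta> + T})"
        by (rule vector_diff_chain_within)
      moreover have "X (x \<theta>) \<circ> (\<lambda>\<tau>. \<tau> - \<theta>) = y" by (simp add: y_def fun_eq_iff)
      ultimately have "(y has_vector_derivative fh (y \<tau>) + \<epsilon> *\<^sub>R gp (\<tau> - \<theta>) (?p (y \<tau>))) (at \<tau> within {\<theta>..\<theta> + T})"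
        by (simp add: y_def)
      moreover have "fh (y \<tau>) + \<epsilon> *\<^sub>R gp (\<tau> - \<theta>) (?p (y \<tau>)) = f (y \<tau>) + \<epsilon> *\<^sub>R h \<tau>"
        using \<epsilon>0 by (simp add: h_def scaleR_add_right)
      ultimately show "(y has_vector_derivative f (y \<tau>) + \<epsilon> *\<^sub>R h \<tau>) (at \<tau> within {\<theta>..\<theta> + T})" by simp
      show "norm (y \<tau> - x \<tau>) \<le> 1 \<longrightarrow> norm (h \<tau> - g (\<tau> - \<theta>) (y \<tau>)) \<le> \<delta>"
      proof
        assume "norm (y \<tau> - x \<tau>) \<le> 1"
        then have ball: "y \<tau> \<in> cball 0 R" by (rule near_in_ball)
        then have "h \<tau> = gp (\<tau> - \<theta>) (y \<tau>)" by (simp only: h_def fh_eq closest_point_self) simp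
        then show "norm (h \<tau> - g (\<tau> - \<theta>) (y \<tau>)) \<le> \<delta>" using gpg[OF t ball] \<delta>' by simp
      qed
    qed
    have yT: "y (\<theta> + T) - x \<theta> = V (x \<theta>)" by (simp add: y_def V_def)
    show ?thesis
      using z[unfolded expands_def, rule_format, of \<epsilon> \<theta> y, OF \<epsilon>(1) \<theta> ys sol] unfolding yT .
  qed
  have "\<exists>\<xi>\<in>K. V \<xi> = 0"
  proof (rule ccontr)
    assume "\<not> (\<exists>\<xi>\<in>K. V \<xi> = 0)"
    then have "turns T (\<lambda>t. V (x t)) = 1" using one[OF Vc] V\<kappa> by blast
    moreover have "turns T (\<lambda>t. (1 - 0) *\<^sub>R V (x t) + (0 * \<epsilon>) *\<^sub>R displacement t) =
        turns T (\<lambda>t. (1 - 1) *\<^sub>R V (x t) + (1 * \<epsilon>) *\<^sub>R displacement t)"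
    proof (rule turns_homotopic[OF T_nonneg])
      show "continuous_on ({0..1} \<times> {0..T}) (\<lambda>(l, t). (1 - l) *\<^sub>R V (x t) + (l * \<epsilon>) *\<^sub>R displacement t)"
        unfolding split_def
        by (intro continuous_intros continuous_on_compose2[OF Vc[of UNIV]] continuous_on_compose2[OF displacement_cont[of UNIV]]) auto
      show "(1 - l) *\<^sub>R V (x T) + (l * \<epsilon>) *\<^sub>R displacement T = (1 - l) *\<^sub>R V (x 0) + (l * \<epsilon>) *\<^sub>R displacement 0" for l :: real
        using x_periodic[of 0] displacement_periodic by simp
      fix l \<theta> :: real assume l: "l \<in> {0..1}" and \<theta>: "\<theta> \<in> {0..T}"
      show "(1 - l) *\<^sub>R V (x \<theta>) + (l * \<epsilon>) *\<^sub>R displacement \<theta> \<noteq> 0"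
      proof
        assume 0: "(1 - l) *\<^sub>R V (x \<theta>) + (l * \<epsilon>) *\<^sub>R displacement \<theta> = 0"
        \<comment> \<open>At a zero, \<open>\<epsilon> * bif z \<theta> \<theta>\<close> would
          equal, up to sign, \<open>1 - l\<close> times the expansion error of \<open>V\<close>, for
          \<open>zt\<close> and \<open>zh\<close> alike.\<close>
        have "\<bar>bif z \<theta> \<theta>\<bar> \<le> \<mu> / 3" if z: "expands z (\<mu> / 3) \<delta> \<epsilon>0" and zd: "z (\<theta> + T) \<bullet> displacement \<theta> = bif z \<theta> \<theta>" for z
        proof -
          have "z (\<theta> + T) \<bullet> ((1 - l) *\<^sub>R V (x \<theta>) + (l * \<epsilon>) *\<^sub>R displacement \<theta>) = 0" by (simp add: 0)
          then have "(1 - l) * (z (\<theta> + T) \<bullet> V (x \<theta>)) + l * \<epsilon> * bif z \<theta> \<theta> = 0" by (simp add: inner_add_right zd)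
          then have "\<epsilon> * bif z \<theta> \<theta> = - ((1 - l) * (z (\<theta> + T) \<bullet> V (x \<theta>) - \<epsilon> * bif z \<theta> \<theta>))"
            by (simp add: algebra_simps)
          then have "\<epsilon> * \<bar>bif z \<theta> \<theta>\<bar> = (1 - l) * \<bar>z (\<theta> + T) \<bullet> V (x \<theta>) - \<epsilon> * bif z \<theta> \<theta>\<bar>"
            using l \<epsilon>0 by (metis abs_minus_cancel abs_mult abs_of_nonneg abs_of_pos atLeastAtMost_iff diff_ge_0_iff_ge)
          also have "\<dots> \<le> 1 * (\<epsilon> * (\<mu> / 3))" using l inner[OF z \<theta>] by (intro mult_mono) auto
          finally show ?thesis using \<epsilon>0 by simp
        qed
        then have "\<bar>bif zt \<theta> \<theta>\<bar> \<le> \<mu> / 3" "\<bar>bif zh \<theta> \<theta>\<bar> \<le> \<mu> / 3"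
          using et eh displacement_inner_shift by blast+
        then show False using low[OF \<theta> \<theta>] \<mu> by linarith
      qed
    qed
    moreover have "turns T (\<lambda>t. \<epsilon> *\<^sub>R displacement t) = turns T displacement"
      by (rule turns_scale[OF T_nonneg displacement_cont displacement_periodic displacement_nonzero \<epsilon>0])
    ultimately show False using index by simp
  qed
  then obtain \<xi> where \<xi>: "\<xi> \<in> K" "V \<xi> = 0" by blast
  show ?thesis
  proof (rule that[of "X \<xi>" "\<lambda>t. fh (X \<xi> t) + \<epsilon> *\<^sub>R gp t (?p (X \<xi> t))"])
    show "X \<xi> 0 \<in> K" "X \<xi> T = X \<xi> 0" using \<xi> by (simp_all add: X0 V_def)
    show "norm (fh (X \<xi> t) + \<epsilon> *\<^sub>R gp t (?p (X \<xi> t)) - (fh (X \<xi> t) + \<epsilon> *\<^sub>R g t (?p (X \<xi> t)))) \<le> \<epsilon> * \<delta>'"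
      if "t \<in> {0..T}" for t
      using gpg[OF that proj_in, of "X \<xi> t"] \<epsilon>0 by (simp flip: scaleR_diff_right)
  qed (rule XD)
qed

text \<open>The collar \<open>K\<close> includes the cycle, both for the count of turns and to be
  closed under limits. That the limit is not on the cycle follows afterwards from the avoidance
  result.\<close>

lemma side_solution:
  assumes pos: "positively_oriented T x" and iso: "isolated_cycle T f x" and S: "side S"
    and index: "turns T displacement \<noteq> 1" and d: "0 < d"
  shows "\<exists>e>0. \<forall>\<epsilon>\<in>{0<..<e}. \<exists>X \<theta>. periodic_solution T (\<lambda>t y. f y + \<epsilon> *\<^sub>R g t y) X \<and> range X \<subseteq> S \<and>
    \<theta> \<in> {0..T} \<and> (\<forall>t. norm (X t - x (\<theta> + t)) \<le> d)"
proof -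
  let ?p = "closest_point (cball 0 R :: (real^2) set)"
  obtain B where B: "0 \<le> B" "\<And>t y. y \<in> cball 0 R \<Longrightarrow> norm (g t y) \<le> B" using g_bounded by blast
  obtain \<mu> \<delta> \<epsilon>0 where \<mu>: "0 < \<mu>" and \<delta>: "0 < \<delta>" and \<epsilon>0: "0 < \<epsilon>0"
    and et: "expands zt (\<mu> / 3) \<delta> \<epsilon>0" and eh: "expands zh (\<mu> / 3) \<delta> \<epsilon>0"
    and low: "\<And>s \<theta>. s \<in> {0..T} \<Longrightarrow> \<theta> \<in> {0..T} \<Longrightarrow> \<mu> \<le> \<bar>bif zt s \<theta>\<bar> + \<bar>bif zh s \<theta>\<bar>"
    using uniform_expansion by blast
  obtain \<epsilon>a where \<epsilon>a: "0 < \<epsilon>a" and avoid: "\<And>\<epsilon> X t s. \<epsilon> \<in> {0<..<\<epsilon>a} \<Longrightarrow>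
    periodic_solution T (\<lambda>t y. f y + \<epsilon> *\<^sub>R g t y) X \<Longrightarrow> X t \<noteq> x s"
    using periodic_solutions_avoid_cycle by blast
  define E where "E = exp (L * T)"
  have E: "0 < E" by (simp add: E_def)
  define dd where "dd = min d 1"
  have dd: "0 < dd" "dd \<le> d" "dd \<le> 1" using d by (auto simp: dd_def)
  \<comment> \<open>An initial distance \<open>r\<close> grows to at most \<open>dd / 2\<close>; the
    other half is left for the contribution \<open>\<epsilon> * Q\<close> of the perturbation.
    \<open>dd \<le> 1\<close> keeps the solution where the truncation changes nothing.\<close>
  define r where "r = min foot_radius (dd / (2 * E))"
  have r: "0 < r" "r \<le> foot_radius" using foot_radius dd E by (auto simp: r_def)
  have "r * E \<le> dd / (2 * E) * E" using E by (intro mult_right_mono) (auto simp: r_def)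
  then have rE: "r * E \<le> dd / 2" using E by simp
  define K where "K = tube r \<inter> (S \<union> range x)"
  obtain \<kappa> where \<kappa>: "0 < \<kappa>" and one: "\<And>V. continuous_on K V \<Longrightarrow>
      (\<And>y. y \<in> K \<Longrightarrow> V y \<noteq> 0 \<and> norm (V y - (flow y T - y)) \<le> \<kappa>) \<Longrightarrow> turns T (\<lambda>t. V (x t)) = 1"
    using side_index[OF pos iso S r] unfolding K_def by blast
  have "closed K" unfolding K_def using S by (intro closed_Int compact_imp_closed[OF tube_compact]) (simp add: side_def)
  define Q where "Q = (B + 1) * T * E"
  have Q: "0 < Q" using B T_pos E by (simp add: Q_def)
  \<comment> \<open>In turn for the expansions, the avoidance of the cycle, the closeness
    \<open>\<kappa>\<close> of the displacements, and the distance from the cycle.\<close>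
  define e where "e = Min {\<epsilon>0, \<epsilon>a, \<kappa> / Q, dd / (2 * Q)}"
  have e: "0 < e" "e \<le> \<epsilon>0" "e \<le> \<epsilon>a" "e \<le> \<kappa> / Q" "e \<le> dd / (2 * Q)"
    using \<epsilon>0 \<epsilon>a \<kappa> Q dd by (auto simp: e_def)
  show ?thesis
  proof (intro exI[of _ e] conjI ballI e(1))
    fix \<epsilon> assume \<epsilon>: "\<epsilon> \<in> {0<..<e}"
    have \<epsilon>p: "0 < \<epsilon>" and \<epsilon>e: "\<epsilon> \<in> {0<..<\<epsilon>0}" "\<epsilon> \<in> {0<..<\<epsilon>a}" using \<epsilon> e by auto
    have "\<epsilon> \<le> \<kappa> / Q" "\<epsilon> \<le> dd / (2 * Q)" using \<epsilon> e by auto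
    then have \<epsilon>Q: "\<epsilon> * Q \<le> \<kappa>" "\<epsilon> * Q \<le> dd / 2" using Q by (simp_all add: pos_le_divide_eq algebra_simps)
    define G where "G t y = fh y + \<epsilon> *\<^sub>R g t (?p y)" for t y
    have Gper: "G (t + T) y = G t y" for t y by (simp add: G_def g_per)
    have Gcont: "continuous_on ({0..T} \<times> UNIV) (\<lambda>(t, y). G t y)"
      unfolding G_def split_def
      by (intro continuous_intros continuous_on_compose2[OF proj_cont[of UNIV]]) auto
    \<comment> \<open>Accuracies that tend to 0, capped by what each single approximation
      requires.\<close>
    define \<delta>n where "\<delta>n n = min (min 1 \<delta>) (inverse (real (Suc n)))" for n
    have \<delta>n: "0 < \<delta>n n" "\<delta>n n \<le> 1" "\<delta>n n \<le> \<delta>" for n using \<delta> by (auto simp: \<delta>n_def)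
    have "\<exists>y h. y 0 \<in> K \<and> y T = y 0 \<and> (\<forall>t\<in>{0..T}. (y has_vector_derivative h t) (at t within {0..T}) \<and>
        norm (h t - G t (y t)) \<le> \<epsilon> * \<delta>n n)" for n
    proof -
      have \<epsilon>\<kappa>: "\<epsilon> * (B + 1) * T * exp (L * T) \<le> \<kappa>"
        using \<epsilon>Q(1) by (simp add: Q_def E_def mult.assoc)
      obtain y h where "y 0 \<in> K" "y T = y 0"
        "\<And>t. t \<in> {0..T} \<Longrightarrow> (y has_vector_derivative h t) (at t within {0..T})"
        "\<And>t. t \<in> {0..T} \<Longrightarrow> norm (h t - G t (y t)) \<le> \<epsilon> * \<delta>n n"
        using approximate_periodic_solution[OF index et eh \<mu> low B one \<epsilon>e(1) \<epsilon>\<kappa> \<delta>n, folded G_def] by blast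
      then show ?thesis by blast
    qed
    then obtain y h where yh: "\<And>n. y n 0 \<in> K" "\<And>n. y n T = y n 0"
      "\<And>n t. t \<in> {0..T} \<Longrightarrow> (y n has_vector_derivative h n t) (at t within {0..T})"
      "\<And>n t. t \<in> {0..T} \<Longrightarrow> norm (h n t - G t (y n t)) \<le> \<epsilon> * \<delta>n n" by metis
    have "compact (f ` cball 0 R)" by (intro compact_continuous_image f_cont) auto
    then have "bounded (f ` cball 0 R)" by (rule compact_imp_bounded)
    then obtain F where "\<forall>p\<in>f ` cball 0 R. norm p \<le> F" unfolding bounded_iff by blast
    then have F: "norm (fh y) \<le> F" for y unfolding fh_def using proj_in by blast
    have GM: "norm (G t y) \<le> F + \<epsilon> * B" for t y
      using norm_triangle_ineq[of "fh y" "\<epsilon> *\<^sub>R g t (?p y)"] F[of y] B(2)[OF proj_in, of t y] \<epsilon>p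
      by (simp add: G_def) (smt (verit) mult_left_mono)
    have "bounded K" unfolding K_def using compact_imp_bounded[OF tube_compact] by (rule bounded_subset) auto
    then obtain b where b: "\<And>p. p \<in> K \<Longrightarrow> norm p \<le> b" unfolding bounded_iff by blast
    have lim0: "(\<lambda>n. \<epsilon> * \<delta>n n) \<longlonglongrightarrow> 0"
    proof (rule Lim_null_comparison)
      show "\<forall>\<^sub>F n in sequentially. norm (\<epsilon> * \<delta>n n) \<le> \<epsilon> * inverse (real (Suc n))"
        using \<epsilon>p \<delta>n by (auto simp: abs_mult \<delta>n_def intro!: always_eventually mult_left_mono)
      show "(\<lambda>n. \<epsilon> * inverse (real (Suc n))) \<longlonglongrightarrow> 0"
        using tendsto_mult_left[OF LIMSEQ_inverse_real_of_nat, of \<epsilon>] by simp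
    qed
    obtain Y k where Y: "solves_ode_on G Y {0..T}" and conv: "\<And>t. t \<in> {0..T} \<Longrightarrow> (\<lambda>n. y (k n) t) \<longlonglongrightarrow> Y t"
      using ode_limit[OF T_nonneg Gcont GM b[OF yh(1)] yh(3) yh(4) lim0] by blast
    have Y0: "Y 0 \<in> K"
      by (rule closed_sequentially[OF \<open>closed K\<close> _ conv[of 0]]) (use yh(1) T_pos in auto)
    have YT: "Y T = Y 0"
      using LIMSEQ_unique[OF conv[of T] conv[of 0, folded yh(2)]] T_pos by auto
    obtain X where X: "periodic_solution T G X" "\<And>t. t \<in> {0..T} \<Longrightarrow> X t = Y t"
      using periodic_extension[OF T_pos, of G Y, OF Gper Y YT] by blast
    obtain \<theta>' where \<theta>': "norm (Y 0 - x \<theta>') \<le> r" using Y0 by (auto simp: K_def tube_def)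
    obtain j where j: "\<theta>' - of_int j * T \<in> {0..<T}" using mod_period by blast
    define \<theta> where "\<theta> = \<theta>' - of_int j * T"
    have \<theta>: "\<theta> \<in> {0..T}" using j by (auto simp: \<theta>_def)
    have Y\<theta>: "norm (Y 0 - x \<theta>) \<le> r" using \<theta>' x_periodic_int[of \<theta> j] by (simp add: \<theta>_def)
    have close0: "norm (Y t - x (\<theta> + t)) \<le> dd" if t: "t \<in> {0..T}" for t
    proof -
      have "norm (Y t - flow (x \<theta>) t) \<le> (norm (Y 0 - flow (x \<theta>) 0) + \<epsilon> * B * T) * exp (L * T)"
      proof (rule fh_gronwall[of 0 T Y "\<lambda>t. G t (Y t)" "flow (x \<theta>)" "\<lambda>t. fh (flow (x \<theta>) t)"])
        show "norm (G t (Y t) - fh (flow (x \<theta>) t) - (fh (Y t) - fh (flow (x \<theta>) t))) \<le> \<epsilon> * B" for t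
          using B(2)[OF proj_in, of t "Y t"] \<epsilon>p by (simp add: G_def)
        show "(Y has_vector_derivative G t (Y t)) (at t within {0..T})" if "t \<in> {0..T}" for t
          using Y that by (simp add: solves_ode_on_def)
      qed (use T_pos \<epsilon>p B flow_deriv t in auto)
      also have "\<dots> \<le> (r + \<epsilon> * (B + 1) * T) * E"
        unfolding E_def flow(1) using Y\<theta> \<epsilon>p T_pos by (intro mult_right_mono add_mono mult_left_mono) auto
      also have "\<dots> = r * E + \<epsilon> * Q" by (simp add: Q_def algebra_simps)
      also have "\<dots> \<le> dd" using rE \<epsilon>Q(2) by linarith
      finally show ?thesis by (simp add: flow_x[OF t])
    qed
    have close: "norm (X t - x (\<theta> + t)) \<le> dd" for t
    proof -
      obtain i where i: "t - of_int i * T \<in> {0..<T}" using mod_period by blast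
      have "X (t + T) = X t" for t using X(1) by (simp add: periodic_solution_def)
      from periodic_int[of X, OF this, of "t - of_int i * T" i]
      have "X t = Y (t - of_int i * T)" using X(2)[of "t - of_int i * T"] i by simp
      moreover have "x (\<theta> + t) = x (\<theta> + (t - of_int i * T))"
        using x_periodic_int[of "\<theta> + (t - of_int i * T)" i] by (simp add: algebra_simps)
      ultimately show ?thesis using close0[of "t - of_int i * T"] i by simp
    qed
    \<comment> \<open>Within \<open>dd\<close> of the cycle \<open>X\<close> stays in the ball, so
      it solves the system without truncation.\<close>
    have "G t (X t) = f (X t) + \<epsilon> *\<^sub>R g t (X t)" for t
    proof -
      have "X t \<in> cball 0 R" using close[of t] dd near_in_ball by (meson order_trans)
      then show ?thesis by (simp only: G_def fh_eq closest_point_self)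
    qed
    then have sol: "periodic_solution T (\<lambda>t y. f y + \<epsilon> *\<^sub>R g t y) X"
      using X(1) by (simp add: periodic_solution_def solves_ode_on_def)
    have off: "X t \<notin> range x" for t using avoid[OF \<epsilon>e(2) sol] by blast
    have "X 0 \<in> S" using Y0 X(2)[of 0] off[of 0] T_pos by (auto simp: K_def)
    moreover have "continuous_on UNIV X"
      using X(1) by (auto simp: periodic_solution_def solves_ode_on_def intro: continuous_on_vector_derivative)
    then have "connected (range X)" by (intro connected_continuous_image) auto
    ultimately have "range X \<subseteq> S" using side_connected[OF S, of "range X" "X 0"] off by blast
    then show "\<exists>X \<theta>. periodic_solution T (\<lambda>t y. f y + \<epsilon> *\<^sub>R g t y) X \<and> range X \<subseteq> S \<and>
      \<theta> \<in> {0..T} \<and> (\<forall>t. norm (X t - x (\<theta> + t)) \<le> d)"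
      using sol \<theta> close dd(2) by (meson order_trans)
  qed
qed

lemma side_family:
  assumes pos: "positively_oriented T x" and iso: "isolated_cycle T f x" and S: "side S"
    and index: "turns T displacement \<noteq> 1"
  obtains e X \<theta> where "0 < e" "tends_to_shifts T x X \<theta>"
    "\<And>\<epsilon>. \<epsilon> \<in> {0<..<e} \<Longrightarrow> periodic_solution T (\<lambda>t y. f y + \<epsilon> *\<^sub>R g t y) (X \<epsilon>) \<and> range (X \<epsilon>) \<subseteq> S"
proof -
  let ?Q = "\<lambda>\<epsilon> d (X, \<theta>). periodic_solution T (\<lambda>t y. f y + \<epsilon> *\<^sub>R g t y) X \<and> range X \<subseteq> S \<and>
    \<theta> \<in> {0..T} \<and> (\<forall>t. norm (X t - x (\<theta> + t)) \<le> d)"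
  obtain e F D where e: "0 < e" and F: "\<And>\<epsilon>. \<epsilon> \<in> {0<..<e} \<Longrightarrow> ?Q \<epsilon> (D \<epsilon>) (F \<epsilon>)"
    and D: "(D \<longlongrightarrow> (0::real)) (at_right 0)"
  proof (rule shrinking_selection[of ?Q])
    show "?Q \<epsilon> d' X" if "?Q \<epsilon> d X" "d \<le> d'" for \<epsilon> d d' X
      using that by (auto split: prod.splits intro: order_trans)
    show "\<exists>e>0. \<forall>\<epsilon>\<in>{0<..<e}. \<exists>X. ?Q \<epsilon> d X" if "0 < d" for d
      using side_solution[OF pos iso S index that] by simp
  qed blast
  \<comment> \<open>The value 0 outside the range of the selection is a default:
    \<open>tends_to_shifts\<close> demands phases in \<open>{0..T}\<close> for every
    \<epsilon>.\<close>
  define \<theta> where "\<theta> \<epsilon> = (if \<epsilon> \<in> {0<..<e} then snd (F \<epsilon>) else 0)" for \<epsilon>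
  have FX: "periodic_solution T (\<lambda>t y. f y + \<epsilon> *\<^sub>R g t y) (fst (F \<epsilon>))" "range (fst (F \<epsilon>)) \<subseteq> S"
    "\<theta> \<epsilon> \<in> {0..T}" "\<And>t. norm (fst (F \<epsilon>) t - x (\<theta> \<epsilon> + t)) \<le> D \<epsilon>" if "\<epsilon> \<in> {0<..<e}" for \<epsilon>
    using F[OF that] that by (auto simp: \<theta>_def split: prod.splits)
  show ?thesis
  proof (rule that[OF e, of "\<lambda>\<epsilon>. fst (F \<epsilon>)" \<theta>])
    show "tends_to_shifts T x (\<lambda>\<epsilon>. fst (F \<epsilon>)) \<theta>"
      unfolding tends_to_shifts_def
    proof (intro conjI allI)
      show "\<theta> \<epsilon> \<in> {0..T}" for \<epsilon> using FX(3)[of \<epsilon>] T_pos by (auto simp: \<theta>_def)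
      show "((\<lambda>\<epsilon>. fst (F \<epsilon>) t - x (\<theta> \<epsilon> + t)) \<longlongrightarrow> 0) (at_right 0)" for t
      proof (rule Lim_null_comparison[OF _ D])
        show "\<forall>\<^sub>F \<epsilon> in at_right 0. norm (fst (F \<epsilon>) t - x (\<theta> \<epsilon> + t)) \<le> D \<epsilon>"
          unfolding eventually_at_right_field using e FX(4) by (intro exI[of _ e]) auto
      qed
    qed
  qed (use FX in auto)
qed

end

theorem theorem2p1:
  fixes f :: "real^2 \<Rightarrow> real^2" and f' :: "real^2 \<Rightarrow> real^2^2"
    and g :: "real \<Rightarrow> real^2 \<Rightarrow> real^2"
    and xt zt zh :: "real \<Rightarrow> real^2" and T :: real
  defines "ME \<equiv> bif_fun T g xt zt" and "MA \<equiv> bif_fun T g xt zh"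
  assumes f_deriv: "\<And>x. (f has_derivative (\<lambda>h. f' x *v h)) (at x)"
    and f'_cont: "continuous_on UNIV f'"
    and f_global: "solutions_extend f"
    and cyc: "cycle T f xt"
    and pos: "positively_oriented T xt"
    and g_cont: "continuous_on UNIV (\<lambda>(t, x). g t x)"
    and g_per: "\<And>t x. g (t + T) x = g t x"
    and zt: "adjoint_solution (\<lambda>t. f' (xt t)) zt"
    and zt0: "zt 0 = perp (vector_derivative xt (at 0))"
    and zh: "adjoint_solution (\<lambda>t. f' (xt t)) zh"
    and zh0: "zh 0 = vector_derivative xt (at 0) /\<^sub>R (norm (vector_derivative xt (at 0)))\<^sup>2"
    and C: "isolated_cycle T f xt"
    and A: "\<And>s \<theta>. s \<in> {0..T} \<Longrightarrow> \<theta> \<in> {0..T} \<Longrightarrow> ME s \<theta> = 0 \<Longrightarrow> MA s \<theta> \<noteq> 0"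
  shows
    "(\<exists>\<epsilon>0>0. \<forall>\<epsilon>\<in>{0<..<\<epsilon>0}. \<forall>x.
        periodic_solution T (\<lambda>t x. f x + \<epsilon> *\<^sub>R g t x) x \<longrightarrow> avoids_cycle T xt x) \<and>
     (poincare_index T (Phi_field T g xt zt zh) \<noteq> 1 \<longrightarrow>
       (\<exists>\<epsilon>0>0. \<exists>x1 x2 \<theta>1 \<theta>2.
          (\<forall>\<epsilon>\<in>{0<..<\<epsilon>0}.
             periodic_solution T (\<lambda>t x. f x + \<epsilon> *\<^sub>R g t x) (x1 \<epsilon>) \<and>
             periodic_solution T (\<lambda>t x. f x + \<epsilon> *\<^sub>R g t x) (x2 \<epsilon>) \<and>
             x1 \<epsilon> \<noteq> x2 \<epsilon> \<and>
             avoids_cycle T xt (x1 \<epsilon>) \<and> avoids_cycle T xt (x2 \<epsilon>) \<and>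
             range (x1 \<epsilon>) \<subseteq> inside (range xt) \<and>
             range (x2 \<epsilon>) \<subseteq> outside (range xt)) \<and>
          tends_to_shifts T xt x1 \<theta>1 \<and> tends_to_shifts T xt x2 \<theta>2))"
proof -
  have T: "0 < T" and per: "xt (t + T) = xt t" and der: "(xt has_vector_derivative f (xt t)) (at t)" for t
    using cyc by (simp_all add: cycle_def periodic_solution_def solves_ode_on_def)
  have "continuous_on {0..T} xt"
    using der by (meson continuous_at_imp_continuous_on has_vector_derivative_continuous)
  then have "bounded (xt ` {0..T})" by (intro compact_imp_bounded compact_continuous_image) auto
  then obtain b where "\<forall>p\<in>xt ` {0..T}. norm p \<le> b" unfolding bounded_iff by blast
  then have b: "norm (xt t) \<le> b" if "t \<in> {0..T}" for t using that by blast
  \<comment> \<open>Periodicity extends the bound \<open>b\<close> to all times, and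
    \<open>b + 1\<close> supplies the margin required by \<open>x_ball\<close>.\<close>
  have ball: "norm (xt t) + 1 \<le> b + 1" for t
  proof -
    have "t - of_int \<lfloor>t / T\<rfloor> * T \<in> {0..T}"
      using floor_divide_lower[OF T, of t] floor_divide_upper[OF T, of t] by (auto simp: algebra_simps)
    from b[OF this] show ?thesis using periodic_int[of xt, OF per, of "t - of_int \<lfloor>t / T\<rfloor> * T" "\<lfloor>t / T\<rfloor>"] by simp
  qed
  obtain L where L: "0 < L"
    "\<And>y z. y \<in> cball 0 (b + 1) \<Longrightarrow> z \<in> cball 0 (b + 1) \<Longrightarrow> norm (f y - f z) \<le> L * norm (y - z)"
    "\<And>y h. y \<in> cball 0 (b + 1) \<Longrightarrow> norm (f' y *v h) \<le> L * norm h"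
    using C1_lipschitz_on_cball[OF f_deriv f'_cont, of "b + 1"] by blast
  have vd: "vector_derivative xt (at 0) = f (xt 0)" using der by (rule vector_derivative_at)
  interpret nondegenerate_cycle f f' xt T "b + 1" L g zt zh
    by unfold_locales
      (use f_deriv f'_cont cyc pos ball L g_cont g_per zt zh zt0 zh0 vd A in
        \<open>auto simp: positively_oriented_def ME_def MA_def\<close>)
  obtain e where e: "0 < e" and avoid: "\<And>\<epsilon> X t s. \<epsilon> \<in> {0<..<e} \<Longrightarrow>
    periodic_solution T (\<lambda>t y. f y + \<epsilon> *\<^sub>R g t y) X \<Longrightarrow> X t \<noteq> xt s"
    using periodic_solutions_avoid_cycle by blast
  show ?thesis
  proof (intro conjI impI)
    show "\<exists>\<epsilon>0>0. \<forall>\<epsilon>\<in>{0<..<\<epsilon>0}. \<forall>x.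
        periodic_solution T (\<lambda>t x. f x + \<epsilon> *\<^sub>R g t x) x \<longrightarrow> avoids_cycle T xt x"
      using e avoid unfolding avoids_cycle_def by blast
    assume "poincare_index T (Phi_field T g xt zt zh) \<noteq> 1"
    then have index: "turns T displacement \<noteq> 1" by (simp add: turns_displacement)
    obtain e1 x1 \<theta>1 where 1: "0 < e1" "tends_to_shifts T xt x1 \<theta>1"
      "\<And>\<epsilon>. \<epsilon> \<in> {0<..<e1} \<Longrightarrow> periodic_solution T (\<lambda>t y. f y + \<epsilon> *\<^sub>R g t y) (x1 \<epsilon>) \<and> range (x1 \<epsilon>) \<subseteq> inside (range xt)"
      using side_family[OF pos C side_inside index] by blast
    obtain e2 x2 \<theta>2 where 2: "0 < e2" "tends_to_shifts T xt x2 \<theta>2"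
      "\<And>\<epsilon>. \<epsilon> \<in> {0<..<e2} \<Longrightarrow> periodic_solution T (\<lambda>t y. f y + \<epsilon> *\<^sub>R g t y) (x2 \<epsilon>) \<and> range (x2 \<epsilon>) \<subseteq> outside (range xt)"
      using side_family[OF pos C side_outside index] by blast
    show "\<exists>\<epsilon>0>0. \<exists>x1 x2 \<theta>1 \<theta>2.
          (\<forall>\<epsilon>\<in>{0<..<\<epsilon>0}.
             periodic_solution T (\<lambda>t x. f x + \<epsilon> *\<^sub>R g t x) (x1 \<epsilon>) \<and>
             periodic_solution T (\<lambda>t x. f x + \<epsilon> *\<^sub>R g t x) (x2 \<epsilon>) \<and>
             x1 \<epsilon> \<noteq> x2 \<epsilon> \<and>
             avoids_cycle T xt (x1 \<epsilon>) \<and> avoids_cycle T xt (x2 \<epsilon>) \<and>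
             range (x1 \<epsilon>) \<subseteq> inside (range xt) \<and>
             range (x2 \<epsilon>) \<subseteq> outside (range xt)) \<and>
          tends_to_shifts T xt x1 \<theta>1 \<and> tends_to_shifts T xt x2 \<theta>2"
    proof (rule exI[of _ "min e1 e2"], rule conjI, use 1 2 in simp, rule exI[of _ x1], rule exI[of _ x2],
        rule exI[of _ \<theta>1], rule exI[of _ \<theta>2], intro conjI ballI)
      fix \<epsilon> assume "\<epsilon> \<in> {0<..<min e1 e2}"
      then have s: "periodic_solution T (\<lambda>t y. f y + \<epsilon> *\<^sub>R g t y) (x1 \<epsilon>)" "range (x1 \<epsilon>) \<subseteq> inside (range xt)"
        "periodic_solution T (\<lambda>t y. f y + \<epsilon> *\<^sub>R g t y) (x2 \<epsilon>)" "range (x2 \<epsilon>) \<subseteq> outside (range xt)"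
        using 1(3)[of \<epsilon>] 2(3)[of \<epsilon>] by auto
      then show "periodic_solution T (\<lambda>t y. f y + \<epsilon> *\<^sub>R g t y) (x1 \<epsilon>)" "range (x1 \<epsilon>) \<subseteq> inside (range xt)"
        "periodic_solution T (\<lambda>t y. f y + \<epsilon> *\<^sub>R g t y) (x2 \<epsilon>)" "range (x2 \<epsilon>) \<subseteq> outside (range xt)"
        by simp_all
      \<comment> \<open>Distinctness and avoidance follow from the positions: inside, outside and
        the cycle are pairwise disjoint.\<close>
      have in1: "x1 \<epsilon> t \<in> inside (range xt)" and in2: "x2 \<epsilon> t \<in> outside (range xt)" for t using s by auto
      show "x1 \<epsilon> \<noteq> x2 \<epsilon>" using in1[of 0] in2[of 0] inside_Int_outside[of "range xt"] by (metis IntI empty_iff)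
      show "avoids_cycle T xt (x1 \<epsilon>)"
        using in1 inside_no_overlap[of "range xt"] unfolding avoids_cycle_def by (metis disjoint_iff rangeI)
      show "avoids_cycle T xt (x2 \<epsilon>)"
        using in2 outside_no_overlap[of "range xt"] unfolding avoids_cycle_def by (metis disjoint_iff rangeI)
    qed (use 1 2 in auto)
  qed
qed

end
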